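(* Let $T_0, T_1$ be recursively enumerable theories extending $\mathbf{I\Sigma_1}$, and let $\tau_0(v)$, $\tau_1(v)$ be $\Sigma_1$ definitions of $T_0$ and $T_1$, respectively. The following are equivalent: (1) $\mathrm{QPL}^{\Sigma_1}_{\tau_0}(T_0) \subseteq \mathrm{QPL}^{\Sigma_1}_{\tau_1}(T_1)$; (2) $\mathrm{Th}(T_0) \subseteq \mathrm{Th}(T_1)$, and for every $\mathcal{L}_A$-formula $\varphi(\vec{x})$, \[ T_1 \vdash \forall \vec{x}\,\bigl(\mathrm{Pr}_{\tau_0}(\ulcorner \varphi(\vec{\dot{x}})\urcorner) \leftrightarrow \mathrm{Pr}_{\tau_1}(\ulcorner \varphi(\vec{\dot{x}})\urcorner)\bigr). \]
   Context: $\mathcal{L}_A=\{0,S,+,\times,<,=\}$ is the language of arithmetic; a theory is a set of $\mathcal{L}_A$-sentences, and $\mathrm{Th}(T)$ is the set of $\mathcal{L}_A$-sentences provable in $T$. $\mathbf{I\Sigma_1}$ is Peano arithmetic with induction restricted to $\Sigma_1$ formulas. A formula $\tau(v)$ is a definition of $T$ if for every natural number $n$, $\mathbb{N}\models\tau(\overline{n})$ iff $n$ is the Gödel number of an axiom of $T$. For a $\Sigma_1$ definition $\tau$, $\mathrm{Pr}_\tau(x)$ is the standard $\Sigma_1$ provability predicate "$x$ is provable in the theory defined by $\tau$". $\ulcorner\varphi(\vec{\dot{x}})\urcorner$ denotes the primitive recursive term computing the Gödel number of $\varphi(\overline{k_1},\dots,\overline{k_n})$ from the values $k_1,\dots,k_n$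 of $\vec x$. The language of quantified modal logic is first-order predicate logic without function or constant symbols, with modal operators $\Box$ and $\Diamond$ (sharing variables with $\mathcal{L}_A$). An arithmetical interpretation $f$ maps each atomic modal formula $P(x_1,\dots,x_n)$ to an $\mathcal{L}_A$-formula $\varphi(x_1,\dots,x_n)$ with the same free variables, such that $f(P(y_1,\dots,y_n))$ is $\varphi(y_1,\dots,y_n)$ for all variables $y_i$. It extends to $f_\tau$ on all modal formulas: $f_\tau(\bot)$ is $0=\overline{1}$; $f_\tau$ commutes with propositional connectives and quantifiers; $f_\tau(\Box A(x_1,\dots,x_n))$ is $\mathrm{Pr}_\tau(\ulcorner f_\tau(A(\dot{x}_1,\dots,\dot{x}_n))\urcorner)$. $f$ is $\Sigma_1$ if $f(P(\vec x))$ is a $\Sigma_1$ formula for every atomic $P(\vec x)$. $\mathrm{QPL}^{\Sigma_1}_\tau(T)$ is the set of modal sentences $A$ such that $T\vdash f_\tau(A)$ for every $\Sigma_1$ arithmetical interpretation $f$. *)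

theory Defs
  imports Main "HOL-Library.Nat_Bijection"
begin

section \<open>The language of arithmetic\<close>

text \<open>Variables are de Bruijn indices throughout, in arithmetical as well as in modal formulas, so
  formulas are identified up to renaming of bound variables. A free variable \<open>i\<close> is \<open>Var (i + n)\<close>
  below \<open>n\<close> quantifiers.\<close>

datatype tm = Var nat | Zero | Succ tm | Plus tm tm | Times tm tm

datatype fm = Eq tm tm | Lt tm tm | Neg fm | Imp fm fm | Forall fm

abbreviation Conj :: "fm \<Rightarrow> fm \<Rightarrow> fm" where "Conj \<phi> \<psi> \<equiv> Neg (Imp \<phi> (Neg \<psi>))"
abbreviation Disj :: "fm \<Rightarrow> fm \<Rightarrow> fm" where "Disj \<phi> \<psi> \<equiv> Imp (Neg \<phi>) \<psi>"
abbreviation Iff :: "fm \<Rightarrow> fm \<Rightarrow> fm" where "Iff \<phi> \<psi> \<equiv> Conj (Imp \<phi> \<psi>) (Imp \<psi> \<phi>)"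
abbreviation Exists :: "fm \<Rightarrow> fm" where "Exists \<phi> \<equiv> Neg (Forall (Neg \<phi>))"

fun fv_tm :: "tm \<Rightarrow> nat set" where
  "fv_tm (Var i) = {i}"
| "fv_tm Zero = {}"
| "fv_tm (Succ t) = fv_tm t"
| "fv_tm (Plus s t) = fv_tm s \<union> fv_tm t"
| "fv_tm (Times s t) = fv_tm s \<union> fv_tm t"

fun fv :: "fm \<Rightarrow> nat set" where
  "fv (Eq s t) = fv_tm s \<union> fv_tm t"
| "fv (Lt s t) = fv_tm s \<union> fv_tm t"
| "fv (Neg \<phi>) = fv \<phi>"
| "fv (Imp \<phi> \<psi>) = fv \<phi> \<union> fv \<psi>"
| "fv (Forall \<phi>) = {i. Suc i \<in> fv \<phi>}"

definition sentence :: "fm \<Rightarrow> bool" where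
  "sentence \<phi> \<longleftrightarrow> fv \<phi> = {}"

text \<open>Quantifying all indices below a bound on the free ones; some of the quantifiers may be vacuous.\<close>

definition univ_closure :: "fm \<Rightarrow> fm" where
  "univ_closure \<phi> = (Forall ^^ (LEAST n. fv \<phi> \<subseteq> {..<n})) \<phi>"

fun lift_tm :: "nat \<Rightarrow> tm \<Rightarrow> tm" where
  "lift_tm k (Var i) = Var (if i < k then i else Suc i)"
| "lift_tm k Zero = Zero"
| "lift_tm k (Succ t) = Succ (lift_tm k t)"
| "lift_tm k (Plus s t) = Plus (lift_tm k s) (lift_tm k t)"
| "lift_tm k (Times s t) = Times (lift_tm k s) (lift_tm k t)"

fun lift :: "nat \<Rightarrow> fm \<Rightarrow> fm" where
  "lift k (Eq s t) = Eq (lift_tm k s) (lift_tm k t)"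
| "lift k (Lt s t) = Lt (lift_tm k s) (lift_tm k t)"
| "lift k (Neg \<phi>) = Neg (lift k \<phi>)"
| "lift k (Imp \<phi> \<psi>) = Imp (lift k \<phi>) (lift k \<psi>)"
| "lift k (Forall \<phi>) = Forall (lift (Suc k) \<phi>)"

text \<open>\<open>sub k u \<phi>\<close> puts \<open>u\<close> for variable \<open>k\<close> and closes the gap in the numbering; so the
  instance of \<open>Forall \<phi>\<close> at \<open>u\<close> is \<open>sub 0 u \<phi>\<close>.\<close>

fun sub_tm :: "nat \<Rightarrow> tm \<Rightarrow> tm \<Rightarrow> tm" where
  "sub_tm k u (Var i) = (if i < k then Var i else if i = k then u else Var (i - 1))"
| "sub_tm k u Zero = Zero"
| "sub_tm k u (Succ t) = Succ (sub_tm k u t)"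
| "sub_tm k u (Plus s t) = Plus (sub_tm k u s) (sub_tm k u t)"
| "sub_tm k u (Times s t) = Times (sub_tm k u s) (sub_tm k u t)"

fun sub :: "nat \<Rightarrow> tm \<Rightarrow> fm \<Rightarrow> fm" where
  "sub k u (Eq s t) = Eq (sub_tm k u s) (sub_tm k u t)"
| "sub k u (Lt s t) = Lt (sub_tm k u s) (sub_tm k u t)"
| "sub k u (Neg \<phi>) = Neg (sub k u \<phi>)"
| "sub k u (Imp \<phi> \<psi>) = Imp (sub k u \<phi>) (sub k u \<psi>)"
| "sub k u (Forall \<phi>) = Forall (sub (Suc k) (lift_tm 0 u) \<phi>)"

text \<open>Simultaneous capture-avoiding substitution for all free variables.\<close>

fun psubst_tm :: "(nat \<Rightarrow> tm) \<Rightarrow> tm \<Rightarrow> tm" where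
  "psubst_tm \<sigma> (Var i) = \<sigma> i"
| "psubst_tm \<sigma> Zero = Zero"
| "psubst_tm \<sigma> (Succ t) = Succ (psubst_tm \<sigma> t)"
| "psubst_tm \<sigma> (Plus s t) = Plus (psubst_tm \<sigma> s) (psubst_tm \<sigma> t)"
| "psubst_tm \<sigma> (Times s t) = Times (psubst_tm \<sigma> s) (psubst_tm \<sigma> t)"

fun psubst :: "(nat \<Rightarrow> tm) \<Rightarrow> fm \<Rightarrow> fm" where
  "psubst \<sigma> (Eq s t) = Eq (psubst_tm \<sigma> s) (psubst_tm \<sigma> t)"
| "psubst \<sigma> (Lt s t) = Lt (psubst_tm \<sigma> s) (psubst_tm \<sigma> t)"
| "psubst \<sigma> (Neg \<phi>) = Neg (psubst \<sigma> \<phi>)"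
| "psubst \<sigma> (Imp \<phi> \<psi>) = Imp (psubst \<sigma> \<phi>) (psubst \<sigma> \<psi>)"
| "psubst \<sigma> (Forall \<phi>) = Forall (psubst (case_nat (Var 0) (\<lambda>i. lift_tm 0 (\<sigma> i))) \<phi>)"

definition num :: "nat \<Rightarrow> tm" where
  "num n = (Succ ^^ n) Zero"


section \<open>The standard model\<close>

fun eval_tm :: "(nat \<Rightarrow> nat) \<Rightarrow> tm \<Rightarrow> nat" where
  "eval_tm e (Var i) = e i"
| "eval_tm e Zero = 0"
| "eval_tm e (Succ t) = Suc (eval_tm e t)"
| "eval_tm e (Plus s t) = eval_tm e s + eval_tm e t"
| "eval_tm e (Times s t) = eval_tm e s * eval_tm e t"

fun sat :: "(nat \<Rightarrow> nat) \<Rightarrow> fm \<Rightarrow> bool" where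
  "sat e (Eq s t) \<longleftrightarrow> eval_tm e s = eval_tm e t"
| "sat e (Lt s t) \<longleftrightarrow> eval_tm e s < eval_tm e t"
| "sat e (Neg \<phi>) \<longleftrightarrow> \<not> sat e \<phi>"
| "sat e (Imp \<phi> \<psi>) \<longleftrightarrow> (sat e \<phi> \<longrightarrow> sat e \<psi>)"
| "sat e (Forall \<phi>) \<longleftrightarrow> (\<forall>n. sat (case_nat n e) \<phi>)"

definition true_in_N :: "fm \<Rightarrow> bool" where
  "true_in_N \<phi> \<longleftrightarrow> (\<forall>e. sat e \<phi>)"


section \<open>Bounded and existential formulas\<close>

inductive delta0 :: "fm \<Rightarrow> bool" where
  "delta0 (Eq s t)"
| "delta0 (Lt s t)"
| "delta0 \<phi> \<Longrightarrow> delta0 (Neg \<phi>)"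
| "delta0 \<phi> \<Longrightarrow> delta0 \<psi> \<Longrightarrow> delta0 (Imp \<phi> \<psi>)"
| "delta0 \<phi> \<Longrightarrow> delta0 (Forall (Imp (Lt (Var 0) (lift_tm 0 t)) \<phi>))"
| "delta0 \<phi> \<Longrightarrow> delta0 (Exists (Conj (Lt (Var 0) (lift_tm 0 t)) \<phi>))"

inductive sigma1 :: "fm \<Rightarrow> bool" where
  "delta0 \<phi> \<Longrightarrow> sigma1 \<phi>"
| "sigma1 \<phi> \<Longrightarrow> sigma1 (Exists \<phi>)"


section \<open>Provability\<close>

definition equality_axioms :: "fm list" where
  "equality_axioms =
    [Eq (Var 0) (Var 0),
     Imp (Eq (Var 0) (Var 1)) (Imp (Eq (Var 0) (Var 2)) (Eq (Var 1) (Var 2))),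
     Imp (Eq (Var 0) (Var 1)) (Eq (Succ (Var 0)) (Succ (Var 1))),
     Imp (Eq (Var 0) (Var 1)) (Imp (Eq (Var 2) (Var 3))
       (Eq (Plus (Var 0) (Var 2)) (Plus (Var 1) (Var 3)))),
     Imp (Eq (Var 0) (Var 1)) (Imp (Eq (Var 2) (Var 3))
       (Eq (Times (Var 0) (Var 2)) (Times (Var 1) (Var 3)))),
     Imp (Eq (Var 0) (Var 1)) (Imp (Eq (Var 2) (Var 3))
       (Imp (Lt (Var 0) (Var 2)) (Lt (Var 1) (Var 3))))]"

text \<open>A Hilbert-style calculus. In the rule \<open>gen\<close>, lifting \<open>\<chi>\<close> expresses that the
  generalized variable is not free in \<open>\<chi>\<close>.\<close>

inductive proves :: "fm set \<Rightarrow> fm \<Rightarrow> bool" (infix "\<turnstile>" 50) for T :: "fm set" where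
  ax: "\<phi> \<in> T \<Longrightarrow> T \<turnstile> \<phi>"
| ax_K: "T \<turnstile> Imp \<phi> (Imp \<psi> \<phi>)"
| ax_S: "T \<turnstile> Imp (Imp \<phi> (Imp \<psi> \<chi>)) (Imp (Imp \<phi> \<psi>) (Imp \<phi> \<chi>))"
| ax_N: "T \<turnstile> Imp (Imp (Neg \<phi>) (Neg \<psi>)) (Imp \<psi> \<phi>)"
| ax_All: "T \<turnstile> Imp (Forall \<phi>) (sub 0 t \<phi>)"
| ax_Eq: "\<phi> \<in> set equality_axioms \<Longrightarrow> T \<turnstile> \<phi>"
| mp: "T \<turnstile> Imp \<phi> \<psi> \<Longrightarrow> T \<turnstile> \<phi> \<Longrightarrow> T \<turnstile> \<psi>"
| gen: "T \<turnstile> Imp (lift 0 \<chi>) \<phi> \<Longrightarrow> T \<turnstile> Imp \<chi> (Forall \<phi>)"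

definition is_theory :: "fm set \<Rightarrow> bool" where
  "is_theory T \<longleftrightarrow> (\<forall>\<phi>\<in>T. sentence \<phi>)"

definition Th :: "fm set \<Rightarrow> fm set" where
  "Th T = {\<phi>. sentence \<phi> \<and> T \<turnstile> \<phi>}"

definition Q_axioms :: "fm list" where
  "Q_axioms =
    [Neg (Eq (Succ (Var 0)) Zero),
     Imp (Eq (Succ (Var 0)) (Succ (Var 1))) (Eq (Var 0) (Var 1)),
     Imp (Neg (Eq (Var 0) Zero)) (Exists (Eq (Var 1) (Succ (Var 0)))),
     Eq (Plus (Var 0) Zero) (Var 0),
     Eq (Plus (Var 0) (Succ (Var 1))) (Succ (Plus (Var 0) (Var 1))),
     Eq (Times (Var 0) Zero) Zero,
     Eq (Times (Var 0) (Succ (Var 1))) (Plus (Times (Var 0) (Var 1)) (Var 0)),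
     Neg (Lt (Var 0) Zero),
     Iff (Lt (Var 0) (Succ (Var 1))) (Disj (Lt (Var 0) (Var 1)) (Eq (Var 0) (Var 1)))]"

definition induction_axiom :: "fm \<Rightarrow> fm" where
  "induction_axiom \<phi> =
    Imp (Conj (sub 0 Zero \<phi>) (Forall (Imp \<phi> (psubst (Var(0 := Succ (Var 0))) \<phi>)))) (Forall \<phi>)"

definition ISigma1 :: "fm set" where
  "ISigma1 = univ_closure ` (set Q_axioms \<union> {induction_axiom \<phi> | \<phi>. sigma1 \<phi>})"


section \<open>Goedel numbers, recursive enumerability, definitions of theories\<close>

fun gn_tm :: "tm \<Rightarrow> nat" where
  "gn_tm (Var i) = prod_encode (0, i)"
| "gn_tm Zero = prod_encode (1, 0)"
| "gn_tm (Succ t) = prod_encode (2, gn_tm t)"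
| "gn_tm (Plus s t) = prod_encode (3, prod_encode (gn_tm s, gn_tm t))"
| "gn_tm (Times s t) = prod_encode (4, prod_encode (gn_tm s, gn_tm t))"

fun gn :: "fm \<Rightarrow> nat" where
  "gn (Eq s t) = prod_encode (5, prod_encode (gn_tm s, gn_tm t))"
| "gn (Lt s t) = prod_encode (6, prod_encode (gn_tm s, gn_tm t))"
| "gn (Neg \<phi>) = prod_encode (7, gn \<phi>)"
| "gn (Imp \<phi> \<psi>) = prod_encode (8, prod_encode (gn \<phi>, gn \<psi>))"
| "gn (Forall \<phi>) = prod_encode (9, gn \<phi>)"

text \<open>\<open>recursive_fn n f\<close>: on lists of length \<open>n\<close>, \<open>f\<close> is a total recursive function of \<open>n\<close> arguments.\<close>

inductive recursive_fn :: "nat \<Rightarrow> (nat list \<Rightarrow> nat) \<Rightarrow> bool" where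
  zero: "recursive_fn n (\<lambda>_. 0)"
| succ: "recursive_fn 1 (\<lambda>xs. Suc (xs ! 0))"
| proj: "i < n \<Longrightarrow> recursive_fn n (\<lambda>xs. xs ! i)"
| comp: "recursive_fn (length gs) f \<Longrightarrow> \<forall>g\<in>set gs. recursive_fn n g
    \<Longrightarrow> recursive_fn n (\<lambda>xs. f (map (\<lambda>g. g xs) gs))"
| prec: "recursive_fn n f \<Longrightarrow> recursive_fn (n + 2) g
    \<Longrightarrow> recursive_fn (Suc n)
          (\<lambda>xs. rec_nat (f (tl xs)) (\<lambda>y r. g (y # r # tl xs)) (hd xs))"
| mu: "recursive_fn (Suc n) f \<Longrightarrow> \<forall>xs. length xs = n \<longrightarrow> (\<exists>y. f (y # xs) = 0)
    \<Longrightarrow> recursive_fn n (\<lambda>xs. LEAST y. f (y # xs) = 0)"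

definition re_set :: "nat set \<Rightarrow> bool" where
  "re_set A \<longleftrightarrow> A = {} \<or> (\<exists>f. recursive_fn 1 f \<and> A = range (\<lambda>n. f [n]))"

definition re_theory :: "fm set \<Rightarrow> bool" where
  "re_theory T \<longleftrightarrow> is_theory T \<and> re_set (gn ` T)"

definition is_definition :: "fm \<Rightarrow> fm set \<Rightarrow> bool" where
  "is_definition \<tau> T \<longleftrightarrow>
    fv \<tau> \<subseteq> {0} \<and> (\<forall>n. true_in_N (psubst (\<lambda>_. num n) \<tau>) \<longleftrightarrow> n \<in> gn ` T)"


section \<open>Arithmetization of provability\<close>

text \<open>To write down long formulas with readable bound variables, terms and formulas are built as
  functions of the number \<open>d\<close> of quantifiers in whose scope they are placed. A variable bound by
  the quantifier at depth \<open>d\<close> is, at depth \<open>d'\<close>, the index \<open>d' - Suc d\<close>. The formula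
  denoted by \<open>F\<close> at the outermost level is \<open>F 0\<close>.\<close>

type_synonym dtm = "nat \<Rightarrow> tm"
type_synonym dfm = "nat \<Rightarrow> fm"

definition free :: "nat \<Rightarrow> dtm" where
  "free i = (\<lambda>d. Var (i + d))"

definition dnum :: "nat \<Rightarrow> dtm" where "dnum n = (\<lambda>d. num n)"
definition dS :: "dtm \<Rightarrow> dtm" where "dS x = (\<lambda>d. Succ (x d))"
definition dplus :: "dtm \<Rightarrow> dtm \<Rightarrow> dtm" (infixl "\<^bold>+" 65) where
  "x \<^bold>+ y = (\<lambda>d. Plus (x d) (y d))"
definition dtimes :: "dtm \<Rightarrow> dtm \<Rightarrow> dtm" (infixl "\<^bold>*" 70) where
  "x \<^bold>* y = (\<lambda>d. Times (x d) (y d))"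

definition deq :: "dtm \<Rightarrow> dtm \<Rightarrow> dfm" (infix "\<^bold>=" 50) where
  "(x \<^bold>= y) = (\<lambda>d. Eq (x d) (y d))"
definition dlt :: "dtm \<Rightarrow> dtm \<Rightarrow> dfm" (infix "\<^bold><" 50) where
  "(x \<^bold>< y) = (\<lambda>d. Lt (x d) (y d))"
definition dneg :: "dfm \<Rightarrow> dfm" ("\<^bold>\<not> _" [40] 40) where
  "(\<^bold>\<not> F) = (\<lambda>d. Neg (F d))"
definition dconj :: "dfm \<Rightarrow> dfm \<Rightarrow> dfm" (infixr "\<^bold>\<and>" 35) where
  "(F \<^bold>\<and> G) = (\<lambda>d. Conj (F d) (G d))"
definition ddisj :: "dfm \<Rightarrow> dfm \<Rightarrow> dfm" (infixr "\<^bold>\<or>" 30) where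
  "(F \<^bold>\<or> G) = (\<lambda>d. Disj (F d) (G d))"
definition dex :: "(dtm \<Rightarrow> dfm) \<Rightarrow> dfm" (binder "\<^bold>\<exists>" 10) where
  "dex F = (\<lambda>d. Exists (F (\<lambda>d'. Var (d' - Suc d)) (Suc d)))"
definition dallb :: "dtm \<Rightarrow> (dtm \<Rightarrow> dfm) \<Rightarrow> dfm" where
  "dallb t F = (\<lambda>d. Forall (Imp (Lt (Var 0) (t (Suc d))) (F (\<lambda>d'. Var (d' - Suc d)) (Suc d))))"

text \<open>\<open>dPair\<close> is the graph of \<^const>\<open>prod_encode\<close>, with both sides doubled; \<open>Tup\<close> is the graph of its
  iteration. \<open>Beta a b i x\<close> is Goedel's \<open>a mod (1 + (i + 1) * b) = x\<close>.\<close>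

definition dPair :: "dtm \<Rightarrow> dtm \<Rightarrow> dtm \<Rightarrow> dfm" where
  "dPair x y z = (z \<^bold>+ z \<^bold>= (x \<^bold>+ y) \<^bold>* dS (x \<^bold>+ y) \<^bold>+ (x \<^bold>+ x))"

fun Tup :: "dtm list \<Rightarrow> dtm \<Rightarrow> dfm" where
  "Tup [] z = (z \<^bold>= dnum 0)"
| "Tup [x] z = (z \<^bold>= x)"
| "Tup (x # y # xs) z = (\<^bold>\<exists>u. Tup (y # xs) u \<^bold>\<and> dPair x u z)"

definition Beta :: "dtm \<Rightarrow> dtm \<Rightarrow> dtm \<Rightarrow> dtm \<Rightarrow> dfm" where
  "Beta a b i x = (x \<^bold>< dS (dS i \<^bold>* b) \<^bold>\<and> (\<^bold>\<exists>q. a \<^bold>= q \<^bold>* dS (dS i \<^bold>* b) \<^bold>+ x))"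

text \<open>All inductively defined relations are expressed in the same way: \<open>x\<close> is the last entry of a
  sequence, coded by \<open>a\<close>, \<open>b\<close>, in which each entry \<open>y\<close> satisfies \<open>Step E y\<close>, where \<open>E\<close>
  is the property of being an earlier entry. \<open>among E [x, ..., z]\<close> says that \<open>E\<close> holds of the
  tuple \<open>(x, ..., z)\<close>.\<close>

definition Ind :: "((dtm \<Rightarrow> dfm) \<Rightarrow> dtm \<Rightarrow> dfm) \<Rightarrow> dtm \<Rightarrow> dfm" where
  "Ind Step x = (\<^bold>\<exists>a. \<^bold>\<exists>b. \<^bold>\<exists>l. Beta a b l x \<^bold>\<and>
     dallb (dS l) (\<lambda>i. \<^bold>\<exists>y. Beta a b i y \<^bold>\<and> Step (\<lambda>z. \<^bold>\<exists>j. j \<^bold>< i \<^bold>\<and> Beta a b j z) y))"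

definition among :: "(dtm \<Rightarrow> dfm) \<Rightarrow> dtm list \<Rightarrow> dfm" where
  "among E xs = (\<^bold>\<exists>w. Tup xs w \<^bold>\<and> E w)"

text \<open>The graphs of the syntactic constructors on Goedel numbers.\<close>

definition cVar :: "dtm \<Rightarrow> dtm \<Rightarrow> dfm" where "cVar i z = Tup [dnum 0, i] z"
definition cZero :: "dtm \<Rightarrow> dfm" where "cZero z = Tup [dnum 1, dnum 0] z"
definition cSucc :: "dtm \<Rightarrow> dtm \<Rightarrow> dfm" where "cSucc t z = Tup [dnum 2, t] z"
definition cPlus :: "dtm \<Rightarrow> dtm \<Rightarrow> dtm \<Rightarrow> dfm" where "cPlus s t z = Tup [dnum 3, s, t] z"
definition cTimes :: "dtm \<Rightarrow> dtm \<Rightarrow> dtm \<Rightarrow> dfm" where "cTimes s t z = Tup [dnum 4, s, t] z"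
definition cEq :: "dtm \<Rightarrow> dtm \<Rightarrow> dtm \<Rightarrow> dfm" where "cEq s t z = Tup [dnum 5, s, t] z"
definition cLt :: "dtm \<Rightarrow> dtm \<Rightarrow> dtm \<Rightarrow> dfm" where "cLt s t z = Tup [dnum 6, s, t] z"
definition cNeg :: "dtm \<Rightarrow> dtm \<Rightarrow> dfm" where "cNeg p z = Tup [dnum 7, p] z"
definition cImp :: "dtm \<Rightarrow> dtm \<Rightarrow> dtm \<Rightarrow> dfm" where "cImp p q z = Tup [dnum 8, p, q] z"
definition cAll :: "dtm \<Rightarrow> dtm \<Rightarrow> dfm" where "cAll p z = Tup [dnum 9, p] z"

definition IsTm :: "dtm \<Rightarrow> dfm" where
  "IsTm = Ind (\<lambda>E z.
     (\<^bold>\<exists>i. cVar i z) \<^bold>\<or> cZero z \<^bold>\<or> (\<^bold>\<exists>t. E t \<^bold>\<and> cSucc t z) \<^bold>\<or>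
     (\<^bold>\<exists>s. \<^bold>\<exists>t. E s \<^bold>\<and> E t \<^bold>\<and> (cPlus s t z \<^bold>\<or> cTimes s t z)))"

definition IsFm :: "dtm \<Rightarrow> dfm" where
  "IsFm = Ind (\<lambda>E z.
     (\<^bold>\<exists>s. \<^bold>\<exists>t. IsTm s \<^bold>\<and> IsTm t \<^bold>\<and> (cEq s t z \<^bold>\<or> cLt s t z)) \<^bold>\<or>
     (\<^bold>\<exists>p. E p \<^bold>\<and> (cNeg p z \<^bold>\<or> cAll p z)) \<^bold>\<or>
     (\<^bold>\<exists>p. \<^bold>\<exists>q. E p \<^bold>\<and> E q \<^bold>\<and> cImp p q z))"

text \<open>The graphs of \<^const>\<open>lift_tm\<close>, \<^const>\<open>lift\<close>, \<^const>\<open>sub_tm\<close>, \<^const>\<open>sub\<close> and \<open>n \<mapsto> gn_tm (num n)\<close>.\<close>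

definition LiftTm :: "dtm \<Rightarrow> dtm \<Rightarrow> dtm \<Rightarrow> dfm" where
  "LiftTm k x y = among (Ind (\<lambda>E z. \<^bold>\<exists>t. \<^bold>\<exists>t'. Tup [t, t'] z \<^bold>\<and>
     ((\<^bold>\<exists>i. cVar i t \<^bold>\<and> (i \<^bold>< k \<^bold>\<and> cVar i t' \<^bold>\<or> (\<^bold>\<not> i \<^bold>< k) \<^bold>\<and> cVar (dS i) t')) \<^bold>\<or>
      cZero t \<^bold>\<and> cZero t' \<^bold>\<or>
      (\<^bold>\<exists>u. \<^bold>\<exists>u'. among E [u, u'] \<^bold>\<and> cSucc u t \<^bold>\<and> cSucc u' t') \<^bold>\<or>
      (\<^bold>\<exists>u. \<^bold>\<exists>v. \<^bold>\<exists>u'. \<^bold>\<exists>v'. among E [u, u'] \<^bold>\<and> among E [v, v'] \<^bold>\<and>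
         (cPlus u v t \<^bold>\<and> cPlus u' v' t' \<^bold>\<or> cTimes u v t \<^bold>\<and> cTimes u' v' t'))))) [x, y]"

definition LiftFm :: "dtm \<Rightarrow> dtm \<Rightarrow> dtm \<Rightarrow> dfm" where
  "LiftFm k x y = among (Ind (\<lambda>E z. \<^bold>\<exists>k. \<^bold>\<exists>p. \<^bold>\<exists>p'. Tup [k, p, p'] z \<^bold>\<and>
     ((\<^bold>\<exists>s. \<^bold>\<exists>t. \<^bold>\<exists>s'. \<^bold>\<exists>t'. LiftTm k s s' \<^bold>\<and> LiftTm k t t' \<^bold>\<and>
         (cEq s t p \<^bold>\<and> cEq s' t' p' \<^bold>\<or> cLt s t p \<^bold>\<and> cLt s' t' p')) \<^bold>\<or>
      (\<^bold>\<exists>q. \<^bold>\<exists>q'. among E [k, q, q'] \<^bold>\<and> cNeg q p \<^bold>\<and> cNeg q' p') \<^bold>\<or>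
      (\<^bold>\<exists>q. \<^bold>\<exists>r. \<^bold>\<exists>q'. \<^bold>\<exists>r'. among E [k, q, q'] \<^bold>\<and> among E [k, r, r'] \<^bold>\<and>
         cImp q r p \<^bold>\<and> cImp q' r' p') \<^bold>\<or>
      (\<^bold>\<exists>q. \<^bold>\<exists>q'. among E [dS k, q, q'] \<^bold>\<and> cAll q p \<^bold>\<and> cAll q' p')))) [k, x, y]"

definition SubTm :: "dtm \<Rightarrow> dtm \<Rightarrow> dtm \<Rightarrow> dtm \<Rightarrow> dfm" where
  "SubTm k w x y = among (Ind (\<lambda>E z. \<^bold>\<exists>t. \<^bold>\<exists>t'. Tup [t, t'] z \<^bold>\<and>
     ((\<^bold>\<exists>i. cVar i t \<^bold>\<and>
         (i \<^bold>< k \<^bold>\<and> cVar i t' \<^bold>\<or> i \<^bold>= k \<^bold>\<and> t' \<^bold>= w \<^bold>\<or>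
          k \<^bold>< i \<^bold>\<and> (\<^bold>\<exists>j. i \<^bold>= dS j \<^bold>\<and> cVar j t'))) \<^bold>\<or>
      cZero t \<^bold>\<and> cZero t' \<^bold>\<or>
      (\<^bold>\<exists>u. \<^bold>\<exists>u'. among E [u, u'] \<^bold>\<and> cSucc u t \<^bold>\<and> cSucc u' t') \<^bold>\<or>
      (\<^bold>\<exists>u. \<^bold>\<exists>v. \<^bold>\<exists>u'. \<^bold>\<exists>v'. among E [u, u'] \<^bold>\<and> among E [v, v'] \<^bold>\<and>
         (cPlus u v t \<^bold>\<and> cPlus u' v' t' \<^bold>\<or> cTimes u v t \<^bold>\<and> cTimes u' v' t'))))) [x, y]"

definition SubFm :: "dtm \<Rightarrow> dtm \<Rightarrow> dtm \<Rightarrow> dtm \<Rightarrow> dfm" where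
  "SubFm k w x y = among (Ind (\<lambda>E z. \<^bold>\<exists>k. \<^bold>\<exists>w. \<^bold>\<exists>p. \<^bold>\<exists>p'. Tup [k, w, p, p'] z \<^bold>\<and>
     ((\<^bold>\<exists>s. \<^bold>\<exists>t. \<^bold>\<exists>s'. \<^bold>\<exists>t'. SubTm k w s s' \<^bold>\<and> SubTm k w t t' \<^bold>\<and>
         (cEq s t p \<^bold>\<and> cEq s' t' p' \<^bold>\<or> cLt s t p \<^bold>\<and> cLt s' t' p')) \<^bold>\<or>
      (\<^bold>\<exists>q. \<^bold>\<exists>q'. among E [k, w, q, q'] \<^bold>\<and> cNeg q p \<^bold>\<and> cNeg q' p') \<^bold>\<or>
      (\<^bold>\<exists>q. \<^bold>\<exists>r. \<^bold>\<exists>q'. \<^bold>\<exists>r'. among E [k, w, q, q'] \<^bold>\<and> among E [k, w, r, r'] \<^bold>\<and>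
         cImp q r p \<^bold>\<and> cImp q' r' p') \<^bold>\<or>
      (\<^bold>\<exists>q. \<^bold>\<exists>q'. \<^bold>\<exists>w'. LiftTm (dnum 0) w w' \<^bold>\<and> among E [dS k, w', q, q'] \<^bold>\<and>
         cAll q p \<^bold>\<and> cAll q' p')))) [k, w, x, y]"

definition NumCode :: "dtm \<Rightarrow> dtm \<Rightarrow> dfm" where
  "NumCode n x = among (Ind (\<lambda>E z. \<^bold>\<exists>k. \<^bold>\<exists>t. Tup [k, t] z \<^bold>\<and>
     (k \<^bold>= dnum 0 \<^bold>\<and> cZero t \<^bold>\<or>
      (\<^bold>\<exists>k'. \<^bold>\<exists>t'. k \<^bold>= dS k' \<^bold>\<and> among E [k', t'] \<^bold>\<and> cSucc t' t)))) [n, x]"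

text \<open>The clauses of \<open>PrfStep\<close> are those of \<^const>\<open>proves\<close>, in the same order.\<close>

definition PrfStep :: "fm \<Rightarrow> (dtm \<Rightarrow> dfm) \<Rightarrow> dtm \<Rightarrow> dfm" where
  "PrfStep \<tau> E z =
     ((\<lambda>d. psubst (\<lambda>_. z d) \<tau>) \<^bold>\<or>
      (\<^bold>\<exists>p. \<^bold>\<exists>q. \<^bold>\<exists>u. IsFm p \<^bold>\<and> IsFm q \<^bold>\<and> cImp q p u \<^bold>\<and> cImp p u z) \<^bold>\<or>
      (\<^bold>\<exists>p. \<^bold>\<exists>q. \<^bold>\<exists>r. \<^bold>\<exists>qr. \<^bold>\<exists>pqr. \<^bold>\<exists>pq. \<^bold>\<exists>pr. \<^bold>\<exists>u. IsFm p \<^bold>\<and> IsFm q \<^bold>\<and> IsFm r \<^bold>\<and>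
         cImp q r qr \<^bold>\<and> cImp p qr pqr \<^bold>\<and> cImp p q pq \<^bold>\<and> cImp p r pr \<^bold>\<and>
         cImp pq pr u \<^bold>\<and> cImp pqr u z) \<^bold>\<or>
      (\<^bold>\<exists>p. \<^bold>\<exists>q. \<^bold>\<exists>np. \<^bold>\<exists>nq. \<^bold>\<exists>u. \<^bold>\<exists>v. IsFm p \<^bold>\<and> IsFm q \<^bold>\<and> cNeg p np \<^bold>\<and> cNeg q nq \<^bold>\<and>
         cImp np nq u \<^bold>\<and> cImp q p v \<^bold>\<and> cImp u v z) \<^bold>\<or>
      (\<^bold>\<exists>p. \<^bold>\<exists>t. \<^bold>\<exists>ap. \<^bold>\<exists>q. IsFm p \<^bold>\<and> IsTm t \<^bold>\<and> cAll p ap \<^bold>\<and>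
         SubFm (dnum 0) t p q \<^bold>\<and> cImp ap q z) \<^bold>\<or>
      foldr (\<lambda>\<phi> F. z \<^bold>= dnum (gn \<phi>) \<^bold>\<or> F) equality_axioms (dnum 0 \<^bold>< dnum 0) \<^bold>\<or>
      (\<^bold>\<exists>p. \<^bold>\<exists>u. cImp p z u \<^bold>\<and> E u \<^bold>\<and> E p) \<^bold>\<or>
      (\<^bold>\<exists>p. \<^bold>\<exists>q. \<^bold>\<exists>q'. \<^bold>\<exists>u. \<^bold>\<exists>ap. IsFm q \<^bold>\<and> LiftFm (dnum 0) q q' \<^bold>\<and> cImp q' p u \<^bold>\<and> E u \<^bold>\<and>
         cAll p ap \<^bold>\<and> cImp q ap z))"

text \<open>The provability predicate: there is a proof whose last formula is \<open>x\<close>. For \<open>\<tau>\<close> in \<^const>\<open>sigma1\<close>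
  it is built from \<open>\<tau>\<close> and atomic or negated atomic formulas by conjunction, disjunction, existential and
  bounded universal quantification, hence is \<open>\<Sigma>\<^sub>1\<close> up to equivalence in \<open>I\<Sigma>\<^sub>1\<close>.\<close>

definition Pr :: "fm \<Rightarrow> dtm \<Rightarrow> dfm" where
  "Pr \<tau> x = Ind (PrfStep \<tau>) x"

text \<open>\<open>y\<close> is the Goedel number of \<open>\<phi>\<close> with each free variable replaced by the numeral of its value;
  \<open>n\<close> counts the quantifiers of \<open>\<phi>\<close> already passed, whose variables are kept.\<close>

fun quote_tm :: "nat \<Rightarrow> tm \<Rightarrow> dtm \<Rightarrow> dfm" where
  "quote_tm n (Var i) y = (if i < n then cVar (dnum i) y else NumCode (free (i - n)) y)"
| "quote_tm n Zero y = cZero y"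
| "quote_tm n (Succ t) y = (\<^bold>\<exists>u. quote_tm n t u \<^bold>\<and> cSucc u y)"
| "quote_tm n (Plus s t) y = (\<^bold>\<exists>u. \<^bold>\<exists>v. quote_tm n s u \<^bold>\<and> quote_tm n t v \<^bold>\<and> cPlus u v y)"
| "quote_tm n (Times s t) y = (\<^bold>\<exists>u. \<^bold>\<exists>v. quote_tm n s u \<^bold>\<and> quote_tm n t v \<^bold>\<and> cTimes u v y)"

fun quote_fm :: "nat \<Rightarrow> fm \<Rightarrow> dtm \<Rightarrow> dfm" where
  "quote_fm n (Eq s t) y = (\<^bold>\<exists>u. \<^bold>\<exists>v. quote_tm n s u \<^bold>\<and> quote_tm n t v \<^bold>\<and> cEq u v y)"
| "quote_fm n (Lt s t) y = (\<^bold>\<exists>u. \<^bold>\<exists>v. quote_tm n s u \<^bold>\<and> quote_tm n t v \<^bold>\<and> cLt u v y)"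
| "quote_fm n (Neg \<phi>) y = (\<^bold>\<exists>u. quote_fm n \<phi> u \<^bold>\<and> cNeg u y)"
| "quote_fm n (Imp \<phi> \<psi>) y = (\<^bold>\<exists>u. \<^bold>\<exists>v. quote_fm n \<phi> u \<^bold>\<and> quote_fm n \<psi> v \<^bold>\<and> cImp u v y)"
| "quote_fm n (Forall \<phi>) y = (\<^bold>\<exists>u. quote_fm (Suc n) \<phi> u \<^bold>\<and> cAll u y)"

text \<open>\<open>Pr_dot \<tau> \<phi>\<close> is \<open>Pr\<^sub>\<tau>\<close> applied to the Goedel number of \<open>\<phi>\<close> with dotted free variables; it has
  the same free variables as \<open>\<phi>\<close>.\<close>

definition Pr_dot :: "fm \<Rightarrow> fm \<Rightarrow> fm" where
  "Pr_dot \<tau> \<phi> = (\<^bold>\<exists>y. quote_fm 0 \<phi> y \<^bold>\<and> Pr \<tau> y) 0"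


section \<open>Quantified modal logic\<close>

text \<open>\<open>\<diamond>A\<close> is \<open>\<not>\<box>\<not>A\<close>. \<open>MPred P ys\<close> applies to \<open>ys\<close> the predicate symbol with name \<open>P\<close> and arity \<open>length ys\<close>.\<close>

datatype mfm = MPred nat "nat list" | MBot | MNeg mfm | MImp mfm mfm | MAll mfm | MBox mfm

abbreviation MConj :: "mfm \<Rightarrow> mfm \<Rightarrow> mfm" where "MConj A B \<equiv> MNeg (MImp A (MNeg B))"
abbreviation MDisj :: "mfm \<Rightarrow> mfm \<Rightarrow> mfm" where "MDisj A B \<equiv> MImp (MNeg A) B"
abbreviation MEx :: "mfm \<Rightarrow> mfm" where "MEx A \<equiv> MNeg (MAll (MNeg A))"
abbreviation MDia :: "mfm \<Rightarrow> mfm" where "MDia A \<equiv> MNeg (MBox (MNeg A))"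

fun mfv :: "mfm \<Rightarrow> nat set" where
  "mfv (MPred P ys) = set ys"
| "mfv MBot = {}"
| "mfv (MNeg A) = mfv A"
| "mfv (MImp A B) = mfv A \<union> mfv B"
| "mfv (MAll A) = {i. Suc i \<in> mfv A}"
| "mfv (MBox A) = mfv A"

text \<open>\<open>f P n\<close> is the formula \<open>\<phi>(x\<^sub>1, \<dots>, x\<^sub>n)\<close> assigned to the \<open>n\<close>-ary symbol with name \<open>P\<close>; its
  variables \<open>x\<^sub>1, \<dots>, x\<^sub>n\<close> are the indices \<open>0, \<dots>, n - 1\<close>.\<close>

type_synonym interp = "nat \<Rightarrow> nat \<Rightarrow> fm"

definition arith_interp :: "interp \<Rightarrow> bool" where
  "arith_interp f \<longleftrightarrow> (\<forall>P n. fv (f P n) = {..<n})"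

definition sigma1_interp :: "interp \<Rightarrow> bool" where
  "sigma1_interp f \<longleftrightarrow> arith_interp f \<and> (\<forall>P n. sigma1 (f P n))"

fun interpret_fm :: "interp \<Rightarrow> fm \<Rightarrow> mfm \<Rightarrow> fm" where
  "interpret_fm f \<tau> (MPred P ys) = psubst (\<lambda>i. Var (ys ! i)) (f P (length ys))"
| "interpret_fm f \<tau> MBot = Eq Zero (num 1)"
| "interpret_fm f \<tau> (MNeg A) = Neg (interpret_fm f \<tau> A)"
| "interpret_fm f \<tau> (MImp A B) = Imp (interpret_fm f \<tau> A) (interpret_fm f \<tau> B)"
| "interpret_fm f \<tau> (MAll A) = Forall (interpret_fm f \<tau> A)"
| "interpret_fm f \<tau> (MBox A) = Pr_dot \<tau> (interpret_fm f \<tau> A)"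

definition QPL_Sigma1 :: "fm \<Rightarrow> fm set \<Rightarrow> mfm set" where
  "QPL_Sigma1 \<tau> T =
    {A. mfv A = {} \<and> (\<forall>f. sigma1_interp f \<longrightarrow> T \<turnstile> interpret_fm f \<tau> A)}"

end

theory Submission
  imports Defs "HOL-Library.Countable_Set"
begin

text \<open>By completeness, provability is truth in all models \<open>M\<close> of the theory, and these satisfy
  \<open>I\<Sigma>\<^sub>1\<close>. If the provability predicates are equivalent, induction on modal formulas shows that the two
  interpretations agree provably.

  Conversely, a box-free modal sentence \<open>D\<close> describes a relational structure with a little arithmetic,
  which codes bounded parts of a set separating two recursively inseparable \<open>\<Sigma>\<^sub>1\<close> sets. A
  \<open>\<Sigma>\<^sub>1\<close> interpretation satisfying \<open>D\<close> in \<open>M\<close> is a \<open>\<Sigma>\<^sub>1\<close>-definable structure, and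
  Tennenbaum's argument inside \<open>M\<close> shows that it is isomorphic to \<open>M\<close>, since the code at an
  element beyond all numerals of \<open>M\<close> would make the separating set recursive. Hence \<open>T\<^sub>0 \<turnstile> \<phi>\<close> puts the
  relativized sentence \<open>D \<longrightarrow> \<phi>\<close> into the logic of \<open>T\<^sub>0\<close>, and the standard interpretation in \<open>T\<^sub>1\<close>
  returns \<open>\<phi>\<close>. If in addition \<open>\<box>D\<close> holds and the atomic facts about zero and successor are provable whenever
  they are true, the isomorphism also carries over into the scope of the provability predicate, so that
  \<open>Pr\<^sub>\<tau>(\<phi>) \<longleftrightarrow> \<box>\<phi>\<close>, for \<open>\<tau>\<close> the definition of \<open>T\<^sub>0\<close>, belongs to the logic of \<open>T\<^sub>0\<close>
  under this hypothesis. Its standard interpretation in \<open>T\<^sub>1\<close> is the required equivalence.\<close>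

section \<open>Substitution\<close>

text \<open>A \<Sigma>1 interpretation supplies \<Sigma>1 relations only, and \<open>M\<close> has
  only \<Sigma>1 induction, so the negation of a relation is out of reach unless it has a positive
  definition of its own. Trichotomy of the order provides one for inequality, an explicit nonzero
  remainder provides one for a cleared bit. Equality is an interpreted symbol as well, so the
  isomorphism is a relation between elements of \<open>M\<close> and classes of interpreted
  equality. Tennenbaum's contradiction must be reached inside a possibly nonstandard
  \<open>M\<close>, with a set defined from parameters of \<open>M\<close>; therefore the
  inseparable pair comes from a universal \<Sigma>1 predicate whose indices contain parameters. The
  box adds a second obstacle: truth of the description in \<open>M\<close> does not make the
  isomorphism provable, and its \<Sigma>1 graph would call for formalized \<Sigma>1-completeness.
  Boxing the description settles the former. For the latter, persistence of zero and successor is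
  enough, because provability spreads along the numerals by an induction whose claim is
  \<Sigma>1.\<close>

abbreviation econs :: "'a \<Rightarrow> (nat \<Rightarrow> 'a) \<Rightarrow> nat \<Rightarrow> 'a" (infixr "##" 65) where
  "a ## e \<equiv> case_nat a e"

abbreviation up :: "(nat \<Rightarrow> tm) \<Rightarrow> nat \<Rightarrow> tm" where
  "up \<sigma> \<equiv> Var 0 ## (\<lambda>i. lift_tm 0 (\<sigma> i))"

lemma psubst_tm_cong: "(\<And>i. i \<in> fv_tm t \<Longrightarrow> \<sigma> i = \<rho> i) \<Longrightarrow> psubst_tm \<sigma> t = psubst_tm \<rho> t"
  by (induction t) auto

lemma psubst_cong: "(\<And>i. i \<in> fv \<phi> \<Longrightarrow> \<sigma> i = \<rho> i) \<Longrightarrow> psubst \<sigma> \<phi> = psubst \<rho> \<phi>"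
proof (induction \<phi> arbitrary: \<sigma> \<rho>)
  case (Forall \<phi>)
  have "up \<sigma> i = up \<rho> i" if "i \<in> fv \<phi>" for i
    using that Forall.prems by (cases i) auto
  then have "psubst (up \<sigma>) \<phi> = psubst (up \<rho>) \<phi>" by (rule Forall.IH)
  then show ?case by simp
next
  case (Imp \<phi> \<psi>)
  have "psubst \<sigma> \<phi> = psubst \<rho> \<phi>" "psubst \<sigma> \<psi> = psubst \<rho> \<psi>"
    by (rule Imp.IH, simp add: Imp.prems)+
  then show ?case by simp
next
  case (Neg \<phi>)
  have "psubst \<sigma> \<phi> = psubst \<rho> \<phi>" by (rule Neg.IH) (simp add: Neg.prems)
  then show ?case by simp
next
  case (Eq s t)
  then show ?case using psubst_tm_cong[of s \<sigma> \<rho>] psubst_tm_cong[of t \<sigma> \<rho>] by simp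
next
  case (Lt s t)
  then show ?case using psubst_tm_cong[of s \<sigma> \<rho>] psubst_tm_cong[of t \<sigma> \<rho>] by simp
qed

text \<open>Lifting and single substitution are reduced to simultaneous substitution, so that
  composition and free variables are studied for \<open>psubst\<close> only.\<close>

lemma lift_tm_psubst: "lift_tm k t = psubst_tm (\<lambda>i. Var (if i < k then i else Suc i)) t"
  by (induction t) auto

lemma lift_psubst: "lift k \<phi> = psubst (\<lambda>i. Var (if i < k then i else Suc i)) \<phi>"
proof (induction \<phi> arbitrary: k)
  case (Forall \<phi>)
  have "up (\<lambda>i. Var (if i < k then i else Suc i)) = (\<lambda>i. Var (if i < Suc k then i else Suc i))"
    by (auto simp: fun_eq_iff split: nat.split)
  then show ?case using Forall by simp
qed (auto simp: lift_tm_psubst)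

lemma sub_tm_psubst:
  "sub_tm k u t = psubst_tm (\<lambda>i. if i < k then Var i else if i = k then u else Var (i - 1)) t"
  by (induction t) auto

lemma sub_psubst:
  "sub k u \<phi> = psubst (\<lambda>i. if i < k then Var i else if i = k then u else Var (i - 1)) \<phi>"
proof (induction \<phi> arbitrary: k u)
  case (Forall \<phi>)
  have "up (\<lambda>i. if i < k then Var i else if i = k then u else Var (i - 1)) =
      (\<lambda>i. if i < Suc k then Var i else if i = Suc k then lift_tm 0 u else Var (i - 1))"
    by (auto simp: fun_eq_iff split: nat.split)
  then show ?case using Forall by simp
qed (auto simp: sub_tm_psubst)

lemma psubst_tm_comp: "psubst_tm \<sigma> (psubst_tm \<rho> t) = psubst_tm (\<lambda>i. psubst_tm \<sigma> (\<rho> i)) t"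
  by (induction t) auto

lemma psubst_tm_up_lift: "psubst_tm (a ## \<sigma>) (lift_tm 0 t) = psubst_tm \<sigma> t"
  by (induction t) auto

lemma lift_tm_psubst_tm: "lift_tm 0 (psubst_tm \<sigma> t) = psubst_tm (\<lambda>i. lift_tm 0 (\<sigma> i)) t"
  by (induction t) auto

lemma psubst_comp: "psubst \<sigma> (psubst \<rho> \<phi>) = psubst (\<lambda>i. psubst_tm \<sigma> (\<rho> i)) \<phi>"
proof (induction \<phi> arbitrary: \<sigma> \<rho>)
  case (Forall \<phi>)
  have "(\<lambda>i. psubst_tm (up \<sigma>) (up \<rho> i)) = up (\<lambda>i. psubst_tm \<sigma> (\<rho> i))"
    by (auto simp: fun_eq_iff psubst_tm_up_lift lift_tm_psubst_tm split: nat.split)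
  then show ?case using Forall by simp
qed (auto simp: psubst_tm_comp)

lemma psubst_tm_Var: "psubst_tm Var t = t"
  by (induction t) auto

lemma psubst_Var: "psubst Var \<phi> = \<phi>"
proof (induction \<phi>)
  case (Forall \<phi>)
  have "up Var = Var" by (auto simp: fun_eq_iff split: nat.split)
  then show ?case using Forall by simp
qed (auto simp: psubst_tm_Var)

lemma sub_0_psubst_up: "sub 0 t (psubst (up \<sigma>) \<phi>) = psubst (t ## \<sigma>) \<phi>"
proof -
  have [simp]: "(\<lambda>i. if i = 0 then t else Var (i - 1)) = t ## Var"
    by (auto simp: fun_eq_iff split: nat.split)
  have "(\<lambda>i. psubst_tm (t ## Var) (up \<sigma> i)) = t ## \<sigma>"
    by (auto simp: fun_eq_iff psubst_tm_up_lift psubst_tm_Var split: nat.split)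
  then show ?thesis by (simp add: sub_psubst psubst_comp)
qed

lemma finite_fv_tm [simp]: "finite (fv_tm t)"
  by (induction t) auto

lemma finite_fv [simp]: "finite (fv \<phi>)"
proof (induction \<phi>)
  case (Forall \<phi>)
  have "{i. Suc i \<in> fv \<phi>} = Suc -` fv \<phi>" by auto
  then show ?case using Forall by (simp add: finite_vimageI)
qed auto

lemma fv_bounded: obtains n where "fv \<phi> \<subseteq> {..<n}"
  using finite_nat_iff_bounded[of "fv \<phi>"] by auto

lemma fv_psubst_tm: "fv_tm (psubst_tm \<sigma> t) = (\<Union>i\<in>fv_tm t. fv_tm (\<sigma> i))"
  by (induction t) auto

lemma fv_lift_tm_0: "fv_tm (lift_tm 0 t) = Suc ` fv_tm t"
  by (induction t) auto

lemma fv_psubst: "fv (psubst \<sigma> \<phi>) = (\<Union>i\<in>fv \<phi>. fv_tm (\<sigma> i))"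
proof (induction \<phi> arbitrary: \<sigma>)
  case (Forall \<phi>)
  have *: "Suc i \<in> fv_tm (up \<sigma> j) \<longleftrightarrow> (\<exists>k. j = Suc k \<and> i \<in> fv_tm (\<sigma> k))" for i j
    by (cases j) (auto simp: fv_lift_tm_0)
  show ?case by (auto simp: Forall.IH * simp del: fv_lift_tm_0)
qed (auto simp: fv_psubst_tm)

lemma fv_foralls: "fv ((Forall ^^ n) \<phi>) = {i. i + n \<in> fv \<phi>}"
  by (induction n) auto

section \<open>Structures\<close>

text \<open>Equality is no field of the record, it is always the identity of the carrier. The term
  model therefore has to be factored, and in return \<open>M\<close> supports ordinary equational
  reasoning.\<close>

record 'a model =
  mZero :: 'a
  mSuc :: "'a \<Rightarrow> 'a"
  mPlus :: "'a \<Rightarrow> 'a \<Rightarrow> 'a"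
  mTimes :: "'a \<Rightarrow> 'a \<Rightarrow> 'a"
  mLess :: "'a \<Rightarrow> 'a \<Rightarrow> bool"

fun meval :: "'a model \<Rightarrow> (nat \<Rightarrow> 'a) \<Rightarrow> tm \<Rightarrow> 'a" where
  "meval M e (Var i) = e i"
| "meval M e Zero = mZero M"
| "meval M e (Succ t) = mSuc M (meval M e t)"
| "meval M e (Plus s t) = mPlus M (meval M e s) (meval M e t)"
| "meval M e (Times s t) = mTimes M (meval M e s) (meval M e t)"

fun msat :: "'a model \<Rightarrow> (nat \<Rightarrow> 'a) \<Rightarrow> fm \<Rightarrow> bool" where
  "msat M e (Eq s t) \<longleftrightarrow> meval M e s = meval M e t"
| "msat M e (Lt s t) \<longleftrightarrow> mLess M (meval M e s) (meval M e t)"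
| "msat M e (Neg \<phi>) \<longleftrightarrow> \<not> msat M e \<phi>"
| "msat M e (Imp \<phi> \<psi>) \<longleftrightarrow> (msat M e \<phi> \<longrightarrow> msat M e \<psi>)"
| "msat M e (Forall \<phi>) \<longleftrightarrow> (\<forall>a. msat M (a ## e) \<phi>)"

definition models :: "'a model \<Rightarrow> fm set \<Rightarrow> bool" where
  "models M T \<longleftrightarrow> (\<forall>\<phi>\<in>T. \<forall>e. msat M e \<phi>)"

lemma meval_psubst: "meval M e (psubst_tm \<sigma> t) = meval M (\<lambda>i. meval M e (\<sigma> i)) t"
  by (induction t) auto

lemma meval_lift0 [simp]: "meval M (a ## e) (lift_tm 0 t) = meval M e t"
  by (induction t) auto

lemma msat_psubst: "msat M e (psubst \<sigma> \<phi>) = msat M (\<lambda>i. meval M e (\<sigma> i)) \<phi>"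
proof (induction \<phi> arbitrary: e \<sigma>)
  case (Forall \<phi>)
  have "(\<lambda>i. meval M (a ## e) (up \<sigma> i)) = a ## (\<lambda>i. meval M e (\<sigma> i))" for a
    by (auto simp: fun_eq_iff split: nat.split)
  then show ?case by (simp add: Forall.IH)
qed (auto simp: meval_psubst)

lemma msat_sub0: "msat M e (sub 0 t \<phi>) = msat M (meval M e t ## e) \<phi>"
proof -
  have "(\<lambda>i. meval M e (if i = 0 then t else Var (i - 1))) = meval M e t ## e"
    by (auto simp: fun_eq_iff split: nat.split)
  then show ?thesis by (simp add: sub_psubst msat_psubst)
qed

lemma msat_lift0 [simp]: "msat M (a ## e) (lift 0 \<phi>) = msat M e \<phi>"
  by (simp add: lift_psubst msat_psubst)

lemma meval_cong: "(\<And>i. i \<in> fv_tm t \<Longrightarrow> e i = e' i) \<Longrightarrow> meval M e t = meval M e' t"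
  by (induction t) auto

lemma msat_cong: "(\<And>i. i \<in> fv \<phi> \<Longrightarrow> e i = e' i) \<Longrightarrow> msat M e \<phi> = msat M e' \<phi>"
proof (induction \<phi> arbitrary: e e')
  case (Forall \<phi>)
  have "msat M (a ## e) \<phi> = msat M (a ## e') \<phi>" for a
    by (rule Forall.IH) (use Forall.prems in \<open>auto split: nat.split\<close>)
  then show ?case by simp
next
  case (Imp \<phi> \<psi>)
  have "msat M e \<phi> = msat M e' \<phi>" "msat M e \<psi> = msat M e' \<psi>"
    by (rule Imp.IH, simp add: Imp.prems)+
  then show ?case by simp
next
  case (Neg \<phi>)
  have "msat M e \<phi> = msat M e' \<phi>" by (rule Neg.IH) (simp add: Neg.prems)
  then show ?case by simp
next
  case (Eq s t)
  then show ?case using meval_cong[of s e e' M] meval_cong[of t e e' M] by auto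
next
  case (Lt s t)
  then show ?case using meval_cong[of s e e' M] meval_cong[of t e e' M] by auto
qed

lemma msat_foralls:
  fixes M :: "'a model"
  shows "(\<forall>e. msat M e ((Forall ^^ n) \<phi>)) \<longleftrightarrow> (\<forall>e. msat M e \<phi>)"
proof (induction n)
  case (Suc n)
  have "(\<forall>e. msat M e (Forall \<psi>)) \<longleftrightarrow> (\<forall>e. msat M e \<psi>)" for \<psi>
  proof
    assume *: "\<forall>e. msat M e (Forall \<psi>)"
    show "\<forall>e. msat M e \<psi>"
    proof
      fix e :: "nat \<Rightarrow> 'a"
      have "e = e 0 ## (\<lambda>i. e (Suc i))" by (auto simp: fun_eq_iff split: nat.split)
      then show "msat M e \<psi>" using * by (metis msat.simps(5))
    qed
  qed auto
  then show ?case using Suc by simp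
qed simp

lemma msat_univ_closure: "(\<forall>e. msat M e (univ_closure \<phi>)) \<longleftrightarrow> (\<forall>e. msat M e \<phi>)"
  unfolding univ_closure_def by (rule msat_foralls)

lemma sentence_univ_closure: "sentence (univ_closure \<phi>)"
proof -
  have "fv \<phi> \<subseteq> {..<(LEAST n. fv \<phi> \<subseteq> {..<n})}"
    by (rule LeastI_ex) (meson fv_bounded)
  then show ?thesis by (auto simp: sentence_def univ_closure_def fv_foralls)
qed

section \<open>Soundness and completeness\<close>

lemma soundness:
  assumes "T \<turnstile> \<phi>" and M: "models M T"
  shows "msat M e \<phi>"
  using assms(1)
proof (induction arbitrary: e rule: proves.induct)
  case (ax \<phi>)
  then show ?case using M by (auto simp: models_def)
next
  case (ax_Eq \<phi>)
  then show ?case by (auto simp: equality_axioms_def)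
next
  case (gen \<chi> \<phi>)
  have "msat M (a ## e) (Imp (lift 0 \<chi>) \<phi>)" for a by (rule gen.IH)
  then show ?case by simp
qed (auto simp: msat_sub0)

lemma proves_refl: "T \<turnstile> Imp \<phi> \<phi>"
  by (rule mp[OF mp[OF ax_S ax_K[of _ _ "Imp \<phi> \<phi>"]] ax_K])

lemma proves_weaken: "T \<turnstile> \<phi> \<Longrightarrow> T \<turnstile> Imp \<psi> \<phi>"
  by (rule mp[OF ax_K])

lemma proves_Forall: "T \<turnstile> \<phi> \<Longrightarrow> T \<turnstile> Forall \<phi>"
  by (rule mp[OF gen[OF proves_weaken] proves_refl])

lemma proves_foralls: "T \<turnstile> \<phi> \<Longrightarrow> T \<turnstile> (Forall ^^ n) \<phi>"
  by (induction n) (auto intro: proves_Forall)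

lemma proves_univ_closure: "T \<turnstile> \<phi> \<Longrightarrow> T \<turnstile> univ_closure \<phi>"
  unfolding univ_closure_def by (rule proves_foralls)

text \<open>Of n + 1 quantifiers the outermost binds index n below the others, so it is instantiated
  at \<open>\<sigma> n\<close>; repeated use of \<open>ax_All\<close> thus performs a simultaneous
  substitution.\<close>

lemma proves_psubst_foralls: "T \<turnstile> psubst (\<lambda>i. \<sigma> (i + n)) ((Forall ^^ n) \<phi>) \<Longrightarrow> T \<turnstile> psubst \<sigma> \<phi>"
proof (induction n arbitrary: \<sigma>)
  case (Suc n)
  have eq: "\<sigma> n ## (\<lambda>i. \<sigma> (i + Suc n)) = (\<lambda>i. \<sigma> (i + n))"
    by (auto simp: fun_eq_iff split: nat.split)
  have "T \<turnstile> Forall (psubst (up (\<lambda>i. \<sigma> (i + Suc n))) ((Forall ^^ n) \<phi>))"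
    using Suc.prems by simp
  from mp[OF ax_All this, of "\<sigma> n"] show ?case
    by (intro Suc.IH) (simp only: sub_0_psubst_up eq)
qed simp

lemma proves_psubst:
  assumes "T \<turnstile> \<phi>"
  shows "T \<turnstile> psubst \<sigma> \<phi>"
proof -
  obtain n where n: "fv \<phi> \<subseteq> {..<n}" by (rule fv_bounded)
  \<comment> \<open>The free variables of \<phi> lie below n, so its n-fold closure is a sentence
    and every substitution leaves it alone.\<close>
  have "psubst (\<lambda>i. \<sigma> (i + n)) ((Forall ^^ n) \<phi>) = psubst Var ((Forall ^^ n) \<phi>)"
    by (rule psubst_cong) (use n in \<open>auto simp: fv_foralls\<close>)
  then show ?thesis
    using proves_foralls[OF assms] by (intro proves_psubst_foralls[of T \<sigma> n]) (simp add: psubst_Var)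
qed

text \<open>Provability from local hypotheses, over which no generalization is allowed.\<close>

inductive lproves :: "fm set \<Rightarrow> fm set \<Rightarrow> fm \<Rightarrow> bool" for T \<Delta> where
  ass: "\<phi> \<in> \<Delta> \<Longrightarrow> lproves T \<Delta> \<phi>"
| lthm: "T \<turnstile> \<phi> \<Longrightarrow> lproves T \<Delta> \<phi>"
| lmp: "lproves T \<Delta> (Imp \<phi> \<psi>) \<Longrightarrow> lproves T \<Delta> \<phi> \<Longrightarrow> lproves T \<Delta> \<psi>"

lemma lproves_mono: "lproves T \<Delta> \<phi> \<Longrightarrow> \<Delta> \<subseteq> \<Delta>' \<Longrightarrow> lproves T \<Delta>' \<phi>"
  by (induction rule: lproves.induct) (auto intro: lproves.intros)

lemma lproves_empty: "lproves T {} \<phi> \<Longrightarrow> T \<turnstile> \<phi>"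
  by (induction rule: lproves.induct) (auto intro: mp)

lemma deduction: "lproves T (insert \<psi> \<Delta>) \<phi> \<Longrightarrow> lproves T \<Delta> (Imp \<psi> \<phi>)"
proof (induction rule: lproves.induct)
  case (ass \<phi>)
  then show ?case
    by (metis insertE lproves.intros proves_refl ax_K)
next
  case (lthm \<phi>)
  then show ?case by (intro lproves.lthm proves_weaken)
next
  case (lmp \<phi> \<chi>)
  then show ?case by (meson lproves.lmp lproves.lthm ax_S)
qed

text \<open>Contraposition \<open>ax_N\<close> is the only axiom on negation, so double negation
  elimination, ex falso and reductio are derived first. Then \<psi> and its negation are both
  refuted from the negated goal.\<close>

lemma lproves_cases:
  assumes 1: "lproves T (insert \<psi> \<Delta>) \<phi>" and 2: "lproves T (insert (Neg \<psi>) \<Delta>) \<phi>"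
  shows "lproves T \<Delta> \<phi>"
proof -
  have dne: "lproves T \<Gamma> \<alpha>" if "lproves T \<Gamma> (Neg (Neg \<alpha>))" for \<Gamma> \<alpha>
    using that by (meson ax_K ax_N lmp lproves.lthm)
  have exf: "lproves T \<Gamma> \<beta>" if "lproves T \<Gamma> \<alpha>" "lproves T \<Gamma> (Neg \<alpha>)" for \<Gamma> \<alpha> \<beta>
    by (rule lmp[OF lmp[OF lproves.lthm[OF ax_N] lmp[OF lproves.lthm[OF ax_K] that(2)]] that(1)])
  have contra: "lproves T \<Gamma> (Neg \<alpha>)" if "lproves T (insert \<alpha> \<Gamma>) \<beta>" "lproves T (insert \<alpha> \<Gamma>) (Neg \<beta>)" for \<Gamma> \<alpha> \<beta>
  proof -
    let ?T = "Imp \<beta> \<beta>"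
    have "lproves T (insert \<alpha> \<Gamma>) (Neg ?T)" using that exf by blast
    then have "lproves T \<Gamma> (Imp \<alpha> (Neg ?T))" by (rule deduction)
    then have "lproves T (insert (Neg (Neg \<alpha>)) \<Gamma>) (Imp \<alpha> (Neg ?T))"
      by (rule lproves_mono) auto
    then have "lproves T (insert (Neg (Neg \<alpha>)) \<Gamma>) (Neg ?T)"
      by (meson ass dne insertI1 lmp)
    then have "lproves T \<Gamma> (Imp (Neg (Neg \<alpha>)) (Neg ?T))" by (rule deduction)
    then show ?thesis by (meson ax_N lmp lproves.lthm proves_refl)
  qed
  let ?\<Gamma> = "insert (Neg \<phi>) \<Delta>"
  have n: "lproves T ?\<Gamma> (Neg \<phi>)" by (auto intro: ass)
  have "lproves T ?\<Gamma> (Neg \<psi>)"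
    by (rule contra[of _ _ \<phi>]) (rule lproves_mono[OF 1], auto intro: ass)
  moreover have "lproves T ?\<Gamma> (Neg (Neg \<psi>))"
    by (rule contra[of _ _ \<phi>]) (rule lproves_mono[OF 2], auto intro: ass)
  ultimately have "lproves T ?\<Gamma> \<phi>" using exf by blast
  then have "lproves T \<Delta> (Neg (Neg \<phi>))" by (rule contra[of _ _ \<phi>, OF _ n])
  then show ?thesis by (rule dne)
qed

lemma lproves_exfalso: "lproves T \<Delta> \<phi> \<Longrightarrow> lproves T \<Delta> (Neg \<phi>) \<Longrightarrow> lproves T \<Delta> \<psi>"
  by (rule lmp[OF lmp[OF lproves.lthm[OF ax_N] lmp[OF lproves.lthm[OF ax_K]]]])

text \<open>The rule \<open>gen\<close> applies to theorems without local hypotheses, so the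
  finitely many members of \<Delta> are first moved into the antecedent \<chi> by
  conjunction.\<close>

lemma lproves_fresh:
  assumes "finite \<Delta>" and "lproves T \<Delta> (sub 0 (Var k) \<phi>)"
    and "\<forall>\<psi>\<in>\<Delta>. k \<notin> fv \<psi>" and "k \<notin> fv (Forall \<phi>)"
  shows "lproves T \<Delta> (Forall \<phi>)"
proof -
  have *: "lproves T \<Delta> (Imp \<chi> (Forall \<phi>))"
    if "finite \<Delta>" "lproves T \<Delta> (Imp \<chi> (sub 0 (Var k) \<phi>))" "\<forall>\<psi>\<in>\<Delta>. k \<notin> fv \<psi>" "k \<notin> fv \<chi>" for \<chi> \<Delta>
    using that
  proof (induction \<Delta> arbitrary: \<chi> rule: finite_induct)
    case empty
    \<comment> \<open>Sending the fresh variable k to 0 and shifting all others turns \<chi> into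
      \<open>lift 0 \<chi>\<close> and the instance back into \<phi>, the shape that
      \<open>gen\<close> expects.\<close>
    let ?\<sigma> = "\<lambda>i. if i = k then Var 0 else Var (Suc i)"
    have "psubst ?\<sigma> \<chi> = lift 0 \<chi>"
      unfolding lift_psubst by (rule psubst_cong) (use empty in auto)
    moreover have "psubst ?\<sigma> (sub 0 (Var k) \<phi>) = psubst Var \<phi>"
      unfolding sub_psubst psubst_comp
    proof (rule psubst_cong)
      fix i assume "i \<in> fv \<phi>"
      then show "psubst_tm ?\<sigma> (if i < 0 then Var i else if i = 0 then Var k else Var (i - 1)) = Var i"
        using assms(4) by (cases i) auto
    qed
    ultimately show ?case
      using proves_psubst[OF lproves_empty[OF empty(1)], of ?\<sigma>]
      by (intro lproves.lthm gen) (simp add: psubst_Var)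
  next
    case (insert \<psi> \<Delta>)
    let ?c = "Neg (Imp \<psi> (Neg \<chi>))"
    have "lproves T (insert \<psi> (insert ?c \<Delta>)) \<chi>"
    proof (rule lproves_cases[of _ \<chi>])
      show "lproves T (insert (Neg \<chi>) (insert \<psi> (insert ?c \<Delta>))) \<chi>"
        by (rule lproves_exfalso[of _ _ "Imp \<psi> (Neg \<chi>)"])
          (auto intro: ass lmp[OF lproves.lthm[OF ax_K]])
    qed (auto intro: ass)
    have cp: "lproves T (insert ?c \<Delta>) \<psi>"
    proof (rule lproves_cases[of _ \<psi>])
      show "lproves T (insert (Neg \<psi>) (insert ?c \<Delta>)) \<psi>"
        by (rule lproves_exfalso[of _ _ "Imp \<psi> (Neg \<chi>)"])
          (auto intro: ass lproves_exfalso deduction)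
    qed (auto intro: ass)
    have cc: "lproves T (insert ?c \<Delta>) \<chi>"
      using \<open>lproves T (insert \<psi> (insert ?c \<Delta>)) \<chi>\<close> cp by (meson deduction lmp)
    have "lproves T \<Delta> (Imp \<psi> (Imp \<chi> (sub 0 (Var k) \<phi>)))"
      using insert.prems deduction by blast
    then have "lproves T (insert ?c \<Delta>) (Imp \<psi> (Imp \<chi> (sub 0 (Var k) \<phi>)))"
      by (rule lproves_mono) auto
    then have "lproves T (insert ?c \<Delta>) (sub 0 (Var k) \<phi>)"
      using cp cc by (meson lmp)
    then have "lproves T \<Delta> (Imp ?c (sub 0 (Var k) \<phi>))" by (rule deduction)
    then have c: "lproves T \<Delta> (Imp ?c (Forall \<phi>))"
      using insert.prems by (intro insert.IH) auto
    have "lproves T (insert \<chi> (insert \<psi> \<Delta>)) ?c"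
    proof (rule lproves_cases[of _ "Imp \<psi> (Neg \<chi>)"])
      show "lproves T (insert (Imp \<psi> (Neg \<chi>)) (insert \<chi> (insert \<psi> \<Delta>))) ?c"
        by (rule lproves_exfalso[of _ _ \<chi>]) (auto intro: ass lmp[of _ _ \<psi>])
    qed (auto intro: ass)
    moreover have "lproves T (insert \<chi> (insert \<psi> \<Delta>)) (Imp ?c (Forall \<phi>))"
      by (rule lproves_mono[OF c]) auto
    ultimately show ?case by (meson deduction lmp)
  qed
  \<comment> \<open>A closed tautology serves as the empty conjunction of hypotheses.\<close>
  have "lproves T \<Delta> (Imp (Imp Zero' Zero') (sub 0 (Var k) \<phi>))" if "Zero' = Eq Zero Zero" for Zero'
    using assms(2) by (meson ax_K lmp lproves.lthm)
  from *[OF assms(1) this[OF refl] assms(3)] show ?thesis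
    by (simp add: lmp[OF _ lproves.lthm[OF proves_refl]])
qed

lemma lproves_compact: "lproves T \<Delta> \<phi> \<Longrightarrow> \<exists>\<Gamma>. finite \<Gamma> \<and> \<Gamma> \<subseteq> \<Delta> \<and> lproves T \<Gamma> \<phi>"
proof (induction rule: lproves.induct)
  case (ass \<phi>)
  then show ?case by (intro exI[of _ "{\<phi>}"]) (auto intro: lproves.ass)
next
  case (lthm \<phi>)
  then show ?case by (intro exI[of _ "{}"]) (auto intro: lproves.lthm)
next
  case (lmp \<phi> \<psi>)
  then obtain \<Gamma>1 \<Gamma>2 where "finite \<Gamma>1" "\<Gamma>1 \<subseteq> \<Delta>" "lproves T \<Gamma>1 (Imp \<phi> \<psi>)"
    "finite \<Gamma>2" "\<Gamma>2 \<subseteq> \<Delta>" "lproves T \<Gamma>2 \<phi>" by blast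
  then show ?case
    by (intro exI[of _ "\<Gamma>1 \<union> \<Gamma>2"]) (auto intro: lproves.lmp lproves_mono)
qed

lemma inj_gn_tm: "gn_tm s = gn_tm t \<Longrightarrow> s = t"
  by (induction s arbitrary: t; case_tac t) auto

lemma inj_gn: "gn \<phi> = gn \<psi> \<Longrightarrow> \<phi> = \<psi>"
  by (induction \<phi> arbitrary: \<psi>; case_tac \<psi>) (auto dest: inj_gn_tm)

section \<open>Henkin extensions\<close>

definition consistent :: "fm set \<Rightarrow> fm set \<Rightarrow> bool" where
  "consistent T \<Delta> \<longleftrightarrow> \<not> (\<exists>\<phi>. lproves T \<Delta> \<phi> \<and> lproves T \<Delta> (Neg \<phi>))"

lemma inconsistent_lproves: "\<not> consistent T (insert (Neg \<phi>) \<Delta>) \<Longrightarrow> lproves T \<Delta> \<phi>"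
  unfolding consistent_def by (rule lproves_cases[of _ \<phi>]) (auto intro: ass lproves_exfalso)

lemma consistent_cases: "consistent T \<Delta> \<Longrightarrow> consistent T (insert \<phi> \<Delta>) \<or> consistent T (insert (Neg \<phi>) \<Delta>)"
  unfolding consistent_def by (meson lproves_exfalso lproves_cases)

lemma consistent_witness:
  assumes "finite \<Delta>" "consistent T \<Delta>" "Neg (Forall \<phi>) \<in> \<Delta>"
  shows "\<exists>k. consistent T (insert (Neg (sub 0 (Var k) \<phi>)) \<Delta>)"
proof -
  have "finite (\<Union>(fv ` \<Delta>))" using assms by simp
  then obtain k where k: "k \<notin> \<Union>(fv ` \<Delta>)" using ex_new_if_finite[OF infinite_UNIV_nat] by blast
  have "consistent T (insert (Neg (sub 0 (Var k) \<phi>)) \<Delta>)"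
  proof (rule ccontr)
    assume "\<not> ?thesis"
    then have "lproves T \<Delta> (sub 0 (Var k) \<phi>)" by (rule inconsistent_lproves)
    then have "lproves T \<Delta> (Forall \<phi>)"
      by (rule lproves_fresh[OF assms(1)]) (use k assms(3) in fastforce)+
    then show False using assms unfolding consistent_def by (meson ass)
  qed
  then show ?thesis by blast
qed

text \<open>Every stage is finite, so some variable is always fresh and can serve as the witness in
  place of a new constant.\<close>

definition henkin_ext :: "fm set \<Rightarrow> fm set \<Rightarrow> fm \<Rightarrow> fm set \<Rightarrow> bool" where
  "henkin_ext T \<Delta> \<phi> \<Delta>' \<longleftrightarrow> finite \<Delta>' \<and> consistent T \<Delta>' \<and> \<Delta> \<subseteq> \<Delta>' \<and> (\<phi> \<in> \<Delta>' \<or> Neg \<phi> \<in> \<Delta>') \<and>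
     (\<forall>\<chi>. \<phi> = Forall \<chi> \<and> Neg \<phi> \<in> \<Delta>' \<longrightarrow> (\<exists>k. Neg (sub 0 (Var k) \<chi>) \<in> \<Delta>'))"

lemma henkin_ext_exists:
  assumes "finite \<Delta>" "consistent T \<Delta>"
  shows "\<exists>\<Delta>'. henkin_ext T \<Delta> \<phi> \<Delta>'"
proof (cases "consistent T (insert \<phi> \<Delta>)")
  case True
  have "\<not> Neg \<phi> \<in> insert \<phi> \<Delta>"
    using True unfolding consistent_def by (meson ass insertI1)
  then show ?thesis using True assms unfolding henkin_ext_def by (intro exI[of _ "insert \<phi> \<Delta>"]) auto
next
  case False
  then have c: "consistent T (insert (Neg \<phi>) \<Delta>)" using consistent_cases assms by blast
  show ?thesis
  proof (cases "\<exists>\<chi>. \<phi> = Forall \<chi>")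
    case True
    then obtain \<chi> where \<chi>: "\<phi> = Forall \<chi>" by blast
    then obtain k where "consistent T (insert (Neg (sub 0 (Var k) \<chi>)) (insert (Neg \<phi>) \<Delta>))"
      using consistent_witness[OF _ c] assms by auto
    then show ?thesis using assms \<chi> unfolding henkin_ext_def
      by (intro exI[of _ "insert (Neg (sub 0 (Var k) \<chi>)) (insert (Neg \<phi>) \<Delta>)"]) auto
  next
    case False
    then show ?thesis using c assms unfolding henkin_ext_def
      by (intro exI[of _ "insert (Neg \<phi>) \<Delta>"]) auto
  qed
qed

lemma henkin_extension:
  assumes "finite \<Delta>" "consistent T \<Delta>"
  obtains H where "\<Delta> \<subseteq> H" "\<And>\<phi>. lproves T H \<phi> \<longleftrightarrow> \<phi> \<in> H" "\<And>\<phi>. Neg \<phi> \<in> H \<longleftrightarrow> \<phi> \<notin> H"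
    "\<And>\<phi>. Forall \<phi> \<in> H \<longleftrightarrow> (\<forall>t. sub 0 t \<phi> \<in> H)"
proof -
  \<comment> \<open>Stage n decides the formula with Goedel number n. If n is no Goedel number,
    \<open>inv gn n\<close> is an arbitrary formula, and deciding it does no harm.\<close>
  define D where "D = rec_nat \<Delta> (\<lambda>n \<Delta>'. SOME \<Delta>''. henkin_ext T \<Delta>' (inv gn n) \<Delta>'')"
  have fc: "finite (D n) \<and> consistent T (D n)" for n
  proof (induction n)
    case 0
    then show ?case using assms by (simp add: D_def)
  next
    case (Suc n)
    have "henkin_ext T (D n) (inv gn n) (D (Suc n))"
      unfolding D_def using henkin_ext_exists[of "D n" T "inv gn n"] Suc
      by (auto simp: D_def intro: someI)
    then show ?case by (auto simp: henkin_ext_def)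
  qed
  have step: "henkin_ext T (D n) (inv gn n) (D (Suc n))" for n
    unfolding D_def using henkin_ext_exists[of "D n" T "inv gn n"] fc[of n]
    by (auto simp: D_def intro: someI)
  have mono: "D m \<subseteq> D n" if "m \<le> n" for m n
    using that by (rule lift_Suc_mono_le[rotated]) (use step in \<open>auto simp: henkin_ext_def\<close>)
  define H where "H = (\<Union>n. D n)"
  have inv: "inv gn (gn \<phi>) = \<phi>" for \<phi>
    by (rule inv_f_f) (auto intro: injI dest: inj_gn)
  have sub: "\<exists>n. \<Gamma> \<subseteq> D n" if "finite \<Gamma>" "\<Gamma> \<subseteq> H" for \<Gamma>
    using that
  proof (induction \<Gamma> rule: finite_induct)
    case (insert \<phi> \<Gamma>)
    then obtain m n where "\<Gamma> \<subseteq> D m" "\<phi> \<in> D n" by (auto simp: H_def)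
    then show ?case using mono[of m "max m n"] mono[of n "max m n"] by auto
  qed auto
  have con: "consistent T H"
  proof (rule ccontr)
    assume "\<not> consistent T H"
    then obtain \<phi> where "lproves T H \<phi>" "lproves T H (Neg \<phi>)" by (auto simp: consistent_def)
    then obtain \<Gamma>1 \<Gamma>2 where "finite \<Gamma>1" "\<Gamma>1 \<subseteq> H" "lproves T \<Gamma>1 \<phi>"
      "finite \<Gamma>2" "\<Gamma>2 \<subseteq> H" "lproves T \<Gamma>2 (Neg \<phi>)" by (meson lproves_compact)
    moreover then obtain n where "\<Gamma>1 \<union> \<Gamma>2 \<subseteq> D n" using sub[of "\<Gamma>1 \<union> \<Gamma>2"] by auto
    ultimately show False using fc[of n]
      by (meson consistent_def le_sup_iff lproves_mono)
  qed
  have ex: "\<phi> \<in> H \<or> Neg \<phi> \<in> H" for \<phi>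
    using step[of "gn \<phi>"] by (auto simp: henkin_ext_def inv H_def)
  have cl: "lproves T H \<phi> \<longleftrightarrow> \<phi> \<in> H" for \<phi>
    using ex[of \<phi>] con by (auto simp: consistent_def intro: ass)
  have ng: "Neg \<phi> \<in> H \<longleftrightarrow> \<phi> \<notin> H" for \<phi>
    using ex[of \<phi>] con unfolding consistent_def by (auto simp: cl)
  have all: "Forall \<phi> \<in> H \<longleftrightarrow> (\<forall>t. sub 0 t \<phi> \<in> H)" for \<phi>
  proof
    assume "Forall \<phi> \<in> H"
    then show "\<forall>t. sub 0 t \<phi> \<in> H" by (metis cl ax_All lmp lproves.lthm)
  next
    assume *: "\<forall>t. sub 0 t \<phi> \<in> H"
    show "Forall \<phi> \<in> H"
    proof (rule ccontr)
      assume "Forall \<phi> \<notin> H"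
      then have "Forall \<phi> \<notin> D (Suc (gn (Forall \<phi>)))" by (auto simp: H_def)
      then have "Neg (Forall \<phi>) \<in> D (Suc (gn (Forall \<phi>)))"
        using step[of "gn (Forall \<phi>)"] by (auto simp: henkin_ext_def inv simp del: gn.simps)
      then obtain k where "Neg (sub 0 (Var k) \<phi>) \<in> D (Suc (gn (Forall \<phi>)))"
        using step[of "gn (Forall \<phi>)"] by (auto simp: henkin_ext_def inv simp del: gn.simps)
      then have "Neg (sub 0 (Var k) \<phi>) \<in> H" by (auto simp: H_def)
      then show False using * ng by blast
    qed
  qed
  have "D 0 = \<Delta>" by (simp add: D_def)
  then have "\<Delta> \<subseteq> H" by (auto simp: H_def)
  then show ?thesis using that cl ng all by blast
qed

text \<open>The two hypotheses on successor make the numerals pairwise distinct classes, so the term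
  model is countably infinite and can be carried over to \<open>nat\<close>. Provability can then be
  tested on this one carrier.\<close>

lemma completeness:
  assumes inj: "T \<turnstile> Imp (Eq (Succ (Var 0)) (Succ (Var 1))) (Eq (Var 0) (Var 1))"
    and nz: "T \<turnstile> Neg (Eq (Succ (Var 0)) Zero)"
    and valid: "\<And>(M :: nat model) e. models M T \<Longrightarrow> msat M e \<phi>"
  shows "T \<turnstile> \<phi>"
proof (rule ccontr)
  assume "\<not> T \<turnstile> \<phi>"
  then have "consistent T {Neg \<phi>}" using inconsistent_lproves lproves_empty by blast
  then obtain H where H: "{Neg \<phi>} \<subseteq> H" "\<And>\<phi>. lproves T H \<phi> \<longleftrightarrow> \<phi> \<in> H" "\<And>\<phi>. Neg \<phi> \<in> H \<longleftrightarrow> \<phi> \<notin> H"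
    "\<And>\<phi>. Forall \<phi> \<in> H \<longleftrightarrow> (\<forall>t. sub 0 t \<phi> \<in> H)"
    using henkin_extension[of "{Neg \<phi>}" T] by auto
  have thH: "psubst \<sigma> \<psi> \<in> H" if "T \<turnstile> \<psi>" for \<psi> \<sigma>
    using H(2) proves_psubst[OF that] lproves.lthm by blast
  have mp: "\<psi> \<in> H" if "Imp \<chi> \<psi> \<in> H" "\<chi> \<in> H" for \<chi> \<psi>
    using H(2) that lmp by blast
  have imp: "Imp \<chi> \<psi> \<in> H \<longleftrightarrow> (\<chi> \<in> H \<longrightarrow> \<psi> \<in> H)" for \<chi> \<psi>
    by (metis H(2,3) mp ass deduction insertI1 lproves_exfalso lproves_mono subset_insertI)
  have eqax: "psubst \<sigma> \<psi> \<in> H" if "\<psi> \<in> set equality_axioms" for \<psi> \<sigma>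
    using thH ax_Eq that by blast
  define eq where "eq s t \<longleftrightarrow> Eq s t \<in> H" for s t
  have refl: "eq s s" for s
    using eqax[of "Eq (Var 0) (Var 0)" "\<lambda>_. s"] by (simp add: eq_def equality_axioms_def)
  have euc: "eq s t \<Longrightarrow> eq s u \<Longrightarrow> eq t u" for s t u
    using eqax[of "equality_axioms ! 1" "((!) [s, t, u])"] by (simp add: eq_def equality_axioms_def imp)
  have sym: "eq s t \<longleftrightarrow> eq t s" for s t using euc refl by blast
  have cS: "eq s t \<Longrightarrow> eq (Succ s) (Succ t)" for s t
    using eqax[of "equality_axioms ! 2" "((!) [s, t])"] by (simp add: eq_def equality_axioms_def imp)
  have cP: "eq s t \<Longrightarrow> eq s' t' \<Longrightarrow> eq (Plus s s') (Plus t t')" for s t s' t'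
    using eqax[of "equality_axioms ! 3" "((!) [s, t, s', t'])"] by (simp add: eq_def equality_axioms_def imp)
  have cT: "eq s t \<Longrightarrow> eq s' t' \<Longrightarrow> eq (Times s s') (Times t t')" for s t s' t'
    using eqax[of "equality_axioms ! 4" "((!) [s, t, s', t'])"] by (simp add: eq_def equality_axioms_def imp)
  have cL: "eq s t \<Longrightarrow> eq s' t' \<Longrightarrow> Lt s s' \<in> H \<Longrightarrow> Lt t t' \<in> H" for s t s' t'
    using eqax[of "equality_axioms ! 5" "((!) [s, t, s', t'])"] by (simp add: eq_def equality_axioms_def imp)
  define Q where "Q = range (\<lambda>t. Collect (eq t))"
  have cls: "Collect (eq s) = Collect (eq t) \<longleftrightarrow> eq s t" for s t
    using euc sym refl by blast
  have "inj (\<lambda>n. Collect (eq (num n)))"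
  proof (rule injI, simp only: cls)
    fix m n
    assume "eq (num m) (num n)"
    then show "m = n"
    proof (induction m arbitrary: n)
      case 0
      have "\<not> eq (Succ s) Zero" for s
        using thH[OF nz, of "\<lambda>_. s"] by (simp add: eq_def H(3))
      then show ?case using 0 sym by (cases n) (auto simp: num_def)
    next
      case (Suc m)
      have 1: "\<not> eq (Succ s) Zero" for s
        using thH[OF nz, of "\<lambda>_. s"] by (simp add: eq_def H(3))
      have 2: "eq (Succ s) (Succ t) \<Longrightarrow> eq s t" for s t
        using thH[OF inj, of "((!) [s, t])"] by (simp add: eq_def imp)
      show ?case using Suc 1 2 by (cases n) (auto simp: num_def)
    qed
  qed
  moreover have "range (\<lambda>n. Collect (eq (num n))) \<subseteq> Q" by (auto simp: Q_def)
  ultimately have inf: "infinite Q" using finite_subset range_inj_infinite by blast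
  have "countable (UNIV :: tm set)"
    by (rule countableI[of gn_tm]) (auto intro: inj_onI dest: inj_gn_tm)
  then have "countable Q" by (simp add: Q_def)
  then have bij: "bij_betw (to_nat_on Q) Q UNIV" using inf by (rule to_nat_on_infinite)
  define p where "p t = to_nat_on Q (Collect (eq t))" for t
  have p: "p s = p t \<longleftrightarrow> eq s t" for s t
  proof -
    have "p s = p t \<longleftrightarrow> Collect (eq s) = Collect (eq t)"
      unfolding p_def by (rule inj_on_eq_iff[OF bij_betw_imp_inj_on[OF bij]]) (auto simp: Q_def)
    then show ?thesis by (simp only: cls)
  qed
  have sp: "surj p"
  proof (rule surjI)
    fix n
    have "n \<in> to_nat_on Q ` Q" using bij by (auto simp: bij_betw_def)
    then have "\<exists>t. p t = n" by (auto simp: Q_def p_def)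
    then show "p (SOME t. p t = n) = n" by (rule someI_ex)
  qed
  have pi: "p (inv p n) = n" for n using sp by (simp add: surj_f_inv_f)
  have ip: "eq (inv p (p t)) t" for t using pi p by blast
  define M where "M = \<lparr>mZero = p Zero, mSuc = (\<lambda>a. p (Succ (inv p a))),
      mPlus = (\<lambda>a b. p (Plus (inv p a) (inv p b))), mTimes = (\<lambda>a b. p (Times (inv p a) (inv p b))),
      mLess = (\<lambda>a b. Lt (inv p a) (inv p b) \<in> H)\<rparr>"
  have ev: "meval M (\<lambda>i. p (\<sigma> i)) t = p (psubst_tm \<sigma> t)" for \<sigma> t
    by (induction t) (auto simp: M_def p intro: cS cP cT ip)
  have truth: "msat M (\<lambda>i. p (\<sigma> i)) \<psi> \<longleftrightarrow> psubst \<sigma> \<psi> \<in> H" for \<sigma> \<psi>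
  proof (induction \<psi> arbitrary: \<sigma>)
    case (Eq s t)
    then show ?case by (simp add: ev p eq_def)
  next
    case (Lt s t)
    have "Lt (inv p (p u)) (inv p (p v)) \<in> H \<longleftrightarrow> Lt u v \<in> H" for u v
      using cL[OF ip ip, of u v] cL[of u "inv p (p u)" v "inv p (p v)"] ip sym by blast
    moreover have "mLess M (p u) (p v) \<longleftrightarrow> Lt (inv p (p u)) (inv p (p v)) \<in> H" for u v
      by (simp add: M_def)
    ultimately show ?case by (simp add: ev)
  next
    case (Neg \<psi>)
    then show ?case by (simp add: H(3))
  next
    case (Imp \<psi> \<chi>)
    then show ?case by (simp add: imp)
  next
    case (Forall \<psi>)
    have *: "p t ## (\<lambda>i. p (\<sigma> i)) = (\<lambda>i. p ((t ## \<sigma>) i))" for t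
      by (auto simp: fun_eq_iff split: nat.split)
    have "msat M (\<lambda>i. p (\<sigma> i)) (Forall \<psi>) \<longleftrightarrow> (\<forall>t. msat M (p t ## (\<lambda>i. p (\<sigma> i))) \<psi>)"
      using pi by simp metis
    also have "\<dots> \<longleftrightarrow> (\<forall>t. psubst (t ## \<sigma>) \<psi> \<in> H)" by (simp only: * Forall)
    also have "\<dots> \<longleftrightarrow> psubst \<sigma> (Forall \<psi>) \<in> H" by (simp add: H(4) sub_0_psubst_up)
    finally show ?case .
  qed
  have "models M T"
    unfolding models_def
  proof (intro ballI allI)
    fix \<psi> e
    assume "\<psi> \<in> T"
    then have "psubst (\<lambda>i. inv p (e i)) \<psi> \<in> H" by (intro thH proves.ax)
    then show "msat M e \<psi>" using truth[of "\<lambda>i. inv p (e i)" \<psi>] by (simp add: pi)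
  qed
  \<comment> \<open>Each variable denotes its own class, so truth of \<phi> becomes membership in
    H.\<close>
  then have "msat M (\<lambda>i. p (Var i)) \<phi>" by (rule valid)
  then have "\<phi> \<in> H" by (simp only: truth psubst_Var)
  then show False using H(1,3) by blast
qed

section \<open>Definability with parameters\<close>

lemma delta0_psubst: "delta0 \<phi> \<Longrightarrow> delta0 (psubst \<sigma> \<phi>)"
proof (induction arbitrary: \<sigma> rule: delta0.induct)
  case (5 \<phi> t)
  have "psubst_tm (up \<sigma>) (lift_tm 0 t) = lift_tm 0 (psubst_tm \<sigma> t)"
    by (simp add: psubst_tm_up_lift lift_tm_psubst_tm)
  then show ?case using 5 by (auto intro: delta0.intros)
next
  case (6 \<phi> t)
  have "psubst_tm (up \<sigma>) (lift_tm 0 t) = lift_tm 0 (psubst_tm \<sigma> t)"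
    by (simp add: psubst_tm_up_lift lift_tm_psubst_tm)
  then show ?case using 6 by (auto intro: delta0.intros)
qed (auto intro: delta0.intros)

text \<open>\<open>sigma1\<close> is strictly prenex, whereas the arithmetization mixes existential
  quantifiers with conjunction, disjunction and bounded quantifiers;
  \<open>sigma_normal_form\<close> leads back to the prenex form.\<close>

inductive sigma_fm :: "fm \<Rightarrow> bool" where
  sigma_delta0: "delta0 \<phi> \<Longrightarrow> sigma_fm \<phi>"
| sigma_Conj: "sigma_fm \<phi> \<Longrightarrow> sigma_fm \<psi> \<Longrightarrow> sigma_fm (Conj \<phi> \<psi>)"
| sigma_Disj: "sigma_fm \<phi> \<Longrightarrow> sigma_fm \<psi> \<Longrightarrow> sigma_fm (Disj \<phi> \<psi>)"
| sigma_Exists: "sigma_fm \<phi> \<Longrightarrow> sigma_fm (Exists \<phi>)"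
| sigma_Ball: "sigma_fm \<phi> \<Longrightarrow> sigma_fm (Forall (Imp (Lt (Var 0) (lift_tm 0 t)) \<phi>))"

lemma sigma1_sigma_fm: "sigma1 \<phi> \<Longrightarrow> sigma_fm \<phi>"
  by (induction rule: sigma1.induct) (auto intro: sigma_fm.intros)

lemma sigma1_psubst: "sigma1 \<phi> \<Longrightarrow> sigma1 (psubst \<sigma> \<phi>)"
  by (induction arbitrary: \<sigma> rule: sigma1.induct) (auto intro: sigma1.intros delta0_psubst)

lemma sigma_psubst: "sigma_fm \<phi> \<Longrightarrow> sigma_fm (psubst \<sigma> \<phi>)"
proof (induction arbitrary: \<sigma> rule: sigma_fm.induct)
  case (sigma_Ball \<phi> t)
  have "psubst_tm (up \<sigma>) (lift_tm 0 t) = lift_tm 0 (psubst_tm \<sigma> t)"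
    by (simp add: psubst_tm_up_lift lift_tm_psubst_tm)
  then show ?case using sigma_Ball by (auto intro: sigma_fm.intros)
qed (auto intro: sigma_fm.intros delta0_psubst)

text \<open>Definability is always with parameters: the even-numbered variables are the arguments, the
  odd-numbered ones stand for the parameters.\<close>

definition mix :: "(nat \<Rightarrow> 'a) \<Rightarrow> (nat \<Rightarrow> 'a) \<Rightarrow> nat \<Rightarrow> 'a" where
  "mix e p i = (if even i then e (i div 2) else p (i div 2))"

text \<open>Two parameter lists are merged by interleaving: parameter j of p becomes parameter 2j of
  \<open>mix p q\<close>, which moves variable 2j + 1 to 4j + 1. For q the target is 4j + 3.\<close>

lemma mix_mix1: "mix e p i = mix e (mix p q) (if even i then i else 2 * i - 1)"
proof (cases "even i")
  case False
  then obtain j where "i = 2 * j + 1" by (elim oddE)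
  then have "2 * i - 1 = 2 * (2 * j) + 1" by simp
  then show ?thesis using False \<open>i = 2 * j + 1\<close> by (simp only: mix_def) simp
qed (simp add: mix_def)

lemma mix_mix2: "mix e q i = mix e (mix p q) (if even i then i else 2 * i + 1)"
proof (cases "even i")
  case False
  then obtain j where "i = 2 * j + 1" by (elim oddE)
  then have "2 * i + 1 = 2 * (2 * j + 1) + 1" by simp
  then show ?thesis using False \<open>i = 2 * j + 1\<close> by (simp only: mix_def) simp
qed (simp add: mix_def)

text \<open>A binder raises every other variable by one and so exchanges the parities of arguments
  and parameters; the renaming compensates for this.\<close>

lemma mix_econs: "mix (a ## e) p i = (a ## mix e p) (if i = 0 then 0 else if even i then i - 1 else Suc i)"
  by (cases i) (auto simp: mix_def elim!: oddE)

definition dtmp :: "'a model \<Rightarrow> (nat \<Rightarrow> 'a) \<Rightarrow> ((nat \<Rightarrow> 'a) \<Rightarrow> 'a) \<Rightarrow> bool" where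
  "dtmp M p t \<longleftrightarrow> (\<exists>u. \<forall>e. t e = meval M (mix e p) u)"

definition dfmp :: "(fm \<Rightarrow> bool) \<Rightarrow> 'a model \<Rightarrow> (nat \<Rightarrow> 'a) \<Rightarrow> ((nat \<Rightarrow> 'a) \<Rightarrow> bool) \<Rightarrow> bool" where
  "dfmp C M p R \<longleftrightarrow> (\<exists>\<phi>. C \<phi> \<and> (\<forall>e. R e \<longleftrightarrow> msat M (mix e p) \<phi>))"

definition psubst_closed :: "(fm \<Rightarrow> bool) \<Rightarrow> bool" where
  "psubst_closed C \<longleftrightarrow> (\<forall>\<phi> \<sigma>. C \<phi> \<longrightarrow> C (psubst \<sigma> \<phi>))"

lemma dtmp_mix1: "dtmp M p t \<Longrightarrow> dtmp M (mix p q) t"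
proof -
  assume "dtmp M p t"
  then obtain u where u: "\<forall>e. t e = meval M (mix e p) u" by (auto simp: dtmp_def)
  let ?\<sigma> = "\<lambda>i. Var (if even i then i else 2 * i - 1)"
  have "\<forall>e. t e = meval M (mix e (mix p q)) (psubst_tm ?\<sigma> u)"
    unfolding meval_psubst meval.simps mix_mix1[symmetric] using u by simp
  then show ?thesis unfolding dtmp_def by blast
qed

lemma dtmp_mix2: "dtmp M q t \<Longrightarrow> dtmp M (mix p q) t"
proof -
  assume "dtmp M q t"
  then obtain u where u: "\<forall>e. t e = meval M (mix e q) u" by (auto simp: dtmp_def)
  let ?\<sigma> = "\<lambda>i. Var (if even i then i else 2 * i + 1)"
  have "\<forall>e. t e = meval M (mix e (mix p q)) (psubst_tm ?\<sigma> u)"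
    unfolding meval_psubst meval.simps mix_mix2[symmetric] using u by simp
  then show ?thesis unfolding dtmp_def by blast
qed

lemma dfmp_mix1:
  assumes "dfmp C M p R" and "psubst_closed C"
  shows "dfmp C M (mix p q) R"
proof -
  obtain \<phi> where \<phi>: "C \<phi>" "\<forall>e. R e = msat M (mix e p) \<phi>" using assms by (auto simp: dfmp_def)
  let ?\<sigma> = "\<lambda>i. Var (if even i then i else 2 * i - 1)"
  have "\<forall>e. R e = msat M (mix e (mix p q)) (psubst ?\<sigma> \<phi>)"
    unfolding msat_psubst meval.simps mix_mix1[symmetric] using \<phi> by simp
  then show ?thesis unfolding dfmp_def using assms \<phi> by (auto simp: psubst_closed_def)
qed

lemma dfmp_mix2:
  assumes "dfmp C M q R" and "psubst_closed C"
  shows "dfmp C M (mix p q) R"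
proof -
  obtain \<phi> where \<phi>: "C \<phi>" "\<forall>e. R e = msat M (mix e q) \<phi>" using assms by (auto simp: dfmp_def)
  let ?\<sigma> = "\<lambda>i. Var (if even i then i else 2 * i + 1)"
  have "\<forall>e. R e = msat M (mix e (mix p q)) (psubst ?\<sigma> \<phi>)"
    unfolding msat_psubst meval.simps mix_mix2[symmetric] using \<phi> by simp
  then show ?thesis unfolding dfmp_def using assms \<phi> by (auto simp: psubst_closed_def)
qed

definition TD :: "'a model \<Rightarrow> ((nat \<Rightarrow> 'a) \<Rightarrow> 'a) \<Rightarrow> bool" where
  "TD M t \<longleftrightarrow> (\<exists>p. dtmp M p t)"

text \<open>Definability is a property of predicates on environments, so it can be proved by
  introduction rules that follow the HOL term, without exhibiting a formula.\<close>

definition defin :: "(fm \<Rightarrow> bool) \<Rightarrow> 'a model \<Rightarrow> ((nat \<Rightarrow> 'a) \<Rightarrow> bool) \<Rightarrow> bool" where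
  "defin C M R \<longleftrightarrow> (\<exists>p. dfmp C M p R)"

abbreviation "DD \<equiv> defin delta0"
abbreviation "SD \<equiv> defin sigma_fm"

lemma psubst_closed [simp]: "psubst_closed delta0" "psubst_closed sigma1" "psubst_closed sigma_fm"
  by (auto simp: psubst_closed_def delta0_psubst sigma1_psubst sigma_psubst)

lemma TD_E2:
  assumes "TD M s" "TD M t"
  obtains p u v where "\<And>e. s e = meval M (mix e p) u" "\<And>e. t e = meval M (mix e p) v"
proof -
  obtain p q where "dtmp M p s" "dtmp M q t" using assms by (auto simp: TD_def)
  then have "dtmp M (mix p q) s" "dtmp M (mix p q) t" by (auto intro: dtmp_mix1 dtmp_mix2)
  then show ?thesis using that unfolding dtmp_def by blast
qed

lemma defin_E2:
  assumes "defin C M R" "defin C M S" "psubst_closed C"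
  obtains p \<phi> \<psi> where "C \<phi>" "\<And>e. R e = msat M (mix e p) \<phi>" "C \<psi>" "\<And>e. S e = msat M (mix e p) \<psi>"
proof -
  obtain p q where "dfmp C M p R" "dfmp C M q S" using assms by (auto simp: defin_def)
  then have "dfmp C M (mix p q) R" "dfmp C M (mix p q) S"
    using assms by (auto intro: dfmp_mix1 dfmp_mix2)
  then show ?thesis using that unfolding dfmp_def by blast
qed

lemma defin_TD_E2:
  assumes "TD M t" "defin C M R" "psubst_closed C"
  obtains p u \<phi> where "\<And>e. t e = meval M (mix e p) u" "C \<phi>" "\<And>e. R e = msat M (mix e p) \<phi>"
proof -
  obtain p q where "dtmp M p t" "dfmp C M q R" using assms by (auto simp: TD_def defin_def)
  then have "dtmp M (mix p q) t" "dfmp C M (mix p q) R"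
    using assms by (auto intro: dfmp_mix2 dtmp_mix1)
  then show ?thesis using that unfolding dfmp_def dtmp_def by blast
qed

lemma TD_I: "(\<And>e. t e = meval M (mix e p) u) \<Longrightarrow> TD M t"
  unfolding TD_def dtmp_def by blast

lemma defin_I: "C \<phi> \<Longrightarrow> (\<And>e. R e = msat M (mix e p) \<phi>) \<Longrightarrow> defin C M R"
  unfolding defin_def dfmp_def by blast

lemma TD_var: "TD M (\<lambda>e. e i)"
  by (rule TD_I[of _ _ undefined "Var (2 * i)"]) (simp add: mix_def)

lemma TD_const: "TD M (\<lambda>e. c)"
  by (rule TD_I[of _ _ "\<lambda>_. c" "Var 1"]) (simp add: mix_def)

lemma TD_Suc: "TD M t \<Longrightarrow> TD M (\<lambda>e. mSuc M (t e))"
  unfolding TD_def dtmp_def by (metis meval.simps(3))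

lemma TD_Plus: "TD M s \<Longrightarrow> TD M t \<Longrightarrow> TD M (\<lambda>e. mPlus M (s e) (t e))"
  by (erule (1) TD_E2, rule TD_I[of _ _ _ "Plus _ _"]) simp

lemma TD_Times: "TD M s \<Longrightarrow> TD M t \<Longrightarrow> TD M (\<lambda>e. mTimes M (s e) (t e))"
  by (erule (1) TD_E2, rule TD_I[of _ _ _ "Times _ _"]) simp

lemmas TD_intros = TD_var TD_const TD_Suc TD_Plus TD_Times

lemma DD_eq: "TD M s \<Longrightarrow> TD M t \<Longrightarrow> DD M (\<lambda>e. s e = t e)"
  by (erule (1) TD_E2, rule defin_I[of _ "Eq _ _"]) (auto intro: delta0.intros)

lemma DD_less: "TD M s \<Longrightarrow> TD M t \<Longrightarrow> DD M (\<lambda>e. mLess M (s e) (t e))"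
  by (erule (1) TD_E2, rule defin_I[of _ "Lt _ _"]) (auto intro: delta0.intros)

lemma DD_const: "DD M (\<lambda>e. c)"
proof (cases c)
  case True
  then show ?thesis by (intro defin_I[of _ "Eq Zero Zero"]) (auto intro: delta0.intros)
next
  case False
  then show ?thesis by (intro defin_I[of _ "Neg (Eq Zero Zero)"]) (auto intro: delta0.intros)
qed

lemma DD_not: "DD M R \<Longrightarrow> DD M (\<lambda>e. \<not> R e)"
  unfolding defin_def dfmp_def by (metis delta0.intros(3) msat.simps(3))

lemma DD_imp: "DD M R \<Longrightarrow> DD M S \<Longrightarrow> DD M (\<lambda>e. R e \<longrightarrow> S e)"
  by (erule (1) defin_E2[OF _ _ psubst_closed(1)], rule defin_I[of _ "Imp _ _"])
    (auto intro: delta0.intros)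

lemma DD_conj: "DD M R \<Longrightarrow> DD M S \<Longrightarrow> DD M (\<lambda>e. R e \<and> S e)"
  using DD_not[OF DD_imp[of M R "\<lambda>e. \<not> S e", OF _ DD_not]] by simp

lemma DD_disj: "DD M R \<Longrightarrow> DD M S \<Longrightarrow> DD M (\<lambda>e. R e \<or> S e)"
  using DD_imp[of M "\<lambda>e. \<not> R e" S, OF DD_not] by (simp add: imp_conv_disj)

lemmas DD_intros = DD_eq DD_less DD_not DD_conj DD_disj DD_imp DD_const

lemma defin_econs_E:
  assumes "defin C M (\<lambda>e. Q (e 0) (\<lambda>i. e (Suc i)))" "psubst_closed C"
  obtains p \<phi> where "C \<phi>" "\<And>a e. Q a e = msat M (a ## mix e p) \<phi>"
proof -
  obtain p \<phi> where \<phi>: "C \<phi>" "\<And>e. Q (e 0) (\<lambda>i. e (Suc i)) = msat M (mix e p) \<phi>"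
    using assms by (auto simp: defin_def dfmp_def)
  let ?\<sigma> = "\<lambda>i. Var (if i = 0 then 0 else if even i then i - 1 else Suc i)"
  have "Q a e = msat M (a ## mix e p) (psubst ?\<sigma> \<phi>)" for a e
    unfolding msat_psubst meval.simps mix_econs[symmetric] using \<phi>(2)[of "a ## e"] by simp
  moreover have "C (psubst ?\<sigma> \<phi>)" using \<phi>(1) assms(2) by (simp add: psubst_closed_def)
  ultimately show ?thesis by (rule that[rotated])
qed

lemma sigma1D_ex: "defin delta0 M (\<lambda>e. Q (e 0) (\<lambda>i. e (Suc i))) \<Longrightarrow> defin sigma1 M (\<lambda>e. \<exists>a. Q a e)"
  by (erule defin_econs_E, simp, rule defin_I[of _ "Exists _"]) (auto intro: sigma1.intros)

lemma SD_delta: "DD M R \<Longrightarrow> SD M R"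
  unfolding defin_def dfmp_def by (metis sigma_delta0)

lemma SD_conj: "SD M R \<Longrightarrow> SD M S \<Longrightarrow> SD M (\<lambda>e. R e \<and> S e)"
  by (erule (1) defin_E2[OF _ _ psubst_closed(3)], rule defin_I[of _ "Conj _ _"])
    (auto intro: sigma_Conj)

lemma SD_disj:
  assumes "SD M R" "SD M S"
  shows "SD M (\<lambda>e. R e \<or> S e)"
proof -
  obtain p \<phi> \<psi> where "sigma_fm \<phi>" "\<And>e. R e = msat M (mix e p) \<phi>"
    "sigma_fm \<psi>" "\<And>e. S e = msat M (mix e p) \<psi>"
    by (rule defin_E2[OF assms psubst_closed(3)]) blast
  then show ?thesis by (intro defin_I[of _ "Disj \<phi> \<psi>" _ _ p]) (auto intro: sigma_Disj)
qed

lemma SD_imp: "DD M R \<Longrightarrow> SD M S \<Longrightarrow> SD M (\<lambda>e. R e \<longrightarrow> S e)"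
  using SD_disj[OF SD_delta[OF DD_not[of M R]], of S] by simp

lemma SD_ex: "SD M (\<lambda>e. Q (e 0) (\<lambda>i. e (Suc i))) \<Longrightarrow> SD M (\<lambda>e. \<exists>a. Q a e)"
  by (erule defin_econs_E, simp, rule defin_I[of _ "Exists _"]) (auto intro: sigma_Exists)

lemma SD_ball:
  assumes "TD M t" "SD M (\<lambda>e. Q (e 0) (\<lambda>i. e (Suc i)))"
  shows "SD M (\<lambda>e. \<forall>a. mLess M a (t e) \<longrightarrow> Q a e)"
proof -
  obtain p u \<phi> where 1: "\<And>e. t e = meval M (mix e p) u" "sigma_fm \<phi>"
      "\<And>e. Q (e 0) (\<lambda>i. e (Suc i)) = msat M (mix e p) \<phi>"
    using defin_TD_E2[OF assms psubst_closed(3)] by blast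
  let ?\<sigma> = "\<lambda>i. Var (if i = 0 then 0 else if even i then i - 1 else Suc i)"
  have "Q a e = msat M (a ## mix e p) (psubst ?\<sigma> \<phi>)" for a e
    unfolding msat_psubst meval.simps mix_econs[symmetric] using 1(3)[of "a ## e"] by simp
  then show ?thesis
    by (intro defin_I[of _ "Forall (Imp (Lt (Var 0) (lift_tm 0 u)) (psubst ?\<sigma> \<phi>))" _ _ p])
      (auto simp: 1(1) intro: sigma_Ball sigma_psubst 1(2))
qed

text \<open>Each of infinitely many terms brings its own parameters; parameter j of term i is stored
  at place \<open>prod_encode (i, j)\<close> of a single list.\<close>

lemma TD_family:
  fixes \<sigma> :: "(nat \<Rightarrow> 'a) \<Rightarrow> nat \<Rightarrow> 'a"
  assumes "\<And>i. TD M (\<lambda>e. \<sigma> e i)"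
  obtains p u where "\<And>e i. \<sigma> e i = meval M (mix e p) (u i)"
proof -
  have "\<forall>i. \<exists>p u. \<forall>e. \<sigma> e i = meval M (mix e p) u" using assms by (simp add: TD_def dtmp_def)
  then obtain p u where u: "\<And>i e. \<sigma> e i = meval M (mix e (p i)) (u i)" by metis
  let ?P = "\<lambda>k. p (fst (prod_decode k)) (snd (prod_decode k))"
  let ?v = "\<lambda>i. psubst_tm (\<lambda>k. Var (if even k then k else 2 * prod_encode (i, k div 2) + 1)) (u i)"
  have "(\<lambda>k. mix e ?P (if even k then k else 2 * prod_encode (i, k div 2) + 1)) = mix e (p i)" for e i
    by (simp add: mix_def fun_eq_iff)
  then have "\<sigma> e i = meval M (mix e ?P) (?v i)" for e i
    unfolding u by (simp only: meval_psubst meval.simps)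
  then show ?thesis by (rule that)
qed

lemma defin_subst:
  assumes "defin C M R" "psubst_closed C" "\<And>i. TD M (\<lambda>e. \<sigma> e i)"
  shows "defin C M (\<lambda>e. R (\<sigma> e))"
proof -
  obtain p \<phi> where \<phi>: "C \<phi>" "\<And>e. R e = msat M (mix e p) \<phi>"
    using assms(1) by (auto simp: defin_def dfmp_def)
  have "TD M (\<lambda>e. mix (\<sigma> e) p i)" for i
    by (cases "even i") (simp_all add: mix_def assms(3) TD_const)
  then obtain q u where u: "\<And>e i. mix (\<sigma> e) p i = meval M (mix e q) (u i)"
    using TD_family[of M "\<lambda>e. mix (\<sigma> e) p"] by blast
  have "R (\<sigma> e) = msat M (mix e q) (psubst u \<phi>)" for e
    unfolding \<phi>(2) msat_psubst u[symmetric] by simp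
  then show ?thesis using \<phi>(1) assms(2) by (auto simp: psubst_closed_def intro: defin_I)
qed

lemma SD_fm: "sigma_fm \<phi> \<Longrightarrow> (\<And>i. TD M (\<lambda>e. \<sigma> e i)) \<Longrightarrow> SD M (\<lambda>e. msat M (\<sigma> e) \<phi>)"
proof (rule defin_subst)
  assume "sigma_fm \<phi>"
  then show "SD M (\<lambda>e. msat M e \<phi>)"
    by (intro defin_I[of _ "psubst (\<lambda>i. Var (2 * i)) \<phi>" _ _ undefined])
      (auto simp: msat_psubst mix_def intro: sigma_psubst)
qed auto

lemma TD_econs: "TD M t \<Longrightarrow> (\<And>i. TD M (\<lambda>e. \<sigma> e i)) \<Longrightarrow> TD M (\<lambda>e. (t e ## \<sigma> e) i)"
  by (cases i) auto

section \<open>Models of \<open>I\<Sigma>\<^sub>1\<close>\<close>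

locale isig =
  fixes M :: "'a model"
  assumes models_ISigma1: "models M ISigma1"
begin

abbreviation zer ("\<zero>") where "\<zero> \<equiv> mZero M"
abbreviation suc ("S") where "S \<equiv> mSuc M"
abbreviation add (infixl "\<oplus>" 65) where "a \<oplus> b \<equiv> mPlus M a b"
abbreviation mul (infixl "\<odot>" 70) where "a \<odot> b \<equiv> mTimes M a b"
abbreviation les (infix "\<lhd>" 50) where "a \<lhd> b \<equiv> mLess M a b"

lemma axioms_sat: "\<phi> \<in> set Q_axioms \<or> (\<exists>\<psi>. sigma1 \<psi> \<and> \<phi> = induction_axiom \<psi>) \<Longrightarrow> msat M e \<phi>"
  using models_ISigma1 msat_univ_closure[of M \<phi>] unfolding models_def ISigma1_def by auto

lemma Q_sat: "i < 9 \<Longrightarrow> msat M e (Q_axioms ! i)"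
  by (rule axioms_sat, rule disjI1, rule nth_mem) (simp add: Q_axioms_def)

lemma Suc_not_zero [simp]: "S a \<noteq> \<zero>" "\<zero> \<noteq> S a"
  using Q_sat[of 0 "\<lambda>_. a"] by (auto simp: Q_axioms_def)

lemma Suc_inject [simp]: "S a = S b \<longleftrightarrow> a = b"
  using Q_sat[of 1 "(!) [a, b]"] by (auto simp: Q_axioms_def)

lemma not_zero_Suc: "a \<noteq> \<zero> \<Longrightarrow> \<exists>b. a = S b"
  using Q_sat[of 2 "(!) [a]"] by (auto simp: Q_axioms_def)

lemma add_zero: "a \<oplus> \<zero> = a"
  using Q_sat[of 3 "(!) [a]"] by (auto simp: Q_axioms_def)

lemma add_Suc: "a \<oplus> S b = S (a \<oplus> b)"
  using Q_sat[of 4 "(!) [a, b]"] by (auto simp: Q_axioms_def)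

lemma mul_zero: "a \<odot> \<zero> = \<zero>"
  using Q_sat[of 5 "(!) [a]"] by (auto simp: Q_axioms_def)

lemma mul_Suc: "a \<odot> S b = a \<odot> b \<oplus> a"
  using Q_sat[of 6 "(!) [a, b]"] by (auto simp: Q_axioms_def)

lemma not_less_zero [simp]: "\<not> a \<lhd> \<zero>"
  using Q_sat[of 7 "(!) [a]"] by (auto simp: Q_axioms_def)

lemma less_Suc: "a \<lhd> S b \<longleftrightarrow> a \<lhd> b \<or> a = b"
  using Q_sat[of 8 "(!) [a, b]"] by (auto simp: Q_axioms_def)

lemma sigma1_induction:
  assumes "sigma1 \<phi>" "msat M (\<zero> ## e) \<phi>" "\<And>a. msat M (a ## e) \<phi> \<Longrightarrow> msat M (S a ## e) \<phi>"
  shows "msat M (a ## e) \<phi>"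
proof -
  have "(\<lambda>i. meval M (b ## e) ((Var(0 := Succ (Var 0))) i)) = S b ## e" for b
    by (auto simp: fun_eq_iff split: nat.split)
  then have "msat M (a ## e) \<phi>"
    if "msat M e (induction_axiom \<phi>)"
    using that assms by (simp add: induction_axiom_def msat_sub0 msat_psubst)
  then show ?thesis using axioms_sat[of "induction_axiom \<phi>" e] assms(1) by blast
qed

lemma defin_induction:
  assumes "defin sigma1 M (\<lambda>e. P (e 0))" "P \<zero>" "\<And>a. P a \<Longrightarrow> P (S a)"
  shows "P a"
proof -
  obtain p \<phi> where \<phi>: "sigma1 \<phi>" "\<And>a e. P a = msat M (a ## mix e p) \<phi>"
    by (rule defin_econs_E[of sigma1 M "\<lambda>a _. P a"]) (use assms(1) in auto)
  have "msat M (a ## mix undefined p) \<phi>"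
    by (rule sigma1_induction) (use assms \<phi> in auto)
  then show ?thesis using \<phi> by blast
qed

lemma DD_induction:
  assumes "DD M (\<lambda>e. P (e 0))" "P \<zero>" "\<And>a. P a \<Longrightarrow> P (S a)"
  shows "P a"
proof (rule defin_induction[of P])
  show "defin sigma1 M (\<lambda>e. P (e 0))"
    using assms(1) unfolding defin_def dfmp_def by (meson sigma1.intros)
qed (use assms in auto)

section \<open>Ordered semiring laws\<close>

lemma zero_add: "\<zero> \<oplus> a = a"
  by (induction a rule: DD_induction) (auto intro!: DD_intros TD_intros simp: add_zero add_Suc)

lemma Suc_add: "S a \<oplus> b = S (a \<oplus> b)"
  by (induction b rule: DD_induction) (auto intro!: DD_intros TD_intros simp: add_zero add_Suc)

lemma add_comm: "a \<oplus> b = b \<oplus> a"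
  by (induction b rule: DD_induction)
    (auto intro!: DD_intros TD_intros simp: add_zero add_Suc zero_add Suc_add)

lemma add_assoc: "a \<oplus> b \<oplus> c = a \<oplus> (b \<oplus> c)"
  by (induction c rule: DD_induction) (auto intro!: DD_intros TD_intros simp: add_zero add_Suc)

lemma add_left_comm: "a \<oplus> (b \<oplus> c) = b \<oplus> (a \<oplus> c)"
  by (metis add_assoc add_comm)

lemma zero_mul: "\<zero> \<odot> a = \<zero>"
  by (induction a rule: DD_induction)
    (auto intro!: DD_intros TD_intros simp: mul_zero mul_Suc add_zero)

lemma Suc_mul: "S a \<odot> b = a \<odot> b \<oplus> b"
  by (induction b rule: DD_induction)
    (auto intro!: DD_intros TD_intros simp: mul_zero mul_Suc add_zero add_Suc add_assoc
      add_comm[of b a for b] add_left_comm)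

lemma mul_comm: "a \<odot> b = b \<odot> a"
  by (induction b rule: DD_induction)
    (auto intro!: DD_intros TD_intros simp: mul_zero mul_Suc zero_mul Suc_mul)

lemma distrib: "a \<odot> (b \<oplus> c) = a \<odot> b \<oplus> a \<odot> c"
  by (induction c rule: DD_induction)
    (auto intro!: DD_intros TD_intros simp: mul_zero mul_Suc add_zero add_Suc add_assoc)

lemma mul_assoc: "a \<odot> b \<odot> c = a \<odot> (b \<odot> c)"
  by (induction c rule: DD_induction)
    (auto intro!: DD_intros TD_intros simp: mul_zero mul_Suc distrib)

lemma zero_less_Suc: "\<zero> \<lhd> S a"
  by (induction a rule: DD_induction) (auto intro!: DD_intros TD_intros simp: less_Suc)

lemma Suc_less_Suc: "a \<lhd> b \<Longrightarrow> S a \<lhd> S b"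
proof -
  have "a \<lhd> b \<longrightarrow> S a \<lhd> S b"
    by (induction b rule: DD_induction) (auto intro!: DD_intros TD_intros simp: less_Suc)
  then show "a \<lhd> b \<Longrightarrow> S a \<lhd> S b" by blast
qed

lemma less_cases: "a \<lhd> b \<or> a = b \<or> b \<lhd> a"
proof (induction b rule: DD_induction)
  case 2
  show ?case using not_zero_Suc[of a] zero_less_Suc by auto
next
  case (3 b)
  then show ?case using less_Suc Suc_less_Suc by blast
qed (intro DD_intros TD_intros)

lemma less_trans: "a \<lhd> b \<Longrightarrow> b \<lhd> c \<Longrightarrow> a \<lhd> c"
proof -
  have "a \<lhd> b \<and> b \<lhd> c \<longrightarrow> a \<lhd> c"
    by (induction c rule: DD_induction) (auto intro!: DD_intros TD_intros simp: less_Suc)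
  then show "a \<lhd> b \<Longrightarrow> b \<lhd> c \<Longrightarrow> a \<lhd> c" by blast
qed

lemma less_irrefl: "\<not> a \<lhd> a"
proof (induction a rule: DD_induction)
  case (3 a)
  show ?case
  proof
    assume "S a \<lhd> S a"
    then have "S a \<lhd> a \<or> S a = a" by (simp add: less_Suc)
    moreover have "a \<lhd> S a" by (simp add: less_Suc)
    ultimately have "a \<lhd> a" using less_trans by metis
    then show False using 3 by blast
  qed
qed (auto intro!: DD_intros TD_intros)

lemma add_less_mono: "a \<lhd> b \<Longrightarrow> a \<oplus> c \<lhd> b \<oplus> c"
proof -
  assume "a \<lhd> b"
  then show ?thesis
    by (induction c rule: DD_induction)
      (auto intro!: DD_intros TD_intros simp: add_zero add_Suc Suc_less_Suc)
qed

text \<open>The difference is existentially quantified without a bound, hence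
  \<open>defin_induction\<close> in place of \<open>DD_induction\<close>.\<close>

lemma less_ex_add: "a \<lhd> b \<Longrightarrow> \<exists>c. b = c \<oplus> a"
proof -
  have "\<exists>c. a \<lhd> b \<longrightarrow> b = c \<oplus> a"
  proof (induction b rule: defin_induction)
    case (3 b)
    then obtain c where c: "a \<lhd> b \<longrightarrow> b = c \<oplus> a" by blast
    show ?case
    proof (cases "a \<lhd> b")
      case True
      then show ?thesis using c by (metis Suc_add)
    next
      case False
      have "S a = S \<zero> \<oplus> a" by (simp add: Suc_add zero_add)
      then show ?thesis using False by (auto simp: less_Suc)
    qed
  qed (use not_less_zero in \<open>intro sigma1D_ex DD_intros TD_intros | blast\<close>)+
  then show "a \<lhd> b \<Longrightarrow> \<exists>c. b = c \<oplus> a" by blast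
qed

lemma mul_less_mono: "a \<lhd> b \<Longrightarrow> \<zero> \<lhd> c \<Longrightarrow> c \<odot> a \<lhd> c \<odot> b"
proof -
  assume ab: "a \<lhd> b" and "\<zero> \<lhd> c"
  then obtain d where d: "c = S d" using not_zero_Suc[of c] less_irrefl by auto
  have "S d \<odot> a \<lhd> S d \<odot> b"
  proof (induction d rule: DD_induction)
    case 2
    then show ?case using ab by (simp add: Suc_mul zero_mul zero_add)
  next
    case (3 d)
    have "S d \<odot> a \<oplus> a \<lhd> S d \<odot> b \<oplus> a" using 3 by (rule add_less_mono)
    moreover have "S d \<odot> b \<oplus> a \<lhd> S d \<odot> b \<oplus> b"
      using add_less_mono[OF ab, of "S d \<odot> b"] by (simp only: add_comm)
    ultimately show ?case unfolding Suc_mul[of "S d"] by (rule less_trans)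
  qed (intro DD_intros TD_intros)
  then show ?thesis using d by simp
qed

definition leq (infix "\<unlhd>" 50) where "a \<unlhd> b \<longleftrightarrow> a \<lhd> b \<or> a = b"
text \<open>Truncated and total, as the class \<open>linordered_semidom\<close> demands; through
  that class the arithmetic of the library applies to \<open>M\<close>.\<close>

definition minus (infixl "\<ominus>" 65) where "a \<ominus> b = (if b \<unlhd> a then THE c. a = c \<oplus> b else \<zero>)"

lemma add_cancel: "a \<oplus> c = b \<oplus> c \<longleftrightarrow> a = b"
  using less_cases add_less_mono less_irrefl by metis

lemma minus_add: "a \<oplus> b \<ominus> b = a"
proof -
  have "\<zero> \<lhd> a \<or> a = \<zero>" using not_zero_Suc zero_less_Suc by metis
  then have "b \<unlhd> a \<oplus> b" unfolding leq_def using add_less_mono[of \<zero> a b] by (metis zero_add)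
  then show ?thesis by (simp add: minus_def add_cancel)
qed

lemma leq_ex_add: "a \<unlhd> b \<Longrightarrow> \<exists>c. b = c \<oplus> a"
  using less_ex_add zero_add by (metis leq_def)

lemma leq_add: "a \<unlhd> c \<oplus> a"
proof -
  have "\<zero> \<lhd> c \<or> c = \<zero>" using not_zero_Suc zero_less_Suc by metis
  then show "a \<unlhd> c \<oplus> a" unfolding leq_def using add_less_mono[of \<zero> c a] by (metis zero_add)
qed

lemma leq_trans: "a \<unlhd> b \<Longrightarrow> b \<unlhd> c \<Longrightarrow> a \<unlhd> c"
  unfolding leq_def using less_trans by blast

lemma not_leq: "\<not> a \<unlhd> b \<longleftrightarrow> b \<lhd> a"
  unfolding leq_def using less_trans less_irrefl less_cases by metis

lemma minus_eq_zero: "\<not> b \<lhd> a \<Longrightarrow> a \<ominus> b = \<zero>"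
  using minus_add[of \<zero> b] by (metis minus_def zero_add leq_def)

lemma mul_left_comm: "a \<odot> (b \<odot> c) = b \<odot> (a \<odot> c)"
  by (metis mul_assoc mul_comm)

sublocale arith: linordered_semidom "(\<oplus>)" "(\<ominus>)" "(\<unlhd>)" "(\<lhd>)" \<zero> "(\<odot>)" "S \<zero>"
proof
  fix a b c
  show "a \<oplus> b \<oplus> c = a \<oplus> (b \<oplus> c)" "a \<odot> b \<odot> c = a \<odot> (b \<odot> c)" by (rule add_assoc mul_assoc)+
  show "a \<oplus> b = b \<oplus> a" "a \<odot> b = b \<odot> a" by (rule add_comm mul_comm)+
  show "(a \<lhd> b) = (a \<unlhd> b \<and> \<not> b \<unlhd> a)" using not_leq leq_def by blast
  show "a \<unlhd> a" by (simp add: leq_def)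
  show "a \<unlhd> b \<Longrightarrow> b \<unlhd> c \<Longrightarrow> a \<unlhd> c" by (rule leq_trans)
  show "a \<unlhd> b \<Longrightarrow> b \<unlhd> a \<Longrightarrow> a = b" using not_leq leq_def by blast
  show "a \<unlhd> b \<or> b \<unlhd> a" using not_leq leq_def by blast
  show "a \<unlhd> b \<Longrightarrow> c \<oplus> a \<unlhd> c \<oplus> b" unfolding leq_def using add_less_mono add_comm by metis
  show "a \<oplus> b \<ominus> a = b" using minus_add add_comm by metis
  show "a \<ominus> b \<ominus> c = a \<ominus> (b \<oplus> c)"
  proof (cases "b \<oplus> c \<unlhd> a")
    case True
    then obtain d where "a = d \<oplus> c \<oplus> b" using leq_ex_add add_assoc add_comm by metis
    then show ?thesis using minus_add add_assoc add_comm by metis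
  next
    case False
    then have "a \<lhd> b \<oplus> c" by (simp add: not_leq)
    then have 1: "a \<ominus> (b \<oplus> c) = \<zero>" using minus_eq_zero less_trans less_irrefl by blast
    have "\<not> c \<lhd> a \<ominus> b"
    proof
      assume c: "c \<lhd> a \<ominus> b"
      then have "b \<unlhd> a" using minus_eq_zero not_leq less_trans less_irrefl not_less_zero by metis
      then obtain d where "a = d \<oplus> b" using leq_ex_add by blast
      then have "c \<oplus> b \<lhd> a" using c minus_add add_less_mono by metis
      then show False using \<open>a \<lhd> b \<oplus> c\<close> less_trans less_irrefl add_comm by metis
    qed
    then show ?thesis using 1 minus_eq_zero by simp
  qed
  show "a \<odot> (b \<oplus> c) = a \<odot> b \<oplus> a \<odot> c" by (rule distrib)
  show "(a \<oplus> b) \<odot> c = a \<odot> c \<oplus> b \<odot> c" by (metis distrib mul_comm)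
  show "a \<odot> (b \<ominus> c) = a \<odot> b \<ominus> a \<odot> c"
  proof (cases "c \<unlhd> b")
    case True
    then obtain d where "b = d \<oplus> c" using leq_ex_add by blast
    then show ?thesis by (simp add: minus_add distrib)
  next
    case False
    then have bc: "b \<lhd> c" by (simp add: not_leq)
    then have "b \<ominus> c = \<zero>" using minus_eq_zero less_trans less_irrefl by blast
    moreover have "\<not> a \<odot> c \<lhd> a \<odot> b"
      using mul_less_mono[OF bc] less_trans less_irrefl not_zero_Suc zero_less_Suc zero_mul by metis
    ultimately show ?thesis using minus_eq_zero mul_zero by simp
  qed
  show "a \<noteq> \<zero> \<Longrightarrow> b \<noteq> \<zero> \<Longrightarrow> a \<odot> b \<noteq> \<zero>"
    using not_zero_Suc mul_Suc add_Suc Suc_not_zero by metis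
  show "a \<lhd> b \<Longrightarrow> \<zero> \<lhd> c \<Longrightarrow> c \<odot> a \<lhd> c \<odot> b" by (rule mul_less_mono)
  show "b \<unlhd> a \<Longrightarrow> a \<ominus> b \<oplus> b = a" using leq_ex_add minus_add by metis
qed (simp_all add: zero_add zero_mul mul_zero mul_Suc zero_less_Suc Suc_mul)

end

section \<open>Normal form\<close>

lemma (in isig) less_Suc_iff: "a \<lhd> S b \<longleftrightarrow> a \<unlhd> b"
  by (simp add: less_Suc leq_def)

text \<open>The witness s is a common bound for everything asserted to exist, and the matrix is
  upward closed in it. Hence two witnesses are merged by taking the larger one, and a bounded
  quantifier asks for a single bound that serves all its instances. The matrix is the same for all
  models.\<close>

lemma sigma_normal_form:
  assumes "sigma_fm \<phi>"
  shows "\<exists>\<delta>. delta0 \<delta> \<and> (\<forall>(M :: 'a model) e. models M ISigma1 \<longrightarrow>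
    (msat M e \<phi> \<longleftrightarrow> (\<exists>s. msat M (s ## e) \<delta>)) \<and>
    (\<forall>s s'. mLess M s s' \<longrightarrow> msat M (s ## e) \<delta> \<longrightarrow> msat M (s' ## e) \<delta>))"
    (is "\<exists>\<delta>. delta0 \<delta> \<and> (\<forall>M e. _ \<longrightarrow> ?P \<phi> \<delta> M e)")
  using assms
proof (induction rule: sigma_fm.induct)
  case (sigma_delta0 \<phi>)
  then have "delta0 (lift 0 \<phi>)" unfolding lift_psubst by (rule delta0_psubst)
  then show ?case by (intro exI[of _ "lift 0 \<phi>"]) simp
next
  case (sigma_Conj \<phi> \<psi>)
  obtain \<delta> \<delta>' where \<delta>: "delta0 \<delta>" "\<And>M e. models M ISigma1 \<Longrightarrow> ?P \<phi> \<delta> M e"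
    "delta0 \<delta>'" "\<And>M e. models M ISigma1 \<Longrightarrow> ?P \<psi> \<delta>' M e"
    using sigma_Conj.IH by blast
  have "?P (Conj \<phi> \<psi>) (Conj \<delta> \<delta>') M e" if "models M ISigma1" for M e
  proof -
    interpret isig M by unfold_locales fact
    have "\<exists>s. msat M (s ## e) \<delta> \<and> msat M (s ## e) \<delta>'"
      if "msat M (s ## e) \<delta>" "msat M (s' ## e) \<delta>'" for s s'
      using less_cases[of s s'] that \<delta>(2)[OF models_ISigma1, of e] \<delta>(4)[OF models_ISigma1, of e] by blast
    then show ?thesis
      using \<delta>(2)[OF that, of e] \<delta>(4)[OF that, of e] unfolding msat.simps by blast
  qed
  then show ?case using \<delta> by (intro exI[of _ "Conj \<delta> \<delta>'"]) (auto intro: delta0.intros)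
next
  case (sigma_Disj \<phi> \<psi>)
  obtain \<delta> \<delta>' where \<delta>: "delta0 \<delta>" "\<And>M e. models M ISigma1 \<Longrightarrow> ?P \<phi> \<delta> M e"
    "delta0 \<delta>'" "\<And>M e. models M ISigma1 \<Longrightarrow> ?P \<psi> \<delta>' M e"
    using sigma_Disj.IH by blast
  have "?P (Disj \<phi> \<psi>) (Disj \<delta> \<delta>') M e" if "models M ISigma1" for M e
    using \<delta>(2)[OF that, of e] \<delta>(4)[OF that, of e] unfolding msat.simps by blast
  then show ?case using \<delta> by (intro exI[of _ "Disj \<delta> \<delta>'"]) (auto intro: delta0.intros)
next
  case (sigma_Exists \<phi>)
  obtain \<delta> where \<delta>: "delta0 \<delta>" "\<And>M e. models M ISigma1 \<Longrightarrow> ?P \<phi> \<delta> M e"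
    using sigma_Exists.IH by blast
  \<comment> \<open>The new quantifier on x stands inside that on s, opposite to the order in the
    matrix, so the two variables are exchanged. The bound for x is s itself.\<close>
  define sw :: "nat \<Rightarrow> tm" where "sw = (Var 1 ## Var 0 ## (\<lambda>i. Var (Suc (Suc i))))"
  let ?\<chi> = "Exists (Conj (Lt (Var 0) (lift_tm 0 (Var 0))) (psubst sw \<delta>))"
  have "?P (Exists \<phi>) ?\<chi> M e" if "models M ISigma1" for M e
  proof -
    interpret isig M by unfold_locales fact
    have [simp]: "(\<lambda>i. meval M (x ## s ## e) (sw i)) = s ## x ## e" for s x
      by (auto simp: sw_def fun_eq_iff split: nat.split)
    have sem: "msat M (s ## e) ?\<chi> \<longleftrightarrow> (\<exists>x. mLess M x (s) \<and> msat M (s ## x ## e) \<delta>)" for s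
      by (simp add: msat_psubst)
    have 1: "msat M e (Exists \<phi>) \<longleftrightarrow> (\<exists>x s. msat M (s ## x ## e) \<delta>)"
      using \<delta>(2)[OF that] by auto
    have 2: "\<exists>s'. mLess M x (s') \<and> msat M (s' ## x ## e) \<delta>" if "msat M (s ## x ## e) \<delta>" for x s
    proof -
      have "mLess M s (mSuc M (mPlus M x s))" "mLess M x (mSuc M (mPlus M x s))"
        using leq_add[of s x] leq_add[of x s] by (simp_all add: less_Suc_iff add_comm)
      then show ?thesis using that \<delta>(2)[OF models_ISigma1, of "x ## e"] by blast
    qed
    show ?thesis
      unfolding sem 1 using 2 less_trans \<delta>(2)[OF that] by blast
  qed
  moreover have "delta0 ?\<chi>" using \<delta>(1) by (intro delta0.intros(6) delta0_psubst)
  ultimately show ?case by blast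
next
  case (sigma_Ball \<phi> t)
  obtain \<delta> where \<delta>: "delta0 \<delta>" "\<And>M e. models M ISigma1 \<Longrightarrow> ?P \<phi> \<delta> M e"
    using sigma_Ball.IH by blast
  define sw :: "nat \<Rightarrow> tm" where "sw = (Var 1 ## Var 0 ## (\<lambda>i. Var (Suc (Suc i))))"
  define sw2 :: "nat \<Rightarrow> tm" where "sw2 = (Var 1 ## Var 0 ## (\<lambda>i. Var (Suc (Suc (Suc i)))))"
  let ?\<chi> = "Forall (Imp (Lt (Var 0) (lift_tm 0 (lift_tm 0 t))) (psubst sw \<delta>))"
  \<comment> \<open>\<Sigma>1 collection: by induction on k there is one witness for all x below k.
    The first disjunct makes the claim trivial once k exceeds the value of t, where nothing is known
    about \<phi>.\<close>
  let ?c = "Exists (Disj (Lt (lift_tm 0 (lift_tm 0 t)) (Var 1))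
    (Forall (Imp (Lt (Var 0) (lift_tm 0 (Var 1))) (psubst sw2 \<delta>))))"
  have "?P (Forall (Imp (Lt (Var 0) (lift_tm 0 t)) \<phi>)) ?\<chi> M e" if "models M ISigma1" for M e
  proof -
    interpret isig M by unfold_locales fact
    have [simp]: "(\<lambda>i. meval M (x ## s ## e) (sw i)) = s ## x ## e" for s x
      by (auto simp: sw_def fun_eq_iff split: nat.split)
    have [simp]: "(\<lambda>i. meval M (x ## s ## k ## e) (sw2 i)) = s ## x ## e" for s x k
      by (auto simp: sw2_def fun_eq_iff split: nat.split)
    let ?t = "meval M e t"
    have mono: "msat M (s' ## x ## e) \<delta>" if "isig.leq M s s'" "msat M (s ## x ## e) \<delta>" for s s' x
      using \<delta>(2)[OF models_ISigma1, of "x ## e"] that unfolding leq_def by blast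
    have sem: "msat M (s ## e) ?\<chi> \<longleftrightarrow> (\<forall>x. mLess M x (?t) \<longrightarrow> msat M (s ## x ## e) \<delta>)" for s
      by (simp add: msat_psubst)
    have semc: "msat M (k ## e) ?c \<longleftrightarrow> (\<exists>s. mLess M ?t (k) \<or> (\<forall>x. mLess M x (k) \<longrightarrow> msat M (s ## x ## e) \<delta>))" for k
      by (auto simp: msat_psubst)
    have 1: "msat M e (Forall (Imp (Lt (Var 0) (lift_tm 0 t)) \<phi>)) \<longleftrightarrow>
        (\<forall>x. mLess M x (?t) \<longrightarrow> (\<exists>s. msat M (s ## x ## e) \<delta>))"
      using \<delta>(2)[OF that] by auto
    have 2: "\<exists>s. \<forall>x. mLess M x (?t) \<longrightarrow> msat M (s ## x ## e) \<delta>"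
      if h: "\<forall>x. mLess M x (?t) \<longrightarrow> (\<exists>s. msat M (s ## x ## e) \<delta>)"
    proof -
      have "msat M (k ## e) ?c" for k
      proof (rule sigma1_induction)
        show "sigma1 ?c"
          using \<delta>(1) by (intro sigma1.intros delta0.intros delta0_psubst)
        show "msat M (mZero M ## e) ?c" unfolding semc by simp
        fix k assume "msat M (k ## e) ?c"
        then obtain s where s: "mLess M ?t (k) \<or> (\<forall>x. mLess M x (k) \<longrightarrow> msat M (s ## x ## e) \<delta>)" unfolding semc by blast
        show "msat M (mSuc M k ## e) ?c"
        proof (cases "isig.leq M ?t k")
          case True
          then show ?thesis unfolding semc less_Suc_iff by blast
        next
          case False
          then have "mLess M k (?t)" by (simp add: not_leq)
          then obtain s' where s': "msat M (s' ## k ## e) \<delta>" using h by blast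
          have "msat M (mPlus M s s' ## x ## e) \<delta>" if "mLess M x (mSuc M k)" for x
            using s s' mono leq_add[of s s'] leq_add[of s' s] that False
            by (metis add_comm leq_def less_Suc)
          then show ?thesis unfolding semc by blast
        qed
      qed
      then show ?thesis using semc[of ?t] less_irrefl by blast
    qed
    show ?thesis
      unfolding sem 1 using 2 \<delta>(2)[OF that] by blast
  qed
  moreover have "delta0 ?\<chi>" using \<delta>(1) by (intro delta0.intros(5) delta0_psubst)
  ultimately show ?case by blast
qed

context isig
begin

lemma SD_sigma1: "SD M R \<Longrightarrow> defin sigma1 M R"
proof -
  assume "SD M R"
  then obtain p \<phi> where \<phi>: "sigma_fm \<phi>" "\<And>e. R e = msat M (mix e p) \<phi>"
    by (auto simp: defin_def dfmp_def)
  obtain \<delta> where "delta0 \<delta>" "\<forall>e. msat M e \<phi> \<longleftrightarrow> (\<exists>s. msat M (s ## e) \<delta>)"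
    using sigma_normal_form[OF \<phi>(1)] models_ISigma1 by blast
  then show ?thesis using \<phi>(2)
    by (intro defin_I[of _ "Exists \<delta>" _ _ p]) (auto intro: sigma1.intros)
qed

lemma SD_induction:
  assumes "SD M (\<lambda>e. P (e 0))" "P \<zero>" "\<And>a. P a \<Longrightarrow> P (S a)"
  shows "P a"
  using defin_induction[OF SD_sigma1] assms by blast

text \<open>A failure is moved down: if P fails at a, then \<Sigma>1 induction on b finds a failure
  b steps below a, and b = a puts it at zero.\<close>

lemma PD_induction:
  assumes "SD M (\<lambda>e. \<not> P (e 0))" "P \<zero>" "\<And>a. P a \<Longrightarrow> P (S a)"
  shows "P a"
proof (rule ccontr)
  assume "\<not> P a"
  have "\<exists>z. z \<oplus> b \<unlhd> a \<and> a \<unlhd> z \<oplus> b \<and> \<not> P z \<or> a \<lhd> b" for b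
  proof (induction b rule: SD_induction)
    case 1
    have "SD M (\<lambda>e. \<not> P (e i))" for i
      using defin_subst[OF assms(1), of "\<lambda>e. e i ## e"] by (simp add: TD_econs TD_intros)
    then show ?case unfolding leq_def
      by (intro SD_ex SD_disj SD_conj SD_delta[OF DD_disj] SD_delta[OF DD_less] DD_intros TD_intros)
  next
    case 2
    then show ?case using \<open>\<not> P a\<close> by (auto simp: add_zero intro: exI[of _ a])
  next
    case (3 b)
    then consider z where "z \<oplus> b = a" "\<not> P z" | "a \<lhd> b" by (metis arith.order_antisym)
    then show ?case
    proof cases
      case (1 z)
      then obtain w where "z = S w \<or> z = \<zero>" using not_zero_Suc by blast
      then have "z = S w" using 1 assms(2) by auto
      then show ?thesis using 1 assms(3) by (metis add_Suc Suc_add arith.order_refl)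
    next
      case 2
      then show ?thesis by (metis less_Suc)
    qed
  qed
  from this[of a] obtain z where "z \<oplus> a = a" "\<not> P z"
    using less_irrefl by (metis arith.order_antisym)
  then show False using assms(2) by (metis add_cancel zero_add)
qed

text \<open>Course-of-values induction stays \<Sigma>1, since bounded universal quantification
  preserves \<open>sigma_fm\<close>.\<close>

lemma SD_less_induction:
  assumes "SD M (\<lambda>e. P (e 0))" "\<And>a. (\<And>b. b \<lhd> a \<Longrightarrow> P b) \<Longrightarrow> P a"
  shows "P a"
proof -
  have P: "SD M (\<lambda>e. P (e i))" for i
    using defin_subst[OF assms(1), of "\<lambda>e. e i ## e"] by (simp add: TD_econs TD_intros)
  have "\<forall>b. b \<lhd> a \<longrightarrow> P b"
  proof (induction a rule: SD_induction)
    case 1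
    then show ?case by (intro SD_ball TD_intros P)
  qed (use assms(2) less_Suc in auto)
  then show ?thesis using assms(2) by blast
qed

lemma less_SucI: "a \<unlhd> b \<Longrightarrow> a \<lhd> S b"
  by (simp add: less_Suc_iff)

lemma less_ex_Suc_add: "a \<lhd> b \<Longrightarrow> \<exists>d. b = a \<oplus> S d"
proof -
  assume ab: "a \<lhd> b"
  then obtain c where c: "b = c \<oplus> a" using less_ex_add by blast
  then have "c \<noteq> \<zero>" using ab by (auto simp: zero_add)
  then show ?thesis using c not_zero_Suc add_comm by metis
qed

lemma zero_leq: "\<zero> \<unlhd> a"
  using leq_add[of \<zero> a] by (simp add: add_zero)

lemma leq_add1: "a \<unlhd> a \<oplus> b" and leq_add2: "b \<unlhd> a \<oplus> b"
  using leq_add[of a b] leq_add[of b a] by (simp_all add: add_comm)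

lemma leq_mul1: "b \<noteq> \<zero> \<Longrightarrow> a \<unlhd> a \<odot> b"
  using not_zero_Suc[of b] leq_add2 mul_Suc by metis

lemma DD_leq: "TD M s \<Longrightarrow> TD M t \<Longrightarrow> DD M (\<lambda>e. s e \<unlhd> t e)"
  unfolding leq_def by (intro DD_intros)

lemmas DDs = DD_intros DD_leq
lemmas SDs = SD_ex SD_conj SD_disj SD_imp SD_ball

section \<open>Standard elements\<close>

primrec cd :: "nat \<Rightarrow> 'a" where
  "cd 0 = \<zero>"
| "cd (Suc n) = S (cd n)"

lemma cd_add: "cd (m + n) = cd m \<oplus> cd n"
  by (induction n) (simp_all add: add_zero add_Suc)

lemma cd_mult: "cd (m * n) = cd m \<odot> cd n"
  by (induction n) (simp_all add: mul_zero mul_Suc cd_add add_comm)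

text \<open>The standard elements form an initial segment, so a bounded quantifier with a standard
  bound ranges over standard elements only; this gives absoluteness of \<Delta>0 formulas.\<close>

lemma less_cd: "a \<lhd> cd n \<longleftrightarrow> (\<exists>m<n. a = cd m)"
  by (induction n) (auto simp: less_Suc less_Suc_eq)

lemma cd_inj [simp]: "cd m = cd n \<longleftrightarrow> m = n"
proof
  assume "cd m = cd n"
  then show "m = n"
  proof (induction m arbitrary: n)
    case 0
    then show ?case by (cases n) auto
  next
    case (Suc m)
    then show ?case by (cases n) auto
  qed
qed simp

lemma cd_less: "cd m \<lhd> cd n \<longleftrightarrow> m < n"
  by (auto simp: less_cd)

lemma meval_num: "meval M e (num n) = cd n"
  by (induction n) (simp_all add: num_def)

section \<open>Pairing\<close>

lemma double_inj: "a \<oplus> a = b \<oplus> b \<Longrightarrow> a = b"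
  using arith.add_strict_mono[of a b a b] arith.add_strict_mono[of b a b a] less_cases[of a b] less_irrefl
  by metis

text \<open>Consecutive numbers have an even product, so the doubled equation behind
  \<open>dPair\<close> always has a solution.\<close>

lemma ex_half: "\<exists>w. w \<oplus> w = s \<odot> S s"
proof (induction s rule: SD_induction)
  case 1
  then show ?case by (intro SDs SD_delta DDs TD_intros)
next
  case 2
  then show ?case by (auto simp: zero_mul intro: exI[of _ \<zero>] add_zero)
next
  case (3 s)
  then obtain w where "w \<oplus> w = s \<odot> S s" by blast
  then have "S s \<odot> S (S s) = (w \<oplus> S s) \<oplus> (w \<oplus> S s)"
    by (metis Suc_mul add_assoc add_comm mul_Suc)
  then show ?case by metis
qed

definition ispr :: "'a \<Rightarrow> 'a \<Rightarrow> 'a \<Rightarrow> bool" where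
  "ispr x y z \<longleftrightarrow> z \<oplus> z = (x \<oplus> y) \<odot> S (x \<oplus> y) \<oplus> (x \<oplus> x)"

definition pr :: "'a \<Rightarrow> 'a \<Rightarrow> 'a" where
  "pr x y = (THE z. ispr x y z)"

lemma ispr_iff: "ispr x y z \<longleftrightarrow> z = pr x y"
proof -
  obtain w where w: "w \<oplus> w = (x \<oplus> y) \<odot> S (x \<oplus> y)" using ex_half by blast
  have ex: "ispr x y (w \<oplus> x)"
    unfolding ispr_def w[symmetric] by (simp add: add_assoc add_left_comm)
  have un: "ispr x y z \<Longrightarrow> ispr x y z' \<Longrightarrow> z = z'" for z z'
    unfolding ispr_def using double_inj by metis
  then have "ispr x y (pr x y)" unfolding pr_def using ex by (metis theI)
  then show ?thesis using un by blast
qed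

text \<open>With s = x \<oplus> y, twice the code is at least s(s + 1) and less than (s + 1)(s + 2),
  so codes on different diagonals differ. On one diagonal the code determines x.\<close>

lemma pr_inj [simp]: "pr x y = pr x' y' \<longleftrightarrow> x = x' \<and> y = y'"
proof
  have le: False if "pr x y = pr x' y'" "x \<oplus> y \<lhd> x' \<oplus> y'" for x y x' y'
  proof -
    let ?s = "x \<oplus> y" and ?t = "x' \<oplus> y'"
    have "ispr x y (pr x y)" "ispr x' y' (pr x y)" using that ispr_iff by auto
    then have eq: "?s \<odot> S ?s \<oplus> (x \<oplus> x) = ?t \<odot> S ?t \<oplus> (x' \<oplus> x')" unfolding ispr_def by simp
    have "x \<oplus> x \<lhd> S ?s \<oplus> S ?s"
      by (intro arith.add_strict_mono less_SucI leq_add1)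
    then have "?s \<odot> S ?s \<oplus> (x \<oplus> x) \<lhd> ?s \<odot> S ?s \<oplus> (S ?s \<oplus> S ?s)"
      by (rule arith.add_strict_left_mono)
    also have "?s \<odot> S ?s \<oplus> (S ?s \<oplus> S ?s) = S ?s \<odot> S (S ?s)"
      by (metis Suc_mul add_assoc mul_Suc)
    also have "S ?s \<odot> S (S ?s) \<unlhd> ?t \<odot> S ?t"
    proof -
      have "S ?s \<unlhd> ?t" using that(2) Suc_less_Suc[OF that(2)] by (simp add: less_Suc_iff)
      moreover from this have "S (S ?s) \<unlhd> S ?t" unfolding leq_def using Suc_less_Suc by auto
      ultimately show ?thesis by (rule arith.mult_mono) (rule zero_leq)+
    qed
    also have "?t \<odot> S ?t \<unlhd> ?t \<odot> S ?t \<oplus> (x' \<oplus> x')" by (rule leq_add1)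
    finally show False unfolding eq using less_irrefl by blast
  qed
  assume h: "pr x y = pr x' y'"
  then have s: "x \<oplus> y = x' \<oplus> y'" using le[of x y x' y'] le[of x' y' x y] less_cases by metis
  have "ispr x y (pr x y)" "ispr x' y' (pr x y)" using h ispr_iff by auto
  then have "(x' \<oplus> y') \<odot> S (x' \<oplus> y') \<oplus> (x \<oplus> x) = (x' \<oplus> y') \<odot> S (x' \<oplus> y') \<oplus> (x' \<oplus> x')"
    unfolding ispr_def s by simp
  then have "x \<oplus> x = x' \<oplus> x'" using add_cancel add_comm by metis
  then have "x = x'" by (rule double_inj)
  then show "x = x' \<and> y = y'" using s add_cancel add_comm by metis
qed auto

lemma cd_pr: "cd (prod_encode (m, n)) = pr (cd m) (cd n)"
proof -
  have "2 * triangle k = k * Suc k" for k by (induction k) auto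
  from this[of "m + n"]
  have "prod_encode (m, n) + prod_encode (m, n) = (m + n) * Suc (m + n) + (m + m)"
    by (simp add: prod_encode_def)
  then have "cd (prod_encode (m, n) + prod_encode (m, n)) = cd ((m + n) * Suc (m + n) + (m + m))"
    by simp
  then show ?thesis
    by (simp add: cd_add cd_mult flip: ispr_iff) (simp add: ispr_def mul_Suc add_comm)
qed

text \<open>\<open>pr\<close> is not the value of a term, only its graph is \<Sigma>1;
  \<open>SD_SF\<close> admits such functions inside \<Sigma>1 predicates.\<close>

definition SF :: "((nat \<Rightarrow> 'a) \<Rightarrow> 'a) \<Rightarrow> bool" where
  "SF t \<longleftrightarrow> SD M (\<lambda>e. e 0 = t (\<lambda>i. e (Suc i)))"

lemma SD_shift: "SD M R \<Longrightarrow> SD M (\<lambda>e. R (\<lambda>i. e (f i)))"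
  by (rule defin_subst) (auto intro: TD_intros)

lemma TD_shift: "TD M t \<Longrightarrow> TD M (\<lambda>e. t (\<lambda>i. e (f i)))"
proof -
  assume "TD M t"
  then obtain p u where u: "\<And>e. t e = meval M (mix e p) u" by (auto simp: TD_def dtmp_def)
  show ?thesis
    by (rule TD_I[of _ _ p "psubst_tm (\<lambda>i. Var (if even i then 2 * f (i div 2) else i)) u"])
      (auto simp: u meval_psubst mix_def intro!: meval_cong)
qed

lemma SD_SF:
  assumes "SF t" "SD M (\<lambda>e. R (e 0) (\<lambda>i. e (Suc i)))"
  shows "SD M (\<lambda>e. R (t e) e)"
proof -
  have "SD M (\<lambda>e. \<exists>a. a = t e \<and> R a e)"
    using assms unfolding SF_def by (intro SD_ex SD_conj)
  then show ?thesis by simp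
qed

lemma SF_TD: assumes "TD M t" shows "SF t"
  unfolding SF_def by (intro SD_delta DD_eq TD_intros TD_shift[OF assms])

lemma SF_pr: "SF s \<Longrightarrow> SF t \<Longrightarrow> SF (\<lambda>e. pr (s e) (t e))"
proof -
  assume "SF s" "SF t"
  then have st: "SD M (\<lambda>e. e 0 = s (\<lambda>i. e (Suc (Suc (Suc i)))))" "SD M (\<lambda>e. e 1 = t (\<lambda>i. e (Suc (Suc (Suc i)))))"
    unfolding SF_def
    using SD_shift[of "\<lambda>e. e 0 = s (\<lambda>i. e (Suc i))" "case_nat 0 (\<lambda>i. Suc (Suc (Suc i)))"]
      SD_shift[of "\<lambda>e. e 0 = t (\<lambda>i. e (Suc i))" "case_nat 1 (\<lambda>i. Suc (Suc (Suc i)))"] by simp_all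
  have "SD M (\<lambda>e. \<exists>b. \<exists>a. a = s (\<lambda>i. e (Suc i)) \<and> b = t (\<lambda>i. e (Suc i)) \<and> ispr a b (e 0))"
    unfolding ispr_def
    by (intro SD_ex SD_conj) (use st in \<open>auto intro!: SD_delta DD_eq TD_intros\<close>)
  then show ?thesis by (simp add: SF_def ispr_iff)
qed

section \<open>Sequences\<close>

definition beta :: "'a \<Rightarrow> 'a \<Rightarrow> 'a \<Rightarrow> 'a \<Rightarrow> bool" where
  "beta a b i x \<longleftrightarrow> x \<lhd> S (S i \<odot> b) \<and> (\<exists>q. a = q \<odot> S (S i \<odot> b) \<oplus> x)"

lemma SD_beta:
  assumes "TD M a" "TD M b" "TD M i" "TD M x"
  shows "SD M (\<lambda>e. beta (a e) (b e) (i e) (x e))"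
  unfolding beta_def
  by (intro SDs SD_delta DDs TD_Suc TD_Plus TD_Times assms TD_shift[OF assms(1)] TD_shift[OF assms(2)]
      TD_shift[OF assms(3)] TD_shift[OF assms(4)] TD_var)

lemma remainder_unique_aux:
  assumes "q \<odot> m \<oplus> x = r \<odot> m \<oplus> y" "x \<lhd> m"
  shows "\<not> q \<lhd> r"
proof
  assume "q \<lhd> r"
  then obtain d where d: "r = q \<oplus> S d" using less_ex_Suc_add by blast
  have "q \<odot> m \<oplus> x = q \<odot> m \<oplus> (m \<oplus> (d \<odot> m \<oplus> y))"
    using assms(1) unfolding d by (simp add: arith.distrib_right Suc_mul add_assoc add_left_comm)
  then have "x = m \<oplus> (d \<odot> m \<oplus> y)" using add_cancel add_comm by metis
  then have "m \<unlhd> x" using leq_add1 by metis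
  then show False using assms(2) not_leq by blast
qed

lemma remainder_unique:
  assumes "q \<odot> m \<oplus> x = r \<odot> m \<oplus> y" "x \<lhd> m" "y \<lhd> m"
  shows "q = r" "x = y"
proof -
  show "q = r"
    using remainder_unique_aux[OF assms(1,2)] remainder_unique_aux[OF assms(1)[symmetric] assms(3)] less_cases by blast
  then show "x = y" using assms(1) add_cancel add_comm by metis
qed

lemma beta_fun: "beta a b i x \<Longrightarrow> beta a b i y \<Longrightarrow> x = y"
  unfolding beta_def using remainder_unique(2) by metis

lemma division: "\<zero> \<lhd> m \<Longrightarrow> \<exists>q r. a = q \<odot> m \<oplus> r \<and> r \<lhd> m"
proof (induction a rule: SD_induction)
  case 1
  then show ?case by (intro SDs SD_delta DDs TD_intros)
next
  case 2
  then show ?case using zero_mul add_zero by metis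
next
  case (3 a)
  then obtain q r where "a = q \<odot> m \<oplus> r" "r \<lhd> m" by blast
  then have "S a = q \<odot> m \<oplus> S r" "S r \<lhd> m \<or> S r = m"
    using Suc_less_Suc[of r m] by (auto simp: add_Suc less_Suc)
  then show ?case using 3(2) by (metis Suc_mul add_zero)
qed

lemma beta_total: "\<exists>x. beta a b i x"
  unfolding beta_def using division[OF zero_less_Suc] by blast

text \<open>Multiples of m on both sides stand in for subtraction, which a semiring does not
  have.\<close>

definition cong :: "'a \<Rightarrow> 'a \<Rightarrow> 'a \<Rightarrow> bool" where
  "cong m a b \<longleftrightarrow> (\<exists>x y. a \<oplus> x \<odot> m = b \<oplus> y \<odot> m)"

lemma cong_refl: "cong m a a"
  unfolding cong_def by blast

lemma cong_sym: "cong m a b \<Longrightarrow> cong m b a"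
  unfolding cong_def by metis

lemma cong_trans: "cong m a b \<Longrightarrow> cong m b c \<Longrightarrow> cong m a c"
proof -
  assume "cong m a b" "cong m b c"
  then obtain x y x' y' where 1: "a \<oplus> x \<odot> m = b \<oplus> y \<odot> m" "b \<oplus> x' \<odot> m = c \<oplus> y' \<odot> m"
    unfolding cong_def by blast
  have "a \<oplus> (x \<oplus> x') \<odot> m = a \<oplus> x \<odot> m \<oplus> x' \<odot> m" by (simp add: arith.distrib_right add_assoc)
  also have "\<dots> = b \<oplus> x' \<odot> m \<oplus> y \<odot> m" unfolding 1(1) by (simp add: add_assoc add_left_comm add_comm)
  also have "\<dots> = c \<oplus> (y' \<oplus> y) \<odot> m" unfolding 1(2) by (simp add: arith.distrib_right add_assoc)
  finally show ?thesis unfolding cong_def by blast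
qed

lemma cong_add: "cong m a b \<Longrightarrow> cong m (a \<oplus> c) (b \<oplus> c)"
  unfolding cong_def by (metis add_assoc add_comm)

lemma cong_add_left: "cong m a b \<Longrightarrow> cong m (c \<oplus> a) (c \<oplus> b)"
  using cong_add add_comm by metis

lemma cong_add_cancel: "cong m (a \<oplus> c) (b \<oplus> c) \<Longrightarrow> cong m a b"
proof -
  assume "cong m (a \<oplus> c) (b \<oplus> c)"
  then obtain x y where "a \<oplus> c \<oplus> x \<odot> m = b \<oplus> c \<oplus> y \<odot> m" unfolding cong_def by blast
  then have "a \<oplus> x \<odot> m \<oplus> c = b \<oplus> y \<odot> m \<oplus> c" by (simp add: add_assoc add_comm[of c])
  then show ?thesis unfolding cong_def add_cancel by blast
qed

lemma cong_mult: "cong m a b \<Longrightarrow> cong m (c \<odot> a) (c \<odot> b)"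
proof -
  assume "cong m a b"
  then obtain x y where "a \<oplus> x \<odot> m = b \<oplus> y \<odot> m" unfolding cong_def by blast
  then have "c \<odot> (a \<oplus> x \<odot> m) = c \<odot> (b \<oplus> y \<odot> m)" by simp
  then show ?thesis unfolding cong_def distrib mul_assoc[symmetric] by blast
qed

lemma cong_multiple: "cong m (a \<oplus> c \<odot> m) a"
proof -
  have "a \<oplus> c \<odot> m \<oplus> \<zero> \<odot> m = a \<oplus> c \<odot> m" by (simp add: zero_mul add_zero)
  then show ?thesis unfolding cong_def by blast
qed

lemma cong_multiple0: "cong m (c \<odot> m) \<zero>"
  using cong_multiple[of m \<zero> c] by (simp add: zero_add)

lemma cong_beta:
  assumes "cong (S (S i \<odot> b)) a x" "x \<lhd> S (S i \<odot> b)"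
  shows "beta a b i x"
proof -
  let ?m = "S (S i \<odot> b)"
  obtain u v where uv: "a \<oplus> u \<odot> ?m = x \<oplus> v \<odot> ?m" using assms(1) unfolding cong_def by blast
  obtain q r where qr: "a = q \<odot> ?m \<oplus> r" "r \<lhd> ?m" using division[OF zero_less_Suc] by blast
  have "(q \<oplus> u) \<odot> ?m \<oplus> r = v \<odot> ?m \<oplus> x"
    using uv unfolding qr(1) by (simp add: arith.distrib_right add_assoc add_comm add_left_comm)
  then have "r = x" using remainder_unique(2) qr(2) assms(2) by blast
  then show ?thesis using qr assms(2) unfolding beta_def by blast
qed

lemma beta_cong: "beta a b i x \<Longrightarrow> cong (S (S i \<odot> b)) a x"
  unfolding beta_def using cong_multiple add_comm by metis

text \<open>Asking for some positive common multiple, rather than for a factorial, makes the claim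
  \<Sigma>1 before coded sequences exist.\<close>

lemma common_multiple: "\<exists>m. \<zero> \<lhd> m \<and> (\<forall>i. i \<lhd> k \<longrightarrow> (\<exists>c. m = S i \<odot> c))"
proof (induction k rule: SD_induction)
  case 1
  then show ?case by (intro SDs SD_delta DDs TD_intros)
next
  case 2
  then show ?case using zero_less_Suc by auto
next
  case (3 k)
  then obtain m where m: "\<zero> \<lhd> m" "\<forall>i. i \<lhd> k \<longrightarrow> (\<exists>c. m = S i \<odot> c)" by blast
  have "\<zero> \<lhd> m \<odot> S k" using m(1) zero_less_Suc by (rule arith.mult_pos_pos)
  moreover have "\<exists>c. m \<odot> S k = S i \<odot> c" if "i \<lhd> S k" for i
    using that m(2) unfolding less_Suc by (metis mul_assoc mul_comm)
  ultimately show ?case by blast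
qed

lemma moduli_coprime:
  assumes "b = S d \<odot> c" and j: "j = i \<oplus> S d"
  shows "\<exists>u. cong (S (S j \<odot> b)) (S (S i \<odot> b) \<odot> u) (S \<zero>)"
proof -
  define t where "t = S j \<odot> b"
  \<comment> \<open>Modulo 1 + t, the number t is -1. As \<open>S d\<close> divides b, this u makes
    \<open>S d \<odot> b \<odot> u\<close> the cube of t, again -1. The modulus equals
    \<open>?n \<oplus> S d \<odot> b\<close>, hence u is an inverse of \<open>?n\<close>.\<close>
  define u where "u = t \<odot> c \<odot> S j \<odot> S j"
  let ?m = "S t" and ?n = "S (S i \<odot> b)"
  have mn: "?m = ?n \<oplus> S d \<odot> b"
    by (simp add: t_def j Suc_mul arith.distrib_right add_Suc Suc_add add_assoc add_comm add_left_comm)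
  have "S d \<odot> b \<odot> u = (S d \<odot> c) \<odot> (S j \<odot> (S j \<odot> (b \<odot> t)))"
    by (simp only: u_def mul_assoc mul_comm mul_left_comm)
  also have "\<dots> = t \<odot> t \<odot> t"
    by (simp only: assms(1)[symmetric]) (simp only: t_def mul_assoc mul_comm mul_left_comm)
  finally have t3: "S d \<odot> b \<odot> u = t \<odot> t \<odot> t" .
  have c0: "cong ?m (x \<odot> t \<oplus> x) \<zero>" for x
    using cong_multiple0[of ?m x] by (simp add: mul_Suc)
  have "cong ?m (t \<odot> t \<odot> t \<oplus> t \<odot> t) (t \<oplus> t \<odot> t)"
    using cong_trans[OF c0[of "t \<odot> t"] cong_sym[OF c0[of t]]] by (simp add: add_comm)
  then have "cong ?m (t \<odot> t \<odot> t) t" by (rule cong_add_cancel)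
  then have "cong ?m (?n \<odot> u \<oplus> S d \<odot> b \<odot> u) (?n \<odot> u \<oplus> t)" unfolding t3 by (rule cong_add_left)
  moreover have "cong ?m (?n \<odot> u \<oplus> S d \<odot> b \<odot> u) \<zero>"
    using cong_multiple0[of ?m u] unfolding mn by (simp add: arith.distrib_right mul_comm[of u])
  moreover have "cong ?m (S \<zero> \<oplus> t) \<zero>"
    using c0[of "S \<zero>"] by (simp add: Suc_mul zero_mul zero_add Suc_add add_Suc add_zero)
  ultimately have "cong ?m (?n \<odot> u \<oplus> t) (S \<zero> \<oplus> t)" by (meson cong_sym cong_trans)
  then show ?thesis unfolding t_def[symmetric] by (blast intro: cong_add_cancel)
qed

lemma SD_cong:
  assumes "TD M m" "TD M a" "TD M b"
  shows "SD M (\<lambda>e. cong (m e) (a e) (b e))"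
  unfolding cong_def
  by (intro SDs SD_delta DDs TD_Suc TD_Plus TD_Times TD_shift[OF assms(1)] TD_shift[OF assms(2)]
      TD_shift[OF assms(3)] TD_var)

text \<open>Chinese remainders for a possibly nonstandard number of moduli. V is only \<Sigma>1 and
  need not be functional: a value is chosen at each step, and the bound B makes it smaller than
  every modulus.\<close>

lemma beta_comprehension:
  assumes V: "SD M (\<lambda>e. V (e 0) (e 1))" and tot: "\<And>i. i \<lhd> l \<Longrightarrow> \<exists>v. v \<lhd> B \<and> V i v"
  shows "\<exists>a b. \<forall>i. i \<lhd> l \<longrightarrow> (\<exists>v. beta a b i v \<and> V i v)"
proof -
  have VV: "SD M (\<lambda>e. V (e i) (e j))" for i j
    using SD_shift[OF V, of "case_nat i (\<lambda>_. j)"] by simp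
  obtain m where m: "\<zero> \<lhd> m" "\<And>i. i \<lhd> l \<Longrightarrow> \<exists>c. m = S i \<odot> c" using common_multiple by blast
  \<comment> \<open>A multiple of all positive numbers up to l makes the moduli pairwise coprime, a
    multiple of B makes them exceed the values.\<close>
  define b where "b = m \<odot> B"
  have div: "\<exists>c. b = S d \<odot> c" if "d \<lhd> l" for d
    using m(2)[OF that] unfolding b_def by (metis mul_assoc)
  define mm where "mm i = S (S i \<odot> b)" for i
  have small: "v \<lhd> mm i" if "v \<lhd> B" for v i
  proof -
    have "B \<unlhd> B \<odot> m" using m(1) by (intro leq_mul1) auto
    also have "\<dots> = b" by (simp add: b_def mul_comm)
    also have "b \<unlhd> b \<odot> S i" by (intro leq_mul1) simp
    also have "\<dots> \<lhd> mm i" by (simp add: mm_def mul_comm less_SucI)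
    finally show ?thesis using that less_trans by blast
  qed
  have cop: "\<exists>u. cong (mm j) (mm i \<odot> u) (S \<zero>)" if ij: "i \<lhd> j" and jl: "j \<lhd> l" for i j
  proof -
    obtain d where d: "j = i \<oplus> S d" using ij less_ex_Suc_add by blast
    have "d \<lhd> S d" by (simp add: less_Suc)
    also have "S d \<unlhd> j" unfolding d by (rule leq_add2)
    finally have "d \<lhd> l" using jl less_trans by blast
    then obtain c where "b = S d \<odot> c" using div by blast
    then show ?thesis unfolding mm_def by (rule moduli_coprime[OF _ d])
  qed
  \<comment> \<open>P is a common multiple of the moduli already treated and is invertible modulo
    each later one. The disjunct \<open>l \<lhd> k\<close> lets the induction stop at l.\<close>
  have "(\<exists>a P. (\<forall>i. i \<lhd> k \<longrightarrow> (\<exists>c. P = c \<odot> mm i) \<and> (\<exists>v. beta a b i v \<and> V i v)) \<and>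
      (\<forall>j. j \<lhd> l \<longrightarrow> k \<unlhd> j \<longrightarrow> (\<exists>u. cong (mm j) (P \<odot> u) (S \<zero>)))) \<or> l \<lhd> k" for k
  proof (induction k rule: SD_induction)
    case 1
    show ?case unfolding mm_def
      by (intro SDs SD_cong SD_beta VV[unfolded One_nat_def] SD_delta DDs TD_intros VV)
  next
    case 2
    have "cong (mm j) (S \<zero> \<odot> S \<zero>) (S \<zero>)" for j
      by (simp add: mul_Suc mul_zero zero_add cong_refl)
    then show ?case using not_less_zero by blast
  next
    case (3 k)
    show ?case
    proof (cases "k \<lhd> l")
      case False
      then show ?thesis using not_leq[of l k] less_Suc_iff[of l k] by blast
    next
      case True
      then obtain a P where aP: "\<And>i. i \<lhd> k \<Longrightarrow> \<exists>c. P = c \<odot> mm i" "\<And>i. i \<lhd> k \<Longrightarrow> \<exists>v. beta a b i v \<and> V i v"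
        "\<And>j. j \<lhd> l \<Longrightarrow> k \<unlhd> j \<Longrightarrow> \<exists>u. cong (mm j) (P \<odot> u) (S \<zero>)"
        using 3 less_trans less_irrefl by metis
      obtain v where v: "v \<lhd> B" "V k v" using tot[OF True] by blast
      obtain u where u: "cong (mm k) (P \<odot> u) (S \<zero>)" using aP(3)[OF True] by (auto simp: leq_def)
      define \<tau> where "\<tau> = S k \<odot> b"
      \<comment> \<open>Adding a multiple of P leaves the earlier residues alone, and u inverts P
        modulo the new modulus \<open>S \<tau>\<close>. There \<tau> is -1, so adding \<tau> times a
        has the effect of subtracting a.\<close>
      define a' where "a' = a \<oplus> P \<odot> (u \<odot> (v \<oplus> \<tau> \<odot> a))"
      have "cong (mm k) ((v \<oplus> \<tau> \<odot> a) \<odot> (P \<odot> u)) ((v \<oplus> \<tau> \<odot> a) \<odot> S \<zero>)" by (rule cong_mult[OF u])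
      then have "cong (mm k) (P \<odot> (u \<odot> (v \<oplus> \<tau> \<odot> a))) (v \<oplus> \<tau> \<odot> a)"
        by (simp add: mul_assoc mul_comm[of "v \<oplus> \<tau> \<odot> a"] mul_Suc mul_zero zero_add)
      then have "cong (mm k) a' (a \<oplus> (v \<oplus> \<tau> \<odot> a))" unfolding a'_def by (rule cong_add_left)
      also have "a \<oplus> (v \<oplus> \<tau> \<odot> a) = v \<oplus> a \<odot> mm k"
        by (simp add: mm_def \<tau>_def mul_Suc mul_comm add_comm add_left_comm)
      finally have "cong (mm k) a' v" using cong_multiple cong_trans by blast
      then have k: "beta a' b k v" using small[OF v(1), of k] cong_beta unfolding mm_def by blast
      have old: "beta a' b i w" if "i \<lhd> k" "beta a b i w" for i w
      proof -
        obtain c where c: "P = c \<odot> mm i" using aP(1) \<open>i \<lhd> k\<close> by blast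
        have "a' = a \<oplus> (c \<odot> (u \<odot> (v \<oplus> \<tau> \<odot> a))) \<odot> mm i"
          unfolding a'_def c by (simp add: mul_assoc mul_comm mul_left_comm)
        then have "cong (mm i) a' a" using cong_multiple by metis
        then have "cong (mm i) a' w" using beta_cong[OF that(2)] cong_trans unfolding mm_def by blast
        then show ?thesis using that(2) cong_beta unfolding mm_def beta_def by blast
      qed
      have "\<exists>c. P \<odot> mm k = c \<odot> mm i" "\<exists>v. beta a' b i v \<and> V i v" if "i \<lhd> S k" for i
      proof -
        show "\<exists>c. P \<odot> mm k = c \<odot> mm i"
          using that aP(1)[of i] unfolding less_Suc by (metis mul_assoc mul_comm)
        show "\<exists>v. beta a' b i v \<and> V i v"
          using that aP(2)[of i] old[of i] k v(2) unfolding less_Suc by blast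
      qed
      moreover have "\<exists>u. cong (mm j) (P \<odot> mm k \<odot> u) (S \<zero>)" if j: "j \<lhd> l" "S k \<unlhd> j" for j
      proof -
        have kj: "k \<lhd> j" using j(2) less_Suc_iff[of k k] by (metis arith.less_le_trans arith.order_refl)
        obtain u1 where u1: "cong (mm j) (P \<odot> u1) (S \<zero>)" using aP(3)[OF j(1)] kj by (auto simp: leq_def)
        obtain u2 where u2: "cong (mm j) (mm k \<odot> u2) (S \<zero>)" using cop[OF kj j(1)] by blast
        have "cong (mm j) ((P \<odot> u1) \<odot> (mm k \<odot> u2)) ((P \<odot> u1) \<odot> S \<zero>)" using u2 by (rule cong_mult)
        then have "cong (mm j) ((P \<odot> u1) \<odot> (mm k \<odot> u2)) (P \<odot> u1)" by (simp add: mul_Suc mul_zero zero_add)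
        then have "cong (mm j) ((P \<odot> u1) \<odot> (mm k \<odot> u2)) (S \<zero>)" using u1 cong_trans by blast
        moreover have "(P \<odot> u1) \<odot> (mm k \<odot> u2) = P \<odot> mm k \<odot> (u1 \<odot> u2)"
          by (simp add: mul_assoc mul_comm mul_left_comm)
        ultimately show ?thesis by metis
      qed
      ultimately show ?thesis by blast
    qed
  qed
  from this[of l] show ?thesis using less_irrefl by blast
qed

end

context isig
begin

declare cd.simps [simp del]

section \<open>Inductive definitions\<close>

definition SEQ :: "(('a \<Rightarrow> bool) \<Rightarrow> 'a \<Rightarrow> bool) \<Rightarrow> 'a \<Rightarrow> 'a \<Rightarrow> 'a \<Rightarrow> bool" where
  "SEQ stp a b n \<longleftrightarrow> (\<forall>i. i \<lhd> n \<longrightarrow> (\<exists>y. beta a b i y \<and> stp (\<lambda>z. \<exists>j. j \<lhd> i \<and> beta a b j z) y))"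

text \<open>The meaning of \<open>Ind\<close> in \<open>M\<close>. The sequence may have nonstandard
  length, so this is not an inductive definition of HOL, and its induction principle
  \<open>IND_induct\<close> is restricted to \<Sigma>1 properties.\<close>

definition IND :: "(('a \<Rightarrow> bool) \<Rightarrow> 'a \<Rightarrow> bool) \<Rightarrow> 'a \<Rightarrow> bool" where
  "IND stp x \<longleftrightarrow> (\<exists>a b l. beta a b l x \<and> SEQ stp a b (S l))"

definition memb :: "'a \<Rightarrow> 'a \<Rightarrow> 'a \<Rightarrow> 'a \<Rightarrow> bool" where
  "memb a b n z \<longleftrightarrow> (\<exists>j. j \<lhd> n \<and> beta a b j z)"

definition mono_step :: "(('a \<Rightarrow> bool) \<Rightarrow> 'a \<Rightarrow> bool) \<Rightarrow> bool" where
  "mono_step stp \<longleftrightarrow> (\<forall>E E' y. (\<forall>z. E z \<longrightarrow> E' z) \<longrightarrow> stp E y \<longrightarrow> stp E' y)"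

lemma mono_stepD: "mono_step stp \<Longrightarrow> stp E y \<Longrightarrow> (\<And>z. E z \<Longrightarrow> E' z) \<Longrightarrow> stp E' y"
  unfolding mono_step_def by blast

lemma SEQ_prefix: "SEQ stp a b n \<Longrightarrow> m \<unlhd> n \<Longrightarrow> SEQ stp a b m"
  unfolding SEQ_def using arith.less_le_trans by blast

lemma IND_memb: "SEQ stp a b n \<Longrightarrow> memb a b n z \<Longrightarrow> IND stp z"
proof -
  assume "SEQ stp a b n" "memb a b n z"
  then obtain j where "j \<lhd> n" "beta a b j z" by (auto simp: memb_def)
  moreover from this have "S j \<unlhd> n" using Suc_less_Suc[of j n] by (simp add: less_Suc_iff)
  ultimately show ?thesis using SEQ_prefix \<open>SEQ stp a b n\<close> unfolding IND_def by blast
qed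

lemma IND_obtain:
  assumes "IND stp z"
  obtains a b n where "SEQ stp a b n" "memb a b n z"
  using assms less_SucI[OF arith.order_refl] unfolding IND_def memb_def by blast

lemma beta_bound: "beta a b i x \<Longrightarrow> i \<lhd> n \<Longrightarrow> x \<lhd> S (S n \<odot> b)"
proof -
  assume "beta a b i x" "i \<lhd> n"
  then have "x \<lhd> S (S i \<odot> b)" "S i \<unlhd> S n" unfolding beta_def leq_def using Suc_less_Suc by auto
  moreover from this(2) have "S i \<odot> b \<unlhd> S n \<odot> b" by (intro arith.mult_right_mono zero_leq)
  ultimately show ?thesis using less_Suc_iff arith.order_trans by blast
qed

text \<open>Both numbers of a code change when it is extended, so the old entries are copied into a
  new code; monotonicity of the step carries their justifications over.\<close>

lemma SEQ_append:
  assumes mono: "mono_step stp" and seq: "SEQ stp a b n" and y: "stp (memb a b n) y"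
  shows "\<exists>a' b'. SEQ stp a' b' (S n) \<and> memb a' b' (S n) y \<and> (\<forall>z. memb a b n z \<longrightarrow> memb a' b' (S n) z)"
proof -
  let ?V = "\<lambda>i v. i \<lhd> n \<and> beta a b i v \<or> i = n \<and> v = y"
  have "\<exists>a' b'. \<forall>i. i \<lhd> S n \<longrightarrow> (\<exists>v. beta a' b' i v \<and> ?V i v)"
  proof (rule beta_comprehension[where B = "S (S n \<odot> b) \<oplus> S y"])
    show "SD M (\<lambda>e. ?V (e 0) (e 1))" by (intro SDs SD_beta SD_delta[OF DD_less] SD_delta[OF DD_eq] TD_intros)
    fix i assume i: "i \<lhd> S n"
    show "\<exists>v. v \<lhd> S (S n \<odot> b) \<oplus> S y \<and> ?V i v"
    proof (cases "i = n")
      case True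
      have "y \<lhd> S y" by (simp add: less_Suc)
      then show ?thesis using True leq_add2 arith.less_le_trans by blast
    next
      case False
      then have "i \<lhd> n" using i by (simp add: less_Suc)
      then show ?thesis using beta_total[of a b i] beta_bound leq_add1 arith.less_le_trans by blast
    qed
  qed
  then obtain a' b' where ab: "\<And>i. i \<lhd> S n \<Longrightarrow> \<exists>v. beta a' b' i v \<and> ?V i v" by blast
  have old: "beta a b i z \<Longrightarrow> beta a' b' i z" if "i \<lhd> n" for i z
    using ab[of i] that beta_fun less_irrefl less_Suc by blast
  have new: "beta a' b' n y" using ab[of n] less_irrefl less_Suc by blast
  have sub: "\<exists>j. j \<lhd> i \<and> beta a' b' j z" if "\<exists>j. j \<lhd> i \<and> beta a b j z" "i \<unlhd> n" for i z
    using that old arith.less_le_trans by blast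
  have "SEQ stp a' b' (S n)"
    unfolding SEQ_def
  proof (intro allI impI)
    fix i assume "i \<lhd> S n"
    then consider "i \<lhd> n" | "i = n" by (auto simp: less_Suc)
    then show "\<exists>y. beta a' b' i y \<and> stp (\<lambda>z. \<exists>j. j \<lhd> i \<and> beta a' b' j z) y"
    proof cases
      case 1
      then obtain x where x: "beta a b i x" "stp (\<lambda>z. \<exists>j. j \<lhd> i \<and> beta a b j z) x"
        using seq unfolding SEQ_def by blast
      then have "stp (\<lambda>z. \<exists>j. j \<lhd> i \<and> beta a' b' j z) x"
        by (intro mono_stepD[OF mono x(2)] sub) (auto simp: 1 leq_def)
      then show ?thesis using old 1 x(1) by blast
    next
      case 2
      have "stp (\<lambda>z. \<exists>j. j \<lhd> n \<and> beta a' b' j z) y"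
        by (intro mono_stepD[OF mono y[unfolded memb_def]] sub) auto
      then show ?thesis using new 2 by blast
    qed
  qed
  moreover have "memb a' b' (S n) y" "\<And>z. memb a b n z \<Longrightarrow> memb a' b' (S n) z"
    using new old unfolding memb_def less_Suc by blast+
  ultimately show ?thesis by blast
qed

text \<open>Rules with two premises, such as modus ponens, need the derivations of both premises in
  one sequence.\<close>

lemma SEQ_concat:
  assumes mono: "mono_step stp" and seq: "SEQ stp a b n" and seq': "SEQ stp a' b' n'"
  shows "\<exists>c d m. SEQ stp c d m \<and> (\<forall>z. memb a b n z \<or> memb a' b' n' z \<longrightarrow> memb c d m z)"
proof -
  let ?V = "\<lambda>i v. i \<lhd> n \<and> beta a b i v \<or> (\<exists>j. j \<lhd> n' \<and> i = n \<oplus> j \<and> beta a' b' j v)"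
  have split: "i \<lhd> n \<or> (\<exists>j. j \<lhd> n' \<and> i = n \<oplus> j)" if "i \<lhd> n \<oplus> n'" for i
  proof (cases "i \<lhd> n")
    case False
    then obtain j where "i = n \<oplus> j" using leq_ex_add not_leq add_comm by metis
    then show ?thesis using that by auto
  qed auto
  have "\<exists>c d. \<forall>i. i \<lhd> n \<oplus> n' \<longrightarrow> (\<exists>v. beta c d i v \<and> ?V i v)"
  proof (rule beta_comprehension[where B = "S (S n \<odot> b) \<oplus> S (S n' \<odot> b')"])
    show "SD M (\<lambda>e. ?V (e 0) (e 1))" by (intro SDs SD_beta SD_delta[OF DD_less] SD_delta[OF DD_eq] TD_intros)
    fix i assume i: "i \<lhd> n \<oplus> n'"
    from split[OF i] show "\<exists>v. v \<lhd> S (S n \<odot> b) \<oplus> S (S n' \<odot> b') \<and> ?V i v"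
    proof
      assume "i \<lhd> n"
      then show ?thesis using beta_total[of a b i] beta_bound leq_add1 arith.less_le_trans by blast
    next
      assume "\<exists>j. j \<lhd> n' \<and> i = n \<oplus> j"
      then obtain j where "j \<lhd> n'" "i = n \<oplus> j" by blast
      then show ?thesis using beta_total[of a' b' j] beta_bound leq_add2 arith.less_le_trans by blast
    qed
  qed
  then obtain c d where cd: "\<And>i. i \<lhd> n \<oplus> n' \<Longrightarrow> \<exists>v. beta c d i v \<and> ?V i v" by blast
  have notless: "\<not> n \<oplus> j \<lhd> n" for j using leq_add1 not_leq by blast
  have one: "beta c d i z" if "i \<lhd> n" "beta a b i z" for i z
  proof -
    have "i \<lhd> n \<oplus> n'" using that(1) leq_add1 arith.less_le_trans by blast
    then show ?thesis using cd[of i] that beta_fun notless by metis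
  qed
  have two: "beta c d (n \<oplus> j) z" if "j \<lhd> n'" "beta a' b' j z" for j z
  proof -
    have "n \<oplus> j \<lhd> n \<oplus> n'" using that(1) by simp
    then obtain v where v: "beta c d (n \<oplus> j) v" "?V (n \<oplus> j) v" using cd by blast
    then have "beta a' b' j v" using notless add_cancel add_comm by metis
    then show ?thesis using v that beta_fun by metis
  qed
  have "SEQ stp c d (n \<oplus> n')"
    unfolding SEQ_def
  proof (intro allI impI)
    fix i assume "i \<lhd> n \<oplus> n'"
    from split[OF this] show "\<exists>y. beta c d i y \<and> stp (\<lambda>z. \<exists>j. j \<lhd> i \<and> beta c d j z) y"
    proof
      assume i: "i \<lhd> n"
      then obtain x where x: "beta a b i x" "stp (\<lambda>z. \<exists>j. j \<lhd> i \<and> beta a b j z) x"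
        using seq unfolding SEQ_def by blast
      then have "stp (\<lambda>z. \<exists>j. j \<lhd> i \<and> beta c d j z) x"
        by (intro mono_stepD[OF mono x(2)]) (use i one less_trans in blast)
      then show ?thesis using one i x(1) by blast
    next
      assume "\<exists>j. j \<lhd> n' \<and> i = n \<oplus> j"
      then obtain k where k: "k \<lhd> n'" "i = n \<oplus> k" by blast
      then obtain x where x: "beta a' b' k x" "stp (\<lambda>z. \<exists>j. j \<lhd> k \<and> beta a' b' j z) x"
        using seq' unfolding SEQ_def by blast
      have "\<exists>j. j \<lhd> i \<and> beta c d j z" if h: "\<exists>j. j \<lhd> k \<and> beta a' b' j z" for z
      proof -
        obtain j where j: "j \<lhd> k" "beta a' b' j z" using h by blast
        then have "n \<oplus> j \<lhd> i" unfolding k(2) by simp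
        then show ?thesis using two[of j z] j k(1) less_trans by blast
      qed
      then have "stp (\<lambda>z. \<exists>j. j \<lhd> i \<and> beta c d j z) x"
        by (intro mono_stepD[OF mono x(2)])
      then show ?thesis using two k x(1) by blast
    qed
  qed
  moreover have "memb c d (n \<oplus> n') z" if "memb a b n z \<or> memb a' b' n' z" for z
  proof -
    from that consider j where "j \<lhd> n" "beta a b j z" | j where "j \<lhd> n'" "beta a' b' j z"
      unfolding memb_def by blast
    then show ?thesis
    proof cases
      case 1
      then show ?thesis using one leq_add1[of n n'] arith.less_le_trans unfolding memb_def by blast
    next
      case 2
      then have "n \<oplus> j \<lhd> n \<oplus> n'" by simp
      then show ?thesis using two 2 unfolding memb_def by blast
    qed
  qed
  ultimately show ?thesis by blast
qed

lemma SEQ_empty: "SEQ stp a b \<zero>"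
  by (simp add: SEQ_def)

lemma IND_step:
  assumes "mono_step stp" "SEQ stp a b n" "stp (memb a b n) y"
  shows "IND stp y"
  using SEQ_append[OF assms] IND_memb by blast

lemma IND_intro0: "mono_step stp \<Longrightarrow> stp (\<lambda>z. False) y \<Longrightarrow> IND stp y"
  by (rule IND_step[OF _ SEQ_empty]) (auto intro: mono_stepD)

lemma IND_intro2:
  assumes "mono_step stp" "IND stp u" "IND stp v" "stp (\<lambda>z. z = u \<or> z = v) y"
  shows "IND stp y"
proof -
  obtain a b n where 1: "SEQ stp a b n" "memb a b n u" using assms(2) by (rule IND_obtain)
  obtain a' b' n' where 2: "SEQ stp a' b' n'" "memb a' b' n' v" using assms(3) by (rule IND_obtain)
  obtain c d m where 3: "SEQ stp c d m" "\<forall>z. memb a b n z \<or> memb a' b' n' z \<longrightarrow> memb c d m z"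
    using SEQ_concat[OF assms(1) 1(1) 2(1)] by blast
  show ?thesis
    by (rule IND_step[OF assms(1) 3(1)]) (rule mono_stepD[OF assms(1,4)], use 1 2 3 in blast)
qed

lemma IND_intro1: "mono_step stp \<Longrightarrow> IND stp u \<Longrightarrow> stp (\<lambda>z. z = u) y \<Longrightarrow> IND stp y"
  using IND_intro2[of stp u u y] by simp

lemma IND_unfold: "mono_step stp \<Longrightarrow> IND stp y \<Longrightarrow> stp (IND stp) y"
proof -
  assume mono: "mono_step stp" and "IND stp y"
  then obtain a b l where l: "beta a b l y" "SEQ stp a b (S l)" unfolding IND_def by blast
  then obtain y' where "beta a b l y'" "stp (\<lambda>z. \<exists>j. j \<lhd> l \<and> beta a b j z) y'"
    unfolding SEQ_def less_Suc by blast
  then have "stp (memb a b l) y" using l beta_fun unfolding memb_def by metis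
  moreover have "SEQ stp a b l" using SEQ_prefix[OF l(2), of l] by (simp add: leq_def less_Suc)
  ultimately show ?thesis using IND_memb by (blast intro: mono_stepD[OF mono])
qed

text \<open>The induction runs over positions in the sequence. Stating existentially that the entry
  has the property Q keeps the claim \<Sigma>1, and \<open>beta_fun\<close> identifies the entry
  afterwards.\<close>

lemma IND_induct:
  assumes mono: "mono_step stp" and "IND stp y" and Q: "SD M (\<lambda>e. Q (e 0))"
    and step: "\<And>y. stp Q y \<Longrightarrow> Q y"
  shows "Q y"
proof -
  obtain a b l where l: "beta a b l y" "SEQ stp a b (S l)" using assms(2) unfolding IND_def by blast
  have QQ: "SD M (\<lambda>e. Q (e i))" for i using SD_shift[OF Q, of "\<lambda>_. i"] .
  have "i \<lhd> S l \<longrightarrow> (\<exists>z. beta a b i z \<and> Q z)" for i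
  proof (induction i rule: SD_less_induction)
    case 1
    show ?case by (intro SDs SD_beta QQ DDs TD_intros)
  next
    case (2 i)
    show ?case
    proof
      assume i: "i \<lhd> S l"
      then obtain z where z: "beta a b i z" "stp (\<lambda>z. \<exists>j. j \<lhd> i \<and> beta a b j z) z"
        using l(2) unfolding SEQ_def by blast
      have "stp Q z"
        by (rule mono_stepD[OF mono z(2)]) (use 2 i less_trans beta_fun in blast)
      then show "\<exists>z. beta a b i z \<and> Q z" using z(1) step by blast
    qed
  qed
  from this[of l] show ?thesis using l(1) beta_fun less_Suc by blast
qed

section \<open>Meaning of the formulas of the arithmetization\<close>

text \<open>\<open>(d, e)\<close> is an environment \<open>e\<close> in the scope of \<open>d\<close> quantifiers. What a term or formula means there has
  to persist under further quantifiers, because it is a function of their number.\<close>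

inductive ext :: "nat \<times> (nat \<Rightarrow> 'a) \<Rightarrow> nat \<times> (nat \<Rightarrow> 'a) \<Rightarrow> bool" where
  ext_refl: "ext c c"
| ext_push: "ext c (d, e) \<Longrightarrow> ext c (Suc d, a ## e)"

lemma ext_trans: "ext c c' \<Longrightarrow> ext c' c'' \<Longrightarrow> ext c c''"
  by (rotate_tac, induction rule: ext.induct) (auto intro: ext.intros)

definition den :: "nat \<times> (nat \<Rightarrow> 'a) \<Rightarrow> dtm \<Rightarrow> 'a \<Rightarrow> bool" where
  "den c x a \<longleftrightarrow> (\<forall>d e. ext c (d, e) \<longrightarrow> meval M e (x d) = a)"

definition dsat :: "nat \<times> (nat \<Rightarrow> 'a) \<Rightarrow> dfm \<Rightarrow> bool \<Rightarrow> bool" where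
  "dsat c F P \<longleftrightarrow> (\<forall>d e. ext c (d, e) \<longrightarrow> msat M e (F d) = P)"

definition mean :: "nat \<times> (nat \<Rightarrow> 'a) \<Rightarrow> (dtm \<Rightarrow> dfm) \<Rightarrow> ('a \<Rightarrow> bool) \<Rightarrow> bool" where
  "mean c E P \<longleftrightarrow> (\<forall>c' z a. ext c c' \<longrightarrow> den c' z a \<longrightarrow> dsat c' (E z) (P a))"

lemma den_up: "ext c c' \<Longrightarrow> den c x a \<Longrightarrow> den c' x a"
  unfolding den_def using ext_trans by blast

lemma mean_up: "ext c c' \<Longrightarrow> mean c E P \<Longrightarrow> mean c' E P"
  unfolding mean_def using ext_trans by blast

lemma mean_I: "(\<And>c' z a. ext c c' \<Longrightarrow> den c' z a \<Longrightarrow> dsat c' (E z) (P a)) \<Longrightarrow> mean c E P"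
  unfolding mean_def by blast

lemma dsat_mean: "mean c E P \<Longrightarrow> den c z a \<Longrightarrow> dsat c (E z) (P a)"
  unfolding mean_def using ext_refl by blast

lemma den_free: "den (0, e) (free i) (e i)"
proof -
  have "ext c c' \<Longrightarrow> c = (0, e) \<Longrightarrow> snd c' (i + fst c') = e i" for c c'
    by (induction rule: ext.induct) auto
  then show ?thesis by (auto simp: den_def free_def)
qed

lemma den_bound: "den (Suc d, a ## e) (\<lambda>d'. Var (d' - Suc d)) a"
proof -
  have "ext c c' \<Longrightarrow> c = (Suc d, a ## e) \<Longrightarrow> fst c' \<ge> Suc d \<and> snd c' (fst c' - Suc d) = a" for c c'
  proof (induction rule: ext.induct)
    case (ext_push c d' e' b)
    then have "Suc d' - Suc d = Suc (d' - Suc d)" by auto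
    then show ?case using ext_push by simp
  qed simp
  then show ?thesis by (auto simp: den_def)
qed

lemma den_dnum: "den c (dnum n) (cd n)"
  by (simp add: den_def dnum_def meval_num)

lemma den_dS: "den c x a \<Longrightarrow> den c (dS x) (S a)"
  by (simp add: den_def dS_def)

lemma den_dplus: "den c x a \<Longrightarrow> den c y b \<Longrightarrow> den c (x \<^bold>+ y) (a \<oplus> b)"
  by (simp add: den_def dplus_def)

lemma den_dtimes: "den c x a \<Longrightarrow> den c y b \<Longrightarrow> den c (x \<^bold>* y) (a \<odot> b)"
  by (simp add: den_def dtimes_def)

lemma dsat_deq: "den c x a \<Longrightarrow> den c y b \<Longrightarrow> dsat c (x \<^bold>= y) (a = b)"
  by (simp add: den_def dsat_def deq_def)

lemma dsat_dlt: "den c x a \<Longrightarrow> den c y b \<Longrightarrow> dsat c (x \<^bold>< y) (a \<lhd> b)"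
  by (simp add: den_def dsat_def dlt_def)

lemma dsat_dneg: "dsat c F P \<Longrightarrow> dsat c (\<^bold>\<not> F) (\<not> P)"
  by (simp add: dsat_def dneg_def)

lemma dsat_dconj: "dsat c F P \<Longrightarrow> dsat c G Q \<Longrightarrow> dsat c (F \<^bold>\<and> G) (P \<and> Q)"
  by (simp add: dsat_def dconj_def)

lemma dsat_ddisj: "dsat c F P \<Longrightarrow> dsat c G Q \<Longrightarrow> dsat c (F \<^bold>\<or> G) (P \<or> Q)"
  by (auto simp add: dsat_def ddisj_def)

lemma dsat_dex:
  assumes "\<And>c' x a. ext c c' \<Longrightarrow> den c' x a \<Longrightarrow> dsat c' (F x) (P a)"
  shows "dsat c (dex F) (\<exists>a. P a)"
proof -
  have "msat M (a ## e) (F (\<lambda>d'. Var (d' - Suc d)) (Suc d)) = P a" if "ext c (d, e)" for d e a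
    using assms[OF ext_push[OF that] den_bound] ext_refl unfolding dsat_def by blast
  then show ?thesis by (simp add: dsat_def dex_def)
qed

lemma dsat_dallb:
  assumes "den c t b" "\<And>c' x a. ext c c' \<Longrightarrow> den c' x a \<Longrightarrow> dsat c' (F x) (P a)"
  shows "dsat c (dallb t F) (\<forall>a. a \<lhd> b \<longrightarrow> P a)"
proof -
  have "msat M (a ## e) (F (\<lambda>d'. Var (d' - Suc d)) (Suc d)) = P a" if "ext c (d, e)" for d e a
    using assms(2)[OF ext_push[OF that] den_bound] ext_refl unfolding dsat_def by blast
  moreover have "meval M (a ## e) (t (Suc d)) = b" if "ext c (d, e)" for d e a
    using assms(1) ext_push[OF that] unfolding den_def by blast
  ultimately show ?thesis by (simp add: dsat_def dallb_def)
qed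

lemmas den_intros = den_dnum den_dS den_dplus den_dtimes
lemmas dsat_intros = dsat_deq dsat_dlt dsat_dneg dsat_dconj dsat_ddisj dsat_dex dsat_dallb

lemma dsat_dPair: "den c x a \<Longrightarrow> den c y b \<Longrightarrow> den c z v \<Longrightarrow> dsat c (dPair x y z) (v = pr a b)"
  unfolding dPair_def ispr_iff[symmetric] ispr_def by (intro dsat_intros den_intros)

fun tp :: "'a list \<Rightarrow> 'a" where
  "tp [] = cd 0"
| "tp [x] = x"
| "tp (x # y # xs) = pr x (tp (y # xs))"

lemma dsat_Tup: "list_all2 (den c) xs as \<Longrightarrow> den c z v \<Longrightarrow> dsat c (Tup xs z) (v = tp as)"
proof (induction xs z arbitrary: c as v rule: Tup.induct)
  case (1 z)
  then show ?case by (auto intro: dsat_intros den_intros)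
next
  case (2 x z)
  then show ?case by (auto simp: list_all2_Cons1 intro: dsat_intros)
next
  case (3 x y xs z)
  from "3.prems"(1) obtain a b as' where as: "as = a # b # as'" "den c x a" "list_all2 (den c) (y # xs) (b # as')"
    by (auto simp: list_all2_Cons1)
  have "dsat c (Tup (x # y # xs) z) (\<exists>w. w = tp (b # as') \<and> v = pr a w)"
    unfolding Tup.simps
  proof (intro dsat_intros "3.IH" dsat_dPair)
    fix c' u w assume c': "ext c c'" "den c' u w"
    show "list_all2 (den c') (y # xs) (b # as')"
      using as(3) by (rule list.rel_mono_strong) (use c' den_up in blast)
    show "den c' u w" "den c' u w" "den c' x a" "den c' z v"
      using c' as "3.prems" den_up by blast+
  qed
  then show ?case by (simp add: as(1))
qed

lemma dsat_Tup2: "den c x a \<Longrightarrow> den c y b \<Longrightarrow> den c z v \<Longrightarrow> dsat c (Tup [x, y] z) (v = pr a b)"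
  using dsat_Tup[of c "[x, y]" "[a, b]"] by simp

lemma dsat_Tup3: "den c x a \<Longrightarrow> den c y b \<Longrightarrow> den c w r \<Longrightarrow> den c z v \<Longrightarrow>
    dsat c (Tup [x, y, w] z) (v = pr a (pr b r))"
  using dsat_Tup[of c "[x, y, w]" "[a, b, r]"] by simp

lemma dsat_Tup4: "den c x a \<Longrightarrow> den c y b \<Longrightarrow> den c w r \<Longrightarrow> den c w' r' \<Longrightarrow> den c z v \<Longrightarrow>
    dsat c (Tup [x, y, w, w'] z) (v = pr a (pr b (pr r r')))"
  using dsat_Tup[of c "[x, y, w, w']" "[a, b, r, r']"] by simp

lemma dsat_among:
  assumes "mean c E P" "list_all2 (den c) xs as"
  shows "dsat c (among E xs) (P (tp as))"
proof -
  have "dsat c (among E xs) (\<exists>w. w = tp as \<and> P w)"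
    unfolding among_def
  proof (intro dsat_intros dsat_Tup dsat_mean)
    fix c' u w assume c': "ext c c'" "den c' u w"
    show "list_all2 (den c') xs as"
      using assms(2) by (rule list.rel_mono_strong) (use c' den_up in blast)
    show "mean c' E P" using assms(1) c'(1) mean_up by blast
    show "den c' u w" "den c' u w" using c' by blast+
  qed
  then show ?thesis by simp
qed

lemma dsat_among2: "mean c E P \<Longrightarrow> den c x a \<Longrightarrow> den c y b \<Longrightarrow> dsat c (among E [x, y]) (P (pr a b))"
  using dsat_among[of c E P "[x, y]" "[a, b]"] by simp

lemma dsat_among3: "mean c E P \<Longrightarrow> den c x a \<Longrightarrow> den c y b \<Longrightarrow> den c w r \<Longrightarrow>
    dsat c (among E [x, y, w]) (P (pr a (pr b r)))"
  using dsat_among[of c E P "[x, y, w]" "[a, b, r]"] by simp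

lemma dsat_among4: "mean c E P \<Longrightarrow> den c x a \<Longrightarrow> den c y b \<Longrightarrow> den c w r \<Longrightarrow> den c w' r' \<Longrightarrow>
    dsat c (among E [x, y, w, w']) (P (pr a (pr b (pr r r'))))"
  using dsat_among[of c E P "[x, y, w, w']" "[a, b, r, r']"] by simp

lemma dsat_Beta: "den c a a' \<Longrightarrow> den c b b' \<Longrightarrow> den c i i' \<Longrightarrow> den c x x' \<Longrightarrow>
    dsat c (Beta a b i x) (beta a' b' i' x')"
  unfolding Beta_def beta_def
  by ((rule dsat_intros den_intros | assumption | rule den_up, assumption)+)

lemma mean_Ind:
  assumes "\<And>c' E P z a. ext c c' \<Longrightarrow> mean c' E P \<Longrightarrow> den c' z a \<Longrightarrow> dsat c' (Step E z) (stp P a)"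
  shows "mean c (Ind Step) (IND stp)"
proof (rule mean_I)
  fix c1 x v assume c1: "ext c c1" "den c1 x v"
  show "dsat c1 (Ind Step x) (IND stp v)"
    unfolding Ind_def IND_def SEQ_def
    apply (rule dsat_dex)
    apply (rule dsat_dex)
    apply (rule dsat_dex)
    subgoal for c2 a a' c3 b b' c4 l l'
      apply (rule dsat_dconj)
       apply ((rule dsat_Beta | assumption | rule den_up, assumption | rule c1)+)[1]
      apply (rule dsat_dallb, (rule den_dS, assumption))
      subgoal for c5 i i'
        apply (rule dsat_dex)
        subgoal for c6 y y'
          apply (rule dsat_dconj)
           apply ((rule dsat_Beta | assumption | rule den_up, assumption)+)[1]
          apply (rule assms)
            apply (meson ext_trans c1)
           apply (rule mean_I)
           apply (rule dsat_dex)
           apply ((rule dsat_intros dsat_Beta | assumption | rule den_up, assumption)+)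
          done
        done
      done
    done
qed

end

context isig
begin

section \<open>Meaning of the syntactic relations and of provability\<close>

abbreviation cvar where "cvar i \<equiv> pr (cd 0) i"
abbreviation czero where "czero \<equiv> pr (cd (Suc 0)) (cd 0)"
abbreviation csuc where "csuc t \<equiv> pr (cd 2) t"
abbreviation cplus where "cplus s t \<equiv> pr (cd 3) (pr s t)"
abbreviation ctimes where "ctimes s t \<equiv> pr (cd 4) (pr s t)"
abbreviation ceq where "ceq s t \<equiv> pr (cd 5) (pr s t)"
abbreviation clt where "clt s t \<equiv> pr (cd 6) (pr s t)"
abbreviation cneg where "cneg p \<equiv> pr (cd 7) p"
abbreviation cimp where "cimp p q \<equiv> pr (cd 8) (pr p q)"
abbreviation call where "call p \<equiv> pr (cd 9) p"

lemma dsat_constructors: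
  "den c i a \<Longrightarrow> den c z v \<Longrightarrow> dsat c (cVar i z) (v = cvar a)"
  "den c z v \<Longrightarrow> dsat c (cZero z) (v = czero)"
  "den c s a \<Longrightarrow> den c z v \<Longrightarrow> dsat c (cSucc s z) (v = csuc a)"
  "den c s a \<Longrightarrow> den c t b \<Longrightarrow> den c z v \<Longrightarrow> dsat c (cPlus s t z) (v = cplus a b)"
  "den c s a \<Longrightarrow> den c t b \<Longrightarrow> den c z v \<Longrightarrow> dsat c (cTimes s t z) (v = ctimes a b)"
  "den c s a \<Longrightarrow> den c t b \<Longrightarrow> den c z v \<Longrightarrow> dsat c (cEq s t z) (v = ceq a b)"
  "den c s a \<Longrightarrow> den c t b \<Longrightarrow> den c z v \<Longrightarrow> dsat c (cLt s t z) (v = clt a b)"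
  "den c s a \<Longrightarrow> den c z v \<Longrightarrow> dsat c (cNeg s z) (v = cneg a)"
  "den c s a \<Longrightarrow> den c t b \<Longrightarrow> den c z v \<Longrightarrow> dsat c (cImp s t z) (v = cimp a b)"
  "den c s a \<Longrightarrow> den c z v \<Longrightarrow> dsat c (cAll s z) (v = call a)"
  unfolding cVar_def cZero_def cSucc_def cPlus_def cTimes_def cEq_def cLt_def cNeg_def cImp_def cAll_def
    One_nat_def
  by (rule dsat_Tup2 dsat_Tup3 den_dnum | assumption)+

text \<open>This and the following step predicates copy the defining formulas connective by
  connective, so that a meaning lemma is proved by matching one rule to each connective.\<close>

definition stTm where
  "stTm E z \<longleftrightarrow> (\<exists>i. z = cvar i) \<or> z = czero \<or> (\<exists>t. E t \<and> z = csuc t) \<or>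
     (\<exists>s. \<exists>t. E s \<and> E t \<and> (z = cplus s t \<or> z = ctimes s t))"

definition isTm where "isTm = IND stTm"

definition stFm where
  "stFm E z \<longleftrightarrow> (\<exists>s. \<exists>t. isTm s \<and> isTm t \<and> (z = ceq s t \<or> z = clt s t)) \<or>
     (\<exists>p. E p \<and> (z = cneg p \<or> z = call p)) \<or>
     (\<exists>p. \<exists>q. E p \<and> E q \<and> z = cimp p q)"

definition isFm where "isFm = IND stFm"

definition stLiftTm where
  "stLiftTm k E z \<longleftrightarrow> (\<exists>t. \<exists>t'. z = pr t t' \<and>
     ((\<exists>i. t = cvar i \<and> (i \<lhd> k \<and> t' = cvar i \<or> (\<not> i \<lhd> k) \<and> t' = cvar (S i))) \<or>
      t = czero \<and> t' = czero \<or>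
      (\<exists>u. \<exists>u'. E (pr u u') \<and> t = csuc u \<and> t' = csuc u') \<or>
      (\<exists>u. \<exists>v. \<exists>u'. \<exists>v'. E (pr u u') \<and> E (pr v v') \<and>
         (t = cplus u v \<and> t' = cplus u' v' \<or> t = ctimes u v \<and> t' = ctimes u' v'))))"

definition liftTm where "liftTm k x y = IND (stLiftTm k) (pr x y)"

definition stLiftFm where
  "stLiftFm E z \<longleftrightarrow> (\<exists>k. \<exists>p. \<exists>p'. z = pr k (pr p p') \<and>
     ((\<exists>s. \<exists>t. \<exists>s'. \<exists>t'. liftTm k s s' \<and> liftTm k t t' \<and>
         (p = ceq s t \<and> p' = ceq s' t' \<or> p = clt s t \<and> p' = clt s' t')) \<or>
      (\<exists>q. \<exists>q'. E (pr k (pr q q')) \<and> p = cneg q \<and> p' = cneg q') \<or>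
      (\<exists>q. \<exists>r. \<exists>q'. \<exists>r'. E (pr k (pr q q')) \<and> E (pr k (pr r r')) \<and>
         p = cimp q r \<and> p' = cimp q' r') \<or>
      (\<exists>q. \<exists>q'. E (pr (S k) (pr q q')) \<and> p = call q \<and> p' = call q')))"

definition liftFm where "liftFm k x y = IND stLiftFm (pr k (pr x y))"

definition stSubTm where
  "stSubTm k w E z \<longleftrightarrow> (\<exists>t. \<exists>t'. z = pr t t' \<and>
     ((\<exists>i. t = cvar i \<and>
         (i \<lhd> k \<and> t' = cvar i \<or> i = k \<and> t' = w \<or>
          k \<lhd> i \<and> (\<exists>j. i = S j \<and> t' = cvar j))) \<or>
      t = czero \<and> t' = czero \<or>
      (\<exists>u. \<exists>u'. E (pr u u') \<and> t = csuc u \<and> t' = csuc u') \<or>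
      (\<exists>u. \<exists>v. \<exists>u'. \<exists>v'. E (pr u u') \<and> E (pr v v') \<and>
         (t = cplus u v \<and> t' = cplus u' v' \<or> t = ctimes u v \<and> t' = ctimes u' v'))))"

definition subTm where "subTm k w x y = IND (stSubTm k w) (pr x y)"

definition stSubFm where
  "stSubFm E z \<longleftrightarrow> (\<exists>k. \<exists>w. \<exists>p. \<exists>p'. z = pr k (pr w (pr p p')) \<and>
     ((\<exists>s. \<exists>t. \<exists>s'. \<exists>t'. subTm k w s s' \<and> subTm k w t t' \<and>
         (p = ceq s t \<and> p' = ceq s' t' \<or> p = clt s t \<and> p' = clt s' t')) \<or>
      (\<exists>q. \<exists>q'. E (pr k (pr w (pr q q'))) \<and> p = cneg q \<and> p' = cneg q') \<or>
      (\<exists>q. \<exists>r. \<exists>q'. \<exists>r'. E (pr k (pr w (pr q q'))) \<and> E (pr k (pr w (pr r r'))) \<and>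
         p = cimp q r \<and> p' = cimp q' r') \<or>
      (\<exists>q. \<exists>q'. \<exists>w'. liftTm (cd 0) w w' \<and> E (pr (S k) (pr w' (pr q q'))) \<and>
         p = call q \<and> p' = call q')))"

definition subFm where "subFm k w x y = IND stSubFm (pr k (pr w (pr x y)))"

definition stNum where
  "stNum E z \<longleftrightarrow> (\<exists>k. \<exists>t. z = pr k t \<and>
     (k = cd 0 \<and> t = czero \<or> (\<exists>k'. \<exists>t'. k = S k' \<and> E (pr k' t') \<and> t = csuc t')))"

definition isNum where "isNum n x = IND stNum (pr n x)"

definition stPrf where
  "stPrf \<tau> E z \<longleftrightarrow>
     msat M (\<lambda>_. z) \<tau> \<or>
      (\<exists>p. \<exists>q. \<exists>u. isFm p \<and> isFm q \<and> u = cimp q p \<and> z = cimp p u) \<or>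
      (\<exists>p. \<exists>q. \<exists>r. \<exists>qr. \<exists>pqr. \<exists>pq. \<exists>pr. \<exists>u. isFm p \<and> isFm q \<and> isFm r \<and>
         qr = cimp q r \<and> pqr = cimp p qr \<and> pq = cimp p q \<and> pr = cimp p r \<and>
         u = cimp pq pr \<and> z = cimp pqr u) \<or>
      (\<exists>p. \<exists>q. \<exists>np. \<exists>nq. \<exists>u. \<exists>v. isFm p \<and> isFm q \<and> np = cneg p \<and> nq = cneg q \<and>
         u = cimp np nq \<and> v = cimp q p \<and> z = cimp u v) \<or>
      (\<exists>p. \<exists>t. \<exists>ap. \<exists>q. isFm p \<and> isTm t \<and> ap = call p \<and>
         subFm (cd 0) t p q \<and> z = cimp ap q) \<or>
      foldr (\<lambda>\<phi> F. z = cd (gn \<phi>) \<or> F) equality_axioms (cd 0 \<lhd> cd 0) \<or>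
      (\<exists>p. \<exists>u. u = cimp p z \<and> E u \<and> E p) \<or>
      (\<exists>p. \<exists>q. \<exists>q'. \<exists>u. \<exists>ap. isFm q \<and> liftFm (cd 0) q q' \<and> u = cimp q' p \<and> E u \<and>
         ap = call p \<and> z = cimp q ap)"

definition PR where "PR \<tau> = IND (stPrf \<tau>)"

lemma mono_steps: "mono_step stTm" "mono_step stFm" "mono_step (stLiftTm k)" "mono_step stLiftFm"
  "mono_step (stSubTm k w)" "mono_step stSubFm" "mono_step stNum" "mono_step (stPrf \<tau>)"
  unfolding mono_step_def stTm_def stFm_def stLiftTm_def stLiftFm_def stSubTm_def stSubFm_def stNum_def stPrf_def
  by (intro allI, rule impI, (rule imp_refl disj_mono conj_mono ex_mono | erule spec)+)+

lemma dsat_tau: "den c z a \<Longrightarrow> dsat c (\<lambda>d. psubst (\<lambda>_. z d) \<tau>) (msat M (\<lambda>_. a) \<tau>)"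
  by (simp add: den_def dsat_def msat_psubst)

lemma dsat_foldr:
  assumes "den c z a"
  shows "dsat c (foldr (\<lambda>\<phi> F. z \<^bold>= dnum (gn \<phi>) \<^bold>\<or> F) \<phi>s (dnum 0 \<^bold>< dnum 0))
    (foldr (\<lambda>\<phi> F. a = cd (gn \<phi>) \<or> F) \<phi>s (cd 0 \<lhd> cd 0))"
proof (induction \<phi>s)
  case Nil
  show ?case unfolding foldr_Nil id_apply by (intro dsat_dlt den_dnum)
next
  case (Cons \<phi> \<phi>s)
  show ?case unfolding foldr_Cons o_apply by (intro dsat_ddisj dsat_deq den_dnum assms Cons)
qed

lemma mean_IsTm: "mean c IsTm isTm"
  unfolding IsTm_def isTm_def stTm_def[abs_def]
  by (rule mean_Ind, (rule dsat_intros dsat_constructors dsat_mean | assumption | rule den_up, assumption | rule mean_up, assumption)+)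

lemma mean_IsFm: "mean c IsFm isFm"
  unfolding IsFm_def isFm_def stFm_def[abs_def]
  by (rule mean_Ind, (rule dsat_intros dsat_constructors dsat_mean mean_IsTm | assumption | rule den_up, assumption | rule mean_up, assumption)+)

lemma dsat_LiftTm:
  assumes "den c k k'" "den c x a" "den c y b"
  shows "dsat c (LiftTm k x y) (liftTm k' a b)"
  unfolding LiftTm_def liftTm_def
  apply (rule dsat_among2[where P="IND (stLiftTm k')"], rule mean_Ind)
  subgoal for c' E P z a
    unfolding stLiftTm_def
    by (rule dsat_intros dsat_constructors dsat_Tup2 dsat_among2[where P=P and E=E] den_dS assms | assumption | rule den_up, assumption | rule mean_up, assumption)+
  by (rule assms)+

lemma dsat_LiftFm:
  assumes "den c k k'" "den c x a" "den c y b"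
  shows "dsat c (LiftFm k x y) (liftFm k' a b)"
  unfolding LiftFm_def liftFm_def
  apply (rule dsat_among3[where P="IND stLiftFm"], rule mean_Ind)
  subgoal for c' E P z a
    unfolding stLiftFm_def
    by (rule dsat_intros dsat_constructors dsat_Tup3 dsat_among3[where P=P and E=E] dsat_LiftTm den_dS assms | assumption | rule den_up, assumption | rule mean_up, assumption)+
  by (rule assms)+

lemma dsat_SubTm:
  assumes "den c k k'" "den c w w'" "den c x a" "den c y b"
  shows "dsat c (SubTm k w x y) (subTm k' w' a b)"
  unfolding SubTm_def subTm_def
  apply (rule dsat_among2[where P="IND (stSubTm k' w')"], rule mean_Ind)
  subgoal for c' E P z a
    unfolding stSubTm_def
    by (rule dsat_intros dsat_constructors dsat_Tup2 dsat_among2[where P=P and E=E] den_dS assms | assumption | rule den_up, assumption | rule mean_up, assumption)+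
  by (rule assms)+

lemma dsat_SubFm:
  assumes "den c k k'" "den c w w'" "den c x a" "den c y b"
  shows "dsat c (SubFm k w x y) (subFm k' w' a b)"
  unfolding SubFm_def subFm_def
  apply (rule dsat_among4[where P="IND stSubFm"], rule mean_Ind)
  subgoal for c' E P z a
    unfolding stSubFm_def
    by (rule dsat_intros dsat_constructors dsat_Tup4 dsat_among4[where P=P and E=E] dsat_SubTm dsat_LiftTm den_dS den_dnum assms | assumption | rule den_up, assumption | rule mean_up, assumption)+
  by (rule assms)+

lemma dsat_NumCode:
  assumes "den c x a" "den c y b"
  shows "dsat c (NumCode x y) (isNum a b)"
  unfolding NumCode_def isNum_def
  apply (rule dsat_among2[where P="IND stNum"], rule mean_Ind)
  subgoal for c' E P z a
    unfolding stNum_def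
    by (rule dsat_intros dsat_constructors dsat_Tup2 dsat_among2[where P=P and E=E] den_dS den_dnum assms | assumption | rule den_up, assumption | rule mean_up, assumption)+
  by (rule assms)+

lemma mean_Pr: "mean c (Pr \<tau>) (PR \<tau>)"
proof -
  have "mean c (\<lambda>x. Ind (PrfStep \<tau>) x) (PR \<tau>)"
    unfolding PR_def
  proof (rule mean_Ind)
    fix c' E P z a
    assume "mean c' E P" "den c' z a"
    then show "dsat c' (PrfStep \<tau> E z) (stPrf \<tau> P a)"
      unfolding PrfStep_def stPrf_def
      by - ((rule dsat_tau dsat_foldr dsat_intros dsat_constructors dsat_LiftFm dsat_SubFm mean_IsFm mean_IsTm den_dnum
        | assumption | rule dsat_mean | rule den_up, assumption | rule mean_up, assumption)+)
  qed
  then show ?thesis by (simp only: Pr_def[abs_def])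
qed

end

section \<open>The formulas of the arithmetization are \<open>\<Sigma>\<^sub>1\<close>\<close>

definition dsig :: "dfm \<Rightarrow> bool" where
  "dsig F \<longleftrightarrow> (\<forall>d. sigma_fm (F d))"

lemma dsig_atomic: "dsig (x \<^bold>= y)" "dsig (x \<^bold>< y)" "dsig (\<^bold>\<not> (x \<^bold>< y))"
  unfolding dsig_def deq_def dlt_def dneg_def by (auto intro!: sigma_delta0 delta0.intros)

lemma dsig_dconj: "dsig F \<Longrightarrow> dsig G \<Longrightarrow> dsig (F \<^bold>\<and> G)"
  unfolding dsig_def dconj_def by (auto intro: sigma_Conj)

lemma dsig_ddisj: "dsig F \<Longrightarrow> dsig G \<Longrightarrow> dsig (F \<^bold>\<or> G)"
  unfolding dsig_def ddisj_def by (auto intro: sigma_Disj)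

lemma dsig_dex: "(\<And>x. dsig (F x)) \<Longrightarrow> dsig (dex F)"
  unfolding dsig_def dex_def by (auto intro: sigma_Exists)

lemma dsig_Beta: "dsig (Beta a b i x)"
  unfolding Beta_def by (intro dsig_dconj dsig_dex dsig_atomic)

lemma dsig_Ind:
  assumes "\<And>E z. (\<And>y. dsig (E y)) \<Longrightarrow> dsig (Step E z)"
  shows "dsig (Ind Step x)"
  unfolding Ind_def
proof (rule dsig_dex, rule dsig_dex)
  fix a b
  let ?G = "\<lambda>l i. \<^bold>\<exists>y. Beta a b i y \<^bold>\<and> Step (\<lambda>z. \<^bold>\<exists>j. j \<^bold>< i \<^bold>\<and> Beta a b j z) y"
  have G: "dsig (?G l i)" for l i
    by (intro dsig_dex dsig_dconj dsig_Beta assms dsig_atomic)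
  \<comment> \<open>\<open>sigma_Ball\<close> wants a lifted term as bound: l is the innermost
    existential variable, hence index 1 below the bounded quantifier, which is the lifting of
    \<open>Var 0\<close>.\<close>
  have "sigma_fm (dallb (dS (\<lambda>d'. Var (d' - Suc d))) (?G l) (Suc d))" for d l
    using sigma_Ball[of "?G l (\<lambda>d'. Var (d' - Suc (Suc d))) (Suc (Suc d))" "Succ (Var 0)"] G
    by (simp add: dallb_def dS_def dsig_def)
  then show "dsig (\<^bold>\<exists>l. Beta a b l x \<^bold>\<and> dallb (dS l) (?G l))"
    using dsig_Beta unfolding dsig_def dex_def dconj_def by (intro allI sigma_Exists sigma_Conj) auto
qed

lemma dsig_Tup: "dsig (Tup xs z)"
  by (induction xs z rule: Tup.induct) (simp_all add: dsig_atomic dsig_dex dsig_dconj dPair_def)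

lemma dsig_among: "(\<And>y. dsig (E y)) \<Longrightarrow> dsig (among E xs)"
  unfolding among_def by (intro dsig_dex dsig_dconj dsig_Tup)

lemma dsig_constructors: "dsig (cVar i z)" "dsig (cZero z)" "dsig (cSucc s z)" "dsig (cPlus s t z)"
  "dsig (cTimes s t z)" "dsig (cEq s t z)" "dsig (cLt s t z)" "dsig (cNeg s z)" "dsig (cImp s t z)" "dsig (cAll s z)"
  unfolding cVar_def cZero_def cSucc_def cPlus_def cTimes_def cEq_def cLt_def cNeg_def cImp_def cAll_def
  by (rule dsig_Tup)+

lemmas dsig_intros = dsig_atomic dsig_dconj dsig_ddisj dsig_dex dsig_Tup dsig_constructors dsig_among

lemma dsig_IsTm: "dsig (IsTm z)"
  unfolding IsTm_def by (rule dsig_Ind, intro dsig_intros)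

lemma dsig_IsFm: "dsig (IsFm z)"
  unfolding IsFm_def by (rule dsig_Ind, intro dsig_intros dsig_IsTm)

lemma dsig_LiftTm: "dsig (LiftTm k x y)"
  unfolding LiftTm_def by (rule dsig_among, rule dsig_Ind, intro dsig_intros)

lemma dsig_LiftFm: "dsig (LiftFm k x y)"
  unfolding LiftFm_def by (rule dsig_among, rule dsig_Ind, intro dsig_intros dsig_LiftTm)

lemma dsig_SubTm: "dsig (SubTm k w x y)"
  unfolding SubTm_def by (rule dsig_among, rule dsig_Ind, intro dsig_intros)

lemma dsig_SubFm: "dsig (SubFm k w x y)"
  unfolding SubFm_def by (rule dsig_among, rule dsig_Ind, intro dsig_intros dsig_SubTm dsig_LiftTm)

lemma dsig_NumCode: "dsig (NumCode x y)"
  unfolding NumCode_def by (rule dsig_among, rule dsig_Ind, intro dsig_intros)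

lemma dsig_psubst: "sigma_fm \<tau> \<Longrightarrow> dsig (\<lambda>d. psubst (\<sigma> d) \<tau>)"
  by (simp add: dsig_def sigma_psubst)

lemma dsig_foldr: "dsig (foldr (\<lambda>\<phi> F. z \<^bold>= dnum (gn \<phi>) \<^bold>\<or> F) \<phi>s (x \<^bold>< y))"
  by (induction \<phi>s) (auto intro: dsig_intros)

lemma dsig_Pr: "sigma_fm \<tau> \<Longrightarrow> dsig (Pr \<tau> x)"
  unfolding Pr_def PrfStep_def
  by (rule dsig_Ind, intro dsig_intros dsig_psubst dsig_foldr dsig_IsFm dsig_IsTm dsig_LiftFm dsig_SubFm)

lemma dsig_quote_tm: "dsig (quote_tm n t y)"
  by (induction n t y rule: quote_tm.induct) (auto intro!: dsig_intros dsig_NumCode)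

lemma dsig_quote_fm: "dsig (quote_fm n \<phi> y)"
  by (induction n \<phi> y rule: quote_fm.induct) (auto intro!: dsig_intros dsig_quote_tm)

lemma sigma_Pr_dot: "sigma1 \<tau> \<Longrightarrow> sigma_fm (Pr_dot \<tau> \<phi>)"
proof -
  assume "sigma1 \<tau>"
  then have "dsig (\<^bold>\<exists>y. quote_fm 0 \<phi> y \<^bold>\<and> Pr \<tau> y)"
    by (intro dsig_intros dsig_quote_fm dsig_Pr sigma1_sigma_fm)
  then show ?thesis by (simp add: dsig_def Pr_dot_def)
qed

section \<open>Codes of terms and formulas\<close>

context isig
begin

lemma dsat_msat: "dsat (d, e) F P \<Longrightarrow> msat M e (F d) = P"
  unfolding dsat_def using ext_refl by blast

lemma SD_dsig:
  assumes "dsig F" "\<And>e. dsat (0, e) F (R e)"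
  shows "SD M R"
proof -
  have "SD M (\<lambda>e. msat M e (F 0))"
    by (rule SD_fm) (use assms(1) in \<open>auto simp: dsig_def intro: TD_intros\<close>)
  then show ?thesis using dsat_msat[OF assms(2)] by simp
qed

lemma SD_isTm: "SD M (\<lambda>e. isTm (e i))"
  by (rule SD_dsig[OF dsig_IsTm[of "free i"]]) (rule dsat_mean[OF mean_IsTm den_free])

lemma SD_isNum: "SD M (\<lambda>e. isNum (e i) (e j))"
  by (rule SD_dsig[OF dsig_NumCode[of "free i" "free j"]]) (intro dsat_NumCode den_free)

lemma SD_liftTm: "SD M (\<lambda>e. liftTm (e i) (e j) (e l))"
  by (rule SD_dsig[OF dsig_LiftTm[of "free i" "free j" "free l"]]) (intro dsat_LiftTm den_free)

lemma SD_subTm: "SD M (\<lambda>e. subTm (e i) (e j) (e l) (e m))"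
  by (rule SD_dsig[OF dsig_SubTm[of "free i" "free j" "free l" "free m"]]) (intro dsat_SubTm den_free)

section \<open>Numerals and quotation\<close>

lemma isNum_zero: "isNum \<zero> x \<longleftrightarrow> x = czero"
proof
  assume "isNum \<zero> x"
  from IND_unfold[OF mono_steps(7) this[unfolded isNum_def]] show "x = czero"
    by (auto simp: stNum_def)
next
  assume "x = czero"
  then show "isNum \<zero> x" unfolding isNum_def
    by (intro IND_intro0 mono_steps) (auto simp: stNum_def cd.simps)
qed

lemma isNum_Suc: "isNum (S a) x \<longleftrightarrow> (\<exists>t. isNum a t \<and> x = csuc t)"
proof
  assume "isNum (S a) x"
  from IND_unfold[OF mono_steps(7) this[unfolded isNum_def]] show "\<exists>t. isNum a t \<and> x = csuc t"
    by (auto simp: stNum_def isNum_def cd.simps)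
next
  assume "\<exists>t. isNum a t \<and> x = csuc t"
  then obtain t where t: "IND stNum (pr a t)" "x = csuc t" by (auto simp: isNum_def)
  show "isNum (S a) x" unfolding isNum_def
    by (rule IND_intro1[OF mono_steps(7) t(1)]) (auto simp: stNum_def t(2))
qed

lemma isNum_ex: "\<exists>x. isNum a x"
proof (induction a rule: SD_induction)
  case 1
  show ?case by (intro SDs SD_isNum)
qed (auto simp: isNum_zero isNum_Suc)

text \<open>Uniqueness is a \<Pi>1 statement, hence \<open>PD_induction\<close>.\<close>

lemma isNum_unique: "isNum a x \<Longrightarrow> isNum a y \<Longrightarrow> x = y"
proof -
  have "\<forall>x y. isNum a x \<and> isNum a y \<longrightarrow> x = y"
  proof (induction a rule: PD_induction)
    case 1
    have "SD M (\<lambda>e. \<exists>x y. isNum (e 0) x \<and> isNum (e 0) y \<and> x \<noteq> y)"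
      by (intro SDs SD_delta DDs TD_intros SD_isNum)
    then show ?case by simp
  qed (auto simp: isNum_zero isNum_Suc)
  then show "isNum a x \<Longrightarrow> isNum a y \<Longrightarrow> x = y" by blast
qed

definition numc :: "'a \<Rightarrow> 'a" where "numc a = (THE x. isNum a x)"

lemma isNum_iff: "isNum a x \<longleftrightarrow> x = numc a"
  unfolding numc_def using isNum_ex isNum_unique by (metis theI)

lemma numc_zero: "numc \<zero> = czero"
  using isNum_zero isNum_iff by blast

lemma numc_Suc: "numc (S a) = csuc (numc a)"
  using isNum_Suc[of a "csuc (numc a)"] isNum_iff by metis

lemma numc_induct:
  assumes "SD M (\<lambda>e. Q (e 0))" "Q czero" "\<And>x. Q x \<Longrightarrow> Q (csuc x)"
  shows "Q (numc a)"
proof -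
  have "\<exists>x. isNum a x \<and> Q x"
  proof (induction a rule: SD_induction)
    case 1
    show ?case by (intro SDs SD_isNum assms(1))
  qed (use assms in \<open>auto simp: isNum_iff numc_zero numc_Suc\<close>)
  then show ?thesis by (simp add: isNum_iff)
qed

text \<open>The code in \<open>M\<close> that \<open>quote_tm\<close> describes. The values of e may
  be nonstandard, and then so are the numerals inside the code.\<close>

fun qt :: "nat \<Rightarrow> tm \<Rightarrow> (nat \<Rightarrow> 'a) \<Rightarrow> 'a" where
  "qt n (Var i) e = (if i < n then cvar (cd i) else numc (e (i - n)))"
| "qt n Zero e = czero"
| "qt n (Succ t) e = csuc (qt n t e)"
| "qt n (Plus s t) e = cplus (qt n s e) (qt n t e)"
| "qt n (Times s t) e = ctimes (qt n s e) (qt n t e)"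

fun qf :: "nat \<Rightarrow> fm \<Rightarrow> (nat \<Rightarrow> 'a) \<Rightarrow> 'a" where
  "qf n (Eq s t) e = ceq (qt n s e) (qt n t e)"
| "qf n (Lt s t) e = clt (qt n s e) (qt n t e)"
| "qf n (Neg \<phi>) e = cneg (qf n \<phi> e)"
| "qf n (Imp \<phi> \<psi>) e = cimp (qf n \<phi> e) (qf n \<psi> e)"
| "qf n (Forall \<phi>) e = call (qf (Suc n) \<phi> e)"

lemma dsat_quote_tm: "ext (0, e) c \<Longrightarrow> den c y v \<Longrightarrow> dsat c (quote_tm n t y) (v = qt n t e)"
proof (induction t arbitrary: c y v)
  case (Var i)
  have "den c (free j) (e j)" for j using den_up[OF Var(1) den_free] .
  then show ?case using Var(2) by (auto simp flip: isNum_iff intro: dsat_NumCode dsat_constructors den_dnum)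
next
  case Zero
  then show ?case by (auto intro: dsat_constructors)
next
  case (Succ t)
  have "dsat c (quote_tm n (Succ t) y) (\<exists>u. u = qt n t e \<and> v = csuc u)"
    unfolding quote_tm.simps using Succ.prems
    by (intro dsat_intros dsat_constructors Succ.IH) (auto intro: ext_trans den_up)
  then show ?case by simp
next
  case (Plus s t)
  have "dsat c (quote_tm n (Plus s t) y) (\<exists>u. \<exists>w. u = qt n s e \<and> w = qt n t e \<and> v = cplus u w)"
    unfolding quote_tm.simps using Plus.prems
    by (intro dsat_intros dsat_constructors Plus.IH) (auto intro: ext_trans den_up)
  then show ?case by simp
next
  case (Times s t)
  have "dsat c (quote_tm n (Times s t) y) (\<exists>u. \<exists>w. u = qt n s e \<and> w = qt n t e \<and> v = ctimes u w)"
    unfolding quote_tm.simps using Times.prems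
    by (intro dsat_intros dsat_constructors Times.IH) (auto intro: ext_trans den_up)
  then show ?case by simp
qed

lemma dsat_quote_fm: "ext (0, e) c \<Longrightarrow> den c y v \<Longrightarrow> dsat c (quote_fm n \<phi> y) (v = qf n \<phi> e)"
proof (induction \<phi> arbitrary: n c y v)
  case (Eq s t)
  have "dsat c (quote_fm n (Eq s t) y) (\<exists>u. \<exists>w. u = qt n s e \<and> w = qt n t e \<and> v = ceq u w)"
    unfolding quote_fm.simps using Eq.prems
    by (intro dsat_intros dsat_constructors dsat_quote_tm) (auto intro: ext_trans den_up)
  then show ?case by simp
next
  case (Lt s t)
  have "dsat c (quote_fm n (Lt s t) y) (\<exists>u. \<exists>w. u = qt n s e \<and> w = qt n t e \<and> v = clt u w)"
    unfolding quote_fm.simps using Lt.prems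
    by (intro dsat_intros dsat_constructors dsat_quote_tm) (auto intro: ext_trans den_up)
  then show ?case by simp
next
  case (Neg \<phi>)
  have "dsat c (quote_fm n (Neg \<phi>) y) (\<exists>u. u = qf n \<phi> e \<and> v = cneg u)"
    unfolding quote_fm.simps using Neg.prems
    by (intro dsat_intros dsat_constructors Neg.IH) (auto intro: ext_trans den_up)
  then show ?case by simp
next
  case (Imp \<phi> \<psi>)
  have "dsat c (quote_fm n (Imp \<phi> \<psi>) y) (\<exists>u. \<exists>w. u = qf n \<phi> e \<and> w = qf n \<psi> e \<and> v = cimp u w)"
    unfolding quote_fm.simps using Imp.prems
    by (intro dsat_intros dsat_constructors Imp.IH) (auto intro: ext_trans den_up)
  then show ?case by simp
next
  case (Forall \<phi>)
  have "dsat c (quote_fm n (Forall \<phi>) y) (\<exists>u. u = qf (Suc n) \<phi> e \<and> v = call u)"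
    unfolding quote_fm.simps using Forall.prems
    by (intro dsat_intros dsat_constructors Forall.IH) (auto intro: ext_trans den_up)
  then show ?case by simp
qed

lemma msat_Pr_dot: "msat M e (Pr_dot \<tau> \<phi>) \<longleftrightarrow> PR \<tau> (qf 0 \<phi> e)"
proof -
  have "dsat (0, e) (\<^bold>\<exists>y. quote_fm 0 \<phi> y \<^bold>\<and> Pr \<tau> y) (\<exists>y. y = qf 0 \<phi> e \<and> PR \<tau> y)"
    by (intro dsat_intros dsat_quote_fm dsat_mean[OF mean_Pr])
  then show ?thesis unfolding Pr_dot_def using dsat_msat by simp
qed

lemma qt_gn: "fv_tm t \<subseteq> {..<n} \<Longrightarrow> qt n t e = cd (gn_tm t)"
  by (induction t) (auto simp: cd_pr)

lemma qf_gn: "fv \<phi> \<subseteq> {..<n} \<Longrightarrow> qf n \<phi> e = cd (gn \<phi>)"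
proof (induction \<phi> arbitrary: n)
  case (Forall \<phi>)
  have "fv \<phi> \<subseteq> {..<Suc n}"
  proof
    fix i assume "i \<in> fv \<phi>"
    then show "i \<in> {..<Suc n}" using Forall.prems by (cases i) auto
  qed
  then show ?case using Forall.IH by (simp add: cd_pr)
qed (auto simp: cd_pr qt_gn)

lemma qt_psubst:
  assumes "\<And>i. qt n (\<sigma> i) e = (if i < n then cvar (cd i) else numc (e' (i - n)))"
  shows "qt n (psubst_tm \<sigma> t) e = qt n t e'"
  by (induction t) (use assms in auto)

lemma qt_lift: "qt (Suc n) (lift_tm 0 t) e = qt n t e \<or> fv_tm t \<inter> {..<n} \<noteq> {}"
  by (induction t) auto

text \<open>Quotation turns a sum into the code of a sum and not into the code of a numeral. The
  hypothesis therefore restricts the substitution to terms that quote to numeral codes, such as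
  variables, zero and successors of these.\<close>

lemma qf_psubst:
  assumes "\<And>i. if i < n then \<sigma> i = Var i else (qt n (\<sigma> i) e = numc (e' (i - n)) \<and> fv_tm (\<sigma> i) \<inter> {..<n} = {})"
  shows "qf n (psubst \<sigma> \<phi>) e = qf n \<phi> e'"
  using assms
proof (induction \<phi> arbitrary: n \<sigma>)
  case (Forall \<phi>)
  have "qf (Suc n) (psubst (up \<sigma>) \<phi>) e = qf (Suc n) \<phi> e'"
  proof (rule Forall.IH)
    fix i
    show "if i < Suc n then up \<sigma> i = Var i
      else qt (Suc n) (up \<sigma> i) e = numc (e' (i - Suc n)) \<and> fv_tm (up \<sigma> i) \<inter> {..<Suc n} = {}"
    proof (cases i)
      case (Suc j)
      then show ?thesis using Forall.prems[of j] qt_lift[of n "\<sigma> j" e] by (auto simp: fv_lift_tm_0)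
    qed simp
  qed
  then show ?case by simp
next
  case (Eq s t)
  have "qt n (\<sigma> i) e = (if i < n then cvar (cd i) else numc (e' (i - n)))" for i
    using Eq.prems[of i] by auto
  then show ?case by (simp add: qt_psubst)
next
  case (Lt s t)
  have "qt n (\<sigma> i) e = (if i < n then cvar (cd i) else numc (e' (i - n)))" for i
    using Lt.prems[of i] by auto
  then show ?case by (simp add: qt_psubst)
qed auto

lemma qf0_psubst: "(\<And>i. qt 0 (\<sigma> i) e = numc (e' i)) \<Longrightarrow> qf 0 (psubst \<sigma> \<phi>) e = qf 0 \<phi> e'"
  by (rule qf_psubst) auto

section \<open>Lifting and substitution on codes\<close>

lemma isTm_intros: "isTm (cvar i)" "isTm czero" "isTm t \<Longrightarrow> isTm (csuc t)"
  "isTm s \<Longrightarrow> isTm t \<Longrightarrow> isTm (cplus s t)" "isTm s \<Longrightarrow> isTm t \<Longrightarrow> isTm (ctimes s t)"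
  unfolding isTm_def
  subgoal by (rule IND_intro0[OF mono_steps(1)]) (simp add: stTm_def)
  subgoal by (rule IND_intro0[OF mono_steps(1)]) (simp add: stTm_def)
  subgoal by (erule IND_intro1[OF mono_steps(1)]) (simp add: stTm_def)
  subgoal by (erule (1) IND_intro2[OF mono_steps(1)]) (auto simp: stTm_def)
  subgoal by (erule (1) IND_intro2[OF mono_steps(1)]) (auto simp: stTm_def)
  done

lemma isFm_intros: "isTm s \<Longrightarrow> isTm t \<Longrightarrow> isFm (ceq s t)" "isTm s \<Longrightarrow> isTm t \<Longrightarrow> isFm (clt s t)"
  "isFm p \<Longrightarrow> isFm (cneg p)" "isFm p \<Longrightarrow> isFm q \<Longrightarrow> isFm (cimp p q)" "isFm p \<Longrightarrow> isFm (call p)"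
  unfolding isFm_def
  subgoal by (rule IND_intro0[OF mono_steps(2)]) (simp add: stFm_def)
  subgoal by (rule IND_intro0[OF mono_steps(2)]) (simp add: stFm_def)
  subgoal by (erule IND_intro1[OF mono_steps(2)]) (simp add: stFm_def)
  subgoal by (erule (1) IND_intro2[OF mono_steps(2)]) (auto simp: stFm_def)
  subgoal by (erule IND_intro1[OF mono_steps(2)]) (simp add: stFm_def)
  done

lemma isTm_numc: "isTm (numc a)"
  by (rule numc_induct[OF SD_isTm]) (auto intro: isTm_intros)

lemma isTm_qt: "isTm (qt n t e)"
  by (induction t) (auto intro: isTm_intros isTm_numc)

lemma isFm_qf: "isFm (qf n \<phi> e)"
  by (induction \<phi> arbitrary: n) (auto intro: isFm_intros isTm_qt)

lemma liftTm_intros: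
  "i \<lhd> k \<Longrightarrow> liftTm k (cvar i) (cvar i)" "\<not> i \<lhd> k \<Longrightarrow> liftTm k (cvar i) (cvar (S i))"
  "liftTm k czero czero" "liftTm k u u' \<Longrightarrow> liftTm k (csuc u) (csuc u')"
  "liftTm k u u' \<Longrightarrow> liftTm k v v' \<Longrightarrow> liftTm k (cplus u v) (cplus u' v')"
  "liftTm k u u' \<Longrightarrow> liftTm k v v' \<Longrightarrow> liftTm k (ctimes u v) (ctimes u' v')"
  unfolding liftTm_def
  subgoal by (rule IND_intro0[OF mono_steps(3)]) (simp add: stLiftTm_def)
  subgoal by (rule IND_intro0[OF mono_steps(3)]) (simp add: stLiftTm_def)
  subgoal by (rule IND_intro0[OF mono_steps(3)]) (simp add: stLiftTm_def)
  subgoal by (erule IND_intro1[OF mono_steps(3)]) (simp add: stLiftTm_def)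
  subgoal by (erule (1) IND_intro2[OF mono_steps(3)]) (auto simp: stLiftTm_def)
  subgoal by (erule (1) IND_intro2[OF mono_steps(3)]) (auto simp: stLiftTm_def)
  done

lemma liftFm_intros:
  "liftTm k s s' \<Longrightarrow> liftTm k t t' \<Longrightarrow> liftFm k (ceq s t) (ceq s' t')"
  "liftTm k s s' \<Longrightarrow> liftTm k t t' \<Longrightarrow> liftFm k (clt s t) (clt s' t')"
  "liftFm k p p' \<Longrightarrow> liftFm k (cneg p) (cneg p')"
  "liftFm k p p' \<Longrightarrow> liftFm k q q' \<Longrightarrow> liftFm k (cimp p q) (cimp p' q')"
  "liftFm (S k) p p' \<Longrightarrow> liftFm k (call p) (call p')"
  unfolding liftFm_def
  subgoal by (rule IND_intro0[OF mono_steps(4)]) (simp add: stLiftFm_def)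
  subgoal by (rule IND_intro0[OF mono_steps(4)]) (simp add: stLiftFm_def)
  subgoal by (erule IND_intro1[OF mono_steps(4)]) (simp add: stLiftFm_def)
  subgoal by (erule (1) IND_intro2[OF mono_steps(4)]) (auto simp: stLiftFm_def)
  subgoal by (erule IND_intro1[OF mono_steps(4)]) (simp add: stLiftFm_def)
  done

lemma subTm_intros:
  "i \<lhd> k \<Longrightarrow> subTm k w (cvar i) (cvar i)" "subTm k w (cvar k) w" "k \<lhd> S i \<Longrightarrow> subTm k w (cvar (S i)) (cvar i)"
  "subTm k w czero czero" "subTm k w u u' \<Longrightarrow> subTm k w (csuc u) (csuc u')"
  "subTm k w u u' \<Longrightarrow> subTm k w v v' \<Longrightarrow> subTm k w (cplus u v) (cplus u' v')"
  "subTm k w u u' \<Longrightarrow> subTm k w v v' \<Longrightarrow> subTm k w (ctimes u v) (ctimes u' v')"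
  unfolding subTm_def
  subgoal by (rule IND_intro0[OF mono_steps(5)]) (simp add: stSubTm_def)
  subgoal by (rule IND_intro0[OF mono_steps(5)]) (simp add: stSubTm_def)
  subgoal by (rule IND_intro0[OF mono_steps(5)]) (simp add: stSubTm_def)
  subgoal by (rule IND_intro0[OF mono_steps(5)]) (simp add: stSubTm_def)
  subgoal by (erule IND_intro1[OF mono_steps(5)]) (simp add: stSubTm_def)
  subgoal by (erule (1) IND_intro2[OF mono_steps(5)]) (auto simp: stSubTm_def)
  subgoal by (erule (1) IND_intro2[OF mono_steps(5)]) (auto simp: stSubTm_def)
  done

lemma subFm_intros:
  "subTm k w s s' \<Longrightarrow> subTm k w t t' \<Longrightarrow> subFm k w (ceq s t) (ceq s' t')"
  "subTm k w s s' \<Longrightarrow> subTm k w t t' \<Longrightarrow> subFm k w (clt s t) (clt s' t')"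
  "subFm k w p p' \<Longrightarrow> subFm k w (cneg p) (cneg p')"
  "subFm k w p p' \<Longrightarrow> subFm k w q q' \<Longrightarrow> subFm k w (cimp p q) (cimp p' q')"
  "liftTm (cd 0) w w' \<Longrightarrow> subFm (S k) w' p p' \<Longrightarrow> subFm k w (call p) (call p')"
  unfolding subFm_def
  subgoal by (rule IND_intro0[OF mono_steps(6)]) (simp add: stSubFm_def)
  subgoal by (rule IND_intro0[OF mono_steps(6)]) (simp add: stSubFm_def)
  subgoal by (erule IND_intro1[OF mono_steps(6)]) (simp add: stSubFm_def)
  subgoal by (erule (1) IND_intro2[OF mono_steps(6)]) (auto simp: stSubFm_def)
  subgoal by (erule IND_intro1[OF mono_steps(6)]) (simp add: stSubFm_def)
  done

text \<open>Numerals are closed terms, but they may be nonstandard, so this takes \<Sigma>1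
  induction in \<open>M\<close>.\<close>

lemma liftTm_numc: "liftTm k (numc a) (numc a)"
proof (rule numc_induct)
  have "SD M (\<lambda>e. \<exists>l. l = k \<and> liftTm l (e 0) (e 0))"
    using SD_liftTm[of 0 1 1] by (intro SD_ex SD_conj) (auto intro!: SD_delta[OF DD_eq] TD_intros)
  then show "SD M (\<lambda>e. liftTm k (e 0) (e 0))" by simp
qed (auto intro: liftTm_intros)

lemma subTm_numc: "subTm k w (numc a) (numc a)"
proof (rule numc_induct)
  have "SD M (\<lambda>e. \<exists>l v. l = k \<and> v = w \<and> subTm l v (e 0) (e 0))"
    using SD_subTm[of 1 0 2 2]
    by (intro SD_ex SD_conj) (auto simp: numeral_2_eq_2 intro!: SD_delta[OF DD_eq] TD_intros)
  then show "SD M (\<lambda>e. subTm k w (e 0) (e 0))" by simp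
qed (auto intro: subTm_intros)

lemma subTm_qt: "subTm (cd k) (numc a) (qt (Suc k) t e) (qt k t (a ## e))"
proof (induction t)
  case (Var i)
  consider "i < k" | "i = k" | "i > k" by linarith
  then show ?case
  proof cases
    case 1
    then show ?thesis by (auto intro: subTm_intros simp: cd_less)
  next
    case 2
    then show ?thesis by (auto intro: subTm_intros)
  next
    case 3
    then have "(a ## e) (i - k) = e (i - Suc k)" by (auto simp: less_iff_Suc_add)
    then show ?thesis using 3 by (auto intro: subTm_numc)
  qed
qed (auto intro: subTm_intros)

text \<open>Numerals are unaffected by lifting, so the substituted code stays the same below
  quantifiers. This is what leads from a quoted universal formula to its numeral instances.\<close>

lemma subFm_qf: "subFm (cd k) (numc a) (qf (Suc k) \<phi> e) (qf k \<phi> (a ## e))"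
proof (induction \<phi> arbitrary: k)
  case (Forall \<phi>)
  show ?case using Forall[of "Suc k"] by (auto intro: subFm_intros liftTm_numc simp: cd.simps)
qed (auto intro: subFm_intros subTm_qt)

lemma liftTm_gn: "liftTm (cd k) (cd (gn_tm t)) (cd (gn_tm (lift_tm k t)))"
  by (induction t) (auto simp: cd_pr cd_less intro: liftTm_intros liftTm_intros(2)[of "cd i" for i, folded cd.simps])

lemma liftFm_gn: "liftFm (cd k) (cd (gn \<phi>)) (cd (gn (lift k \<phi>)))"
  by (induction \<phi> arbitrary: k) (auto simp: cd_pr intro: liftFm_intros liftTm_gn simp flip: cd.simps)

lemma subTm_gn: "subTm (cd k) (cd (gn_tm u)) (cd (gn_tm t)) (cd (gn_tm (sub_tm k u t)))"
proof (induction t)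
  case (Var i)
  show ?case
  proof (cases i)
    case (Suc j)
    have "subTm (cd k) w (cvar (cd (Suc j))) (cvar (cd j))" if "k < Suc j" for w
      using subTm_intros(3)[of "cd k" "cd j" w] that cd_less[of k "Suc j"] by (simp add: cd.simps)
    then show ?thesis using Suc by (auto simp: cd_pr cd_less intro: subTm_intros)
  qed (auto simp: cd_pr cd_less intro: subTm_intros)
qed (auto simp: cd_pr intro: subTm_intros)

lemma subFm_gn: "subFm (cd k) (cd (gn_tm u)) (cd (gn \<phi>)) (cd (gn (sub k u \<phi>)))"
proof (induction \<phi> arbitrary: k u)
  case (Forall \<phi>)
  show ?case using Forall[of "Suc k" "lift_tm 0 u"] liftTm_gn[of 0 u]
    by (auto simp: cd_pr cd.simps(2) intro: subFm_intros)
qed (auto simp: cd_pr intro: subFm_intros subTm_gn)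

section \<open>Derivability conditions\<close>

lemma isTm_gn: "isTm (cd (gn_tm t))"
proof -
  obtain n where "fv_tm t \<subseteq> {..<n}" using finite_nat_iff_bounded[of "fv_tm t"] by auto
  then show ?thesis using isTm_qt[of n t undefined] by (simp add: qt_gn)
qed

lemma isFm_gn: "isFm (cd (gn \<phi>))"
proof -
  obtain n where "fv \<phi> \<subseteq> {..<n}" by (rule fv_bounded)
  then show ?thesis using isFm_qf[of n \<phi> undefined] by (simp add: qf_gn)
qed

lemma PR_intro0: "stPrf \<tau> (\<lambda>_. False) z \<Longrightarrow> PR \<tau> z"
  unfolding PR_def by (rule IND_intro0[OF mono_steps(8)])

lemma PR_mp: "PR \<tau> (cimp p q) \<Longrightarrow> PR \<tau> p \<Longrightarrow> PR \<tau> q"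
  unfolding PR_def by (erule (1) IND_intro2[OF mono_steps(8)]) (unfold stPrf_def, blast)

lemma PR_all: "isFm p \<Longrightarrow> isTm t \<Longrightarrow> subFm (cd 0) t p q \<Longrightarrow> PR \<tau> (cimp (call p) q)"
  by (rule PR_intro0) (auto simp: stPrf_def)

lemma PR_inst: "PR \<tau> (qf 0 (Forall \<phi>) e) \<Longrightarrow> PR \<tau> (qf 0 \<phi> (a ## e))"
  using PR_mp[OF PR_all[OF isFm_qf isTm_numc subFm_qf]] by simp

lemma PR_foralls: "PR \<tau> (qf 0 ((Forall ^^ n) \<phi>) (\<lambda>i. e (i + n))) \<Longrightarrow> PR \<tau> (qf 0 \<phi> e)"
proof (induction n arbitrary: e)
  case (Suc n)
  have "e n ## (\<lambda>i. e (i + Suc n)) = (\<lambda>i. e (i + n))"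
    by (auto simp: fun_eq_iff split: nat.split)
  then show ?case using PR_inst[of \<tau> "(Forall ^^ n) \<phi>" _ "e n"] Suc by (metis funpow.simps(2) o_apply)
qed simp

lemma foldr_disj: "foldr (\<lambda>\<phi> F. P \<phi> \<or> F) \<phi>s X \<longleftrightarrow> (\<exists>\<phi>\<in>set \<phi>s. P \<phi>) \<or> X"
  by (induction \<phi>s) auto

text \<open>An actual derivation is replayed rule by rule in \<open>M\<close>; the hypothesis on
  \<tau> covers the axioms of the theory.\<close>

lemma PR_provable:
  assumes "T \<turnstile> \<phi>" and "\<And>\<psi>. \<psi> \<in> T \<Longrightarrow> msat M (\<lambda>_. cd (gn \<psi>)) \<tau>"
  shows "PR \<tau> (cd (gn \<phi>))"
  using assms(1)
proof (induction rule: proves.induct)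
  case (ax \<phi>)
  then show ?case using assms(2) by (intro PR_intro0) (simp add: stPrf_def)
next
  case (ax_K \<phi> \<psi>)
  show ?case by (rule PR_intro0) (simp add: stPrf_def cd_pr isFm_gn)
next
  case (ax_S \<phi> \<psi> \<chi>)
  show ?case by (rule PR_intro0) (simp add: stPrf_def cd_pr isFm_gn)
next
  case (ax_N \<phi> \<psi>)
  show ?case by (rule PR_intro0) (simp add: stPrf_def cd_pr isFm_gn)
next
  case (ax_All \<phi> t)
  show ?case using PR_all[OF isFm_gn isTm_gn subFm_gn[of 0]] by (simp add: cd_pr)
next
  case (ax_Eq \<phi>)
  then show ?case by (intro PR_intro0) (auto simp: stPrf_def foldr_disj)
next
  case (mp \<phi> \<psi>)
  then show ?case using PR_mp by (simp add: cd_pr)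
next
  case (gen \<chi> \<phi>)
  have 1: "PR \<tau> (cimp (cd (gn (lift 0 \<chi>))) (cd (gn \<phi>)))" using gen.IH by (simp add: cd_pr)
  have "PR \<tau> (cimp (cd (gn \<chi>)) (call (cd (gn \<phi>))))"
    unfolding PR_def
    by (rule IND_intro1[OF mono_steps(8) 1[unfolded PR_def]])
      (use isFm_gn[of \<chi>] liftFm_gn[of 0 \<chi>] in \<open>auto simp: stPrf_def\<close>)
  then show ?case by (simp add: cd_pr)
qed

text \<open>The closure is a sentence and has a standard code; its quantifiers are then instantiated
  inside \<open>M\<close>, at elements that may be nonstandard.\<close>

lemma PR_dot:
  assumes "T \<turnstile> \<phi>" and "\<And>\<psi>. \<psi> \<in> T \<Longrightarrow> msat M (\<lambda>_. cd (gn \<psi>)) \<tau>"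
  shows "PR \<tau> (qf 0 \<phi> e)"
proof -
  obtain n where "fv \<phi> \<subseteq> {..<n}" by (rule fv_bounded)
  then have "fv ((Forall ^^ n) \<phi>) \<subseteq> {..<0}" by (auto simp: fv_foralls)
  then have "PR \<tau> (qf 0 ((Forall ^^ n) \<phi>) (\<lambda>i. e (i + n)))"
    using PR_provable[OF proves_foralls[OF assms(1)] assms(2)] by (simp add: qf_gn)
  then show ?thesis by (rule PR_foralls)
qed

lemma PR_Imp: "PR \<tau> (qf 0 (Imp \<phi> \<psi>) e) \<Longrightarrow> PR \<tau> (qf 0 \<phi> e) \<Longrightarrow> PR \<tau> (qf 0 \<psi> e)"
  using PR_mp by simp

lemma eval_cd: "meval M (\<lambda>i. cd (e i)) t = cd (eval_tm e t)"
  by (induction t) (auto simp: cd_add cd_mult cd.simps)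

lemma cd_econs: "(\<lambda>i. cd ((n ## e) i)) = cd n ## (\<lambda>i. cd (e i))"
  by (auto simp: fun_eq_iff split: nat.split)

lemma delta0_absolute: "delta0 \<phi> \<Longrightarrow> msat M (\<lambda>i. cd (e i)) \<phi> \<longleftrightarrow> sat e \<phi>"
proof (induction arbitrary: e rule: delta0.induct)
  case (5 \<phi> t)
  have "eval_tm (n ## e) (lift_tm 0 t) = eval_tm e t" for n by (induction t) auto
  then show ?case using 5 by (auto simp: eval_cd less_cd simp flip: cd_econs)
next
  case (6 \<phi> t)
  have "eval_tm (n ## e) (lift_tm 0 t) = eval_tm e t" for n by (induction t) auto
  then show ?case using 6 by (auto simp: eval_cd less_cd simp flip: cd_econs)
qed (auto simp: eval_cd cd_less)

lemma sigma1_complete: "sigma1 \<phi> \<Longrightarrow> sat e \<phi> \<Longrightarrow> msat M (\<lambda>i. cd (e i)) \<phi>"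
proof (induction arbitrary: e rule: sigma1.induct)
  case (2 \<phi>)
  then obtain n where "sat (n ## e) \<phi>" by auto
  from 2(2)[OF this] show ?case by (auto simp: cd_econs)
qed (simp add: delta0_absolute)

end

lemma eval_num: "eval_tm e (num n) = n"
  by (induction n) (simp_all add: num_def)

lemma sat_psubst_num: "sat e (psubst (\<lambda>_. num n) \<phi>) \<longleftrightarrow> sat (\<lambda>_. n) \<phi>"
proof -
  \<comment> \<open>The standard model is repackaged as a \<open>model\<close>, so that
    \<open>msat_psubst\<close> also serves for \<open>sat\<close>.\<close>
  define N :: "nat model" where "N = \<lparr>mZero = 0, mSuc = Suc, mPlus = (+), mTimes = (*), mLess = (<)\<rparr>"
  have "eval_tm e t = meval N e t" for e t by (induction t) (auto simp: N_def)
  moreover from this have "sat e \<phi> = msat N e \<phi>" for e \<phi>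
    by (induction \<phi> arbitrary: e) (auto simp: N_def)
  ultimately show ?thesis by (simp add: msat_psubst eval_num flip: \<open>\<And>t e. eval_tm e t = meval N e t\<close>)
qed

text \<open>Truth of \<Sigma>1 formulas passes from the standard model up to \<open>M\<close>. Only
  this direction is available, as \<tau> may hold of further elements of \<open>M\<close>.\<close>

lemma (in isig) definition_sat:
  assumes "sigma1 \<tau>" "is_definition \<tau> T" "\<psi> \<in> T"
  shows "msat M (\<lambda>_. cd (gn \<psi>)) \<tau>"
proof -
  have "true_in_N (psubst (\<lambda>_. num (gn \<psi>)) \<tau>)" using assms unfolding is_definition_def by blast
  then have "sat (\<lambda>_. gn \<psi>) \<tau>" by (simp add: true_in_N_def sat_psubst_num)
  then show ?thesis using sigma1_complete[OF assms(1), of "\<lambda>_. gn \<psi>"] by simp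
qed

section \<open>A universal \<open>\<Sigma>\<^sub>1\<close> predicate\<close>

text \<open>The items derived by \<open>WStep\<close> are pairs of a program and a stack of values. A program whose tag is below 6
  compares the value of a term with the top of the stack, the other ones evaluate a positive formula.\<close>

definition WStep :: "(dtm \<Rightarrow> dfm) \<Rightarrow> dtm \<Rightarrow> dfm" where
  "WStep E z = (\<^bold>\<exists>c. \<^bold>\<exists>x. Tup [c, x] z \<^bold>\<and>
     ((\<^bold>\<exists>v. \<^bold>\<exists>r. Tup [dnum 0, dnum 0] c \<^bold>\<and> Tup [v, v, r] x) \<^bold>\<or>
      (\<^bold>\<exists>p. \<^bold>\<exists>v. \<^bold>\<exists>u. \<^bold>\<exists>r. Tup [dnum 1, p] c \<^bold>\<and> Tup [v, u, r] x \<^bold>\<and> among E [p, v, r]) \<^bold>\<or>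
      (\<^bold>\<exists>r. Tup [dnum 2, dnum 0] c \<^bold>\<and> Tup [dnum 0, r] x) \<^bold>\<or>
      (\<^bold>\<exists>p. \<^bold>\<exists>v. \<^bold>\<exists>r. Tup [dnum 3, p] c \<^bold>\<and> Tup [dS v, r] x \<^bold>\<and> among E [p, v, r]) \<^bold>\<or>
      (\<^bold>\<exists>p. \<^bold>\<exists>q. \<^bold>\<exists>v. \<^bold>\<exists>w. \<^bold>\<exists>r. Tup [dnum 4, p, q] c \<^bold>\<and> Tup [v \<^bold>+ w, r] x \<^bold>\<and> among E [p, v, r] \<^bold>\<and> among E [q, w, r]) \<^bold>\<or>
      (\<^bold>\<exists>p. \<^bold>\<exists>q. \<^bold>\<exists>v. \<^bold>\<exists>w. \<^bold>\<exists>r. Tup [dnum 5, p, q] c \<^bold>\<and> Tup [v \<^bold>* w, r] x \<^bold>\<and> among E [p, v, r] \<^bold>\<and> among E [q, w, r]) \<^bold>\<or>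
      (\<^bold>\<exists>p. \<^bold>\<exists>q. \<^bold>\<exists>v. Tup [dnum 6, p, q] c \<^bold>\<and> among E [p, v, x] \<^bold>\<and> among E [q, v, x]) \<^bold>\<or>
      (\<^bold>\<exists>p. \<^bold>\<exists>q. \<^bold>\<exists>v. \<^bold>\<exists>w. Tup [dnum 7, p, q] c \<^bold>\<and> v \<^bold>< w \<^bold>\<and> among E [p, v, x] \<^bold>\<and> among E [q, w, x]) \<^bold>\<or>
      (\<^bold>\<exists>p. \<^bold>\<exists>q. Tup [dnum 8, p, q] c \<^bold>\<and> among E [p, x] \<^bold>\<and> among E [q, x]) \<^bold>\<or>
      (\<^bold>\<exists>p. \<^bold>\<exists>q. Tup [dnum 9, p, q] c \<^bold>\<and> (among E [p, x] \<^bold>\<or> among E [q, x])) \<^bold>\<or>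
      (\<^bold>\<exists>p. \<^bold>\<exists>v. Tup [dnum 10, p] c \<^bold>\<and> among E [p, v, x]) \<^bold>\<or>
      (\<^bold>\<exists>p. \<^bold>\<exists>q. \<^bold>\<exists>v. (Tup [dnum 11, p, q] c \<^bold>\<and> among E [p, v, x]) \<^bold>\<and> dallb v (\<lambda>u. among E [q, u, x]))))"

lemma dsig_dex_dallb:
  assumes "\<And>v. dsig (F v)" "\<And>v u. dsig (G v u)"
  shows "dsig (\<^bold>\<exists>v. F v \<^bold>\<and> dallb v (G v))"
proof -
  have "sigma_fm (dallb (\<lambda>d'. Var (d' - Suc d)) (G v) (Suc d))" for d v
    using sigma_Ball[of "G v (\<lambda>d'. Var (d' - Suc (Suc d))) (Suc (Suc d))" "Var 0"] assms(2)
    by (simp add: dallb_def dsig_def)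
  then show ?thesis
    using assms(1) unfolding dsig_def dex_def dconj_def by (intro allI sigma_Exists sigma_Conj) auto
qed

lemma dsig_WStep: "(\<And>y. dsig (E y)) \<Longrightarrow> dsig (WStep E z)"
  unfolding WStep_def by (intro dsig_dex_dallb dsig_intros)

context isig
begin

definition stW where
  "stW E z \<longleftrightarrow> (\<exists>c. \<exists>x. z = pr c x \<and>
     ((\<exists>v. \<exists>r. c = pr (cd 0) (cd 0) \<and> x = pr v (pr v r)) \<or>
      (\<exists>p. \<exists>v. \<exists>u. \<exists>r. c = pr (cd 1) p \<and> x = pr v (pr u r) \<and> E (pr p (pr v r))) \<or>
      (\<exists>r. c = pr (cd 2) (cd 0) \<and> x = pr (cd 0) r) \<or>
      (\<exists>p. \<exists>v. \<exists>r. c = pr (cd 3) p \<and> x = pr (S v) r \<and> E (pr p (pr v r))) \<or>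
      (\<exists>p. \<exists>q. \<exists>v. \<exists>w. \<exists>r. c = pr (cd 4) (pr p q) \<and> x = pr (v \<oplus> w) r \<and> E (pr p (pr v r)) \<and> E (pr q (pr w r))) \<or>
      (\<exists>p. \<exists>q. \<exists>v. \<exists>w. \<exists>r. c = pr (cd 5) (pr p q) \<and> x = pr (v \<odot> w) r \<and> E (pr p (pr v r)) \<and> E (pr q (pr w r))) \<or>
      (\<exists>p. \<exists>q. \<exists>v. c = pr (cd 6) (pr p q) \<and> E (pr p (pr v x)) \<and> E (pr q (pr v x))) \<or>
      (\<exists>p. \<exists>q. \<exists>v. \<exists>w. c = pr (cd 7) (pr p q) \<and> v \<lhd> w \<and> E (pr p (pr v x)) \<and> E (pr q (pr w x))) \<or>
      (\<exists>p. \<exists>q. c = pr (cd 8) (pr p q) \<and> E (pr p x) \<and> E (pr q x)) \<or>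
      (\<exists>p. \<exists>q. c = pr (cd 9) (pr p q) \<and> (E (pr p x) \<or> E (pr q x))) \<or>
      (\<exists>p. \<exists>v. c = pr (cd 10) p \<and> E (pr p (pr v x))) \<or>
      (\<exists>p. \<exists>q. \<exists>v. (c = pr (cd 11) (pr p q) \<and> E (pr p (pr v x))) \<and> (\<forall>u. u \<lhd> v \<longrightarrow> E (pr q (pr u x))))))"

definition W where "W = IND stW"

lemma mono_stW: "mono_step stW"
  unfolding mono_step_def stW_def
  by (intro allI, rule impI, (rule imp_refl disj_mono conj_mono ex_mono all_mono imp_mono | erule spec)+)

lemma dsat_WStep:
  assumes "mean c E P" "den c z a"
  shows "dsat c (WStep E z) (stW P a)"
  unfolding WStep_def stW_def
  by (rule dsat_intros dsat_Tup2 dsat_Tup3 dsat_among2[where P=P and E=E] dsat_among3[where P=P and E=E]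
      den_intros assms | assumption | rule den_up, assumption | rule mean_up, assumption)+

lemma mean_W: "mean c (Ind WStep) W"
  unfolding W_def by (rule mean_Ind) (rule dsat_WStep)

lemma SD_SEQ_W: "SD M (\<lambda>e. SEQ stW (e i) (e j) (e n))"
proof -
  define G where "G = (\<lambda>k. \<^bold>\<exists>y. Beta (free i) (free j) k y \<^bold>\<and> WStep (\<lambda>z. \<^bold>\<exists>l. l \<^bold>< k \<^bold>\<and> Beta (free i) (free j) l z) y)"
  have "dsig (G k)" for k
    unfolding G_def by (intro dsig_intros dsig_Beta dsig_WStep)
  then have "dsig (dallb (free n) G)"
    using sigma_Ball[of _ "free n d" for d]
    by (auto simp: dsig_def dallb_def free_def)
  moreover have "dsat (0, e) (dallb (free n) G) (SEQ stW (e i) (e j) (e n))" for e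
    unfolding SEQ_def G_def
    apply (rule dsat_dallb[OF den_free])
    subgoal for c' k k'
      apply (rule dsat_dex)
      subgoal for c2 y y'
        apply (rule dsat_dconj)
         apply ((rule dsat_Beta den_free | assumption | rule den_up, assumption)+)[1]
        apply (rule dsat_WStep)
         apply (rule mean_I)
         apply ((rule dsat_intros dsat_Beta | assumption | rule den_free | rule den_up, assumption)+)
        done
      done
    done
  ultimately show ?thesis by (rule SD_dsig)
qed

text \<open>The bounded universal clause may have a nonstandard number of premises. \<Sigma>1
  induction on that number collects their derivations in one sequence.\<close>

lemma W_step_ball:
  assumes "\<And>u. u \<lhd> v \<Longrightarrow> W (pr q (pr u x))"
  shows "\<exists>a b n. SEQ stW a b n \<and> (\<forall>u. u \<lhd> v \<longrightarrow> memb a b n (pr q (pr u x)))"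
proof -
  have m: "SD M (\<lambda>e. memb (e i) (e j) (e k) (e l))" for i j k l
    unfolding memb_def by (intro SDs SD_beta TD_intros SD_delta DDs)
  have m2: "SD M (\<lambda>e. memb (e i) (e j) (e k) (pr q (pr (e l) x)))" for i j k l
    using SD_SF[OF SF_pr[OF SF_TD[OF TD_const] SF_pr[OF SF_TD[OF TD_var] SF_TD[OF TD_const]]],
        of "\<lambda>z e. memb (e i) (e j) (e k) z" q l x] m[of "Suc i" "Suc j" "Suc k" 0] by simp
  have "(\<exists>a b n. SEQ stW a b n \<and> (\<forall>u. u \<lhd> k \<longrightarrow> memb a b n (pr q (pr u x)))) \<or> v \<lhd> k" for k
  proof (induction k rule: SD_induction)
    case 1
    have "SD M (\<lambda>e. SEQ stW (e (Suc (Suc 0))) (e (Suc 0)) (e 0))" by (rule SD_SEQ_W)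
    then show ?case by (intro SDs m2 TD_intros SD_delta[OF DD_less])
  next
    case 2
    show ?case using SEQ_empty not_less_zero by blast
  next
    case (3 k)
    show ?case
    proof (cases "v \<unlhd> k")
      case True
      then show ?thesis using less_Suc_iff by blast
    next
      case False
      then have k: "k \<lhd> v" by (simp add: not_leq)
      then obtain a b n where 1: "SEQ stW a b n" "\<And>u. u \<lhd> k \<Longrightarrow> memb a b n (pr q (pr u x))"
        using 3 less_trans less_irrefl by blast
      obtain a' b' n' where 2: "SEQ stW a' b' n'" "memb a' b' n' (pr q (pr k x))"
        using assms[OF k] unfolding W_def by (rule IND_obtain)
      show ?thesis using SEQ_concat[OF mono_stW 1(1) 2(1)] 1(2) 2(2) less_Suc by blast
    qed
  qed
  from this[of v] show ?thesis using less_irrefl by blast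
qed

lemma W_I0: "stW (\<lambda>_. False) z \<Longrightarrow> W z"
  unfolding W_def by (rule IND_intro0[OF mono_stW])

lemma W_I2: "W u \<Longrightarrow> W v \<Longrightarrow> stW (\<lambda>z. z = u \<or> z = v) z \<Longrightarrow> W z"
  unfolding W_def by (rule IND_intro2[OF mono_stW])

lemma W_I1: "W u \<Longrightarrow> stW (\<lambda>z. z = u) z \<Longrightarrow> W z"
  unfolding W_def by (rule IND_intro1[OF mono_stW])

lemma W_ballI:
  assumes "W (pr p (pr v x))" "\<And>u. u \<lhd> v \<Longrightarrow> W (pr q (pr u x))"
  shows "W (pr (pr (cd 11) (pr p q)) x)"
proof -
  obtain a b n where 1: "SEQ stW a b n" "\<And>u. u \<lhd> v \<Longrightarrow> memb a b n (pr q (pr u x))"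
    using W_step_ball[OF assms(2)] by blast
  obtain a' b' n' where 2: "SEQ stW a' b' n'" "memb a' b' n' (pr p (pr v x))"
    using assms(1) unfolding W_def by (rule IND_obtain)
  obtain c d m where 3: "SEQ stW c d m" "\<And>z. memb a b n z \<or> memb a' b' n' z \<Longrightarrow> memb c d m z"
    using SEQ_concat[OF mono_stW 1(1) 2(1)] by blast
  show ?thesis unfolding W_def
  proof (rule IND_step[OF mono_stW 3(1)])
    show "stW (memb c d m) (pr (pr (cd 11) (pr p q)) x)"
      unfolding stW_def using 1(2) 2(2) 3(2) by simp blast
  qed
qed

lemma W_unfold: "W z \<Longrightarrow> stW W z"
  unfolding W_def by (rule IND_unfold[OF mono_stW])

text \<open>Distinct tags and injectivity of \<open>pr\<close> leave one clause for each program, so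
  the derivation rules can be inverted.\<close>

lemma W_iff:
  "W (pr (pr (cd 0) (cd 0)) (pr v (pr u r))) \<longleftrightarrow> v = u"
  "W (pr (pr (cd 1) p) (pr v (pr u r))) \<longleftrightarrow> W (pr p (pr v r))"
  "W (pr (pr (cd 2) (cd 0)) (pr v r)) \<longleftrightarrow> v = cd 0"
  "W (pr (pr (cd 3) p) (pr v r)) \<longleftrightarrow> (\<exists>u. v = S u \<and> W (pr p (pr u r)))"
  "W (pr (pr (cd 4) (pr p q)) (pr v r)) \<longleftrightarrow> (\<exists>u w. v = u \<oplus> w \<and> W (pr p (pr u r)) \<and> W (pr q (pr w r)))"
  "W (pr (pr (cd 5) (pr p q)) (pr v r)) \<longleftrightarrow> (\<exists>u w. v = u \<odot> w \<and> W (pr p (pr u r)) \<and> W (pr q (pr w r)))"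
  "W (pr (pr (cd 6) (pr p q)) x) \<longleftrightarrow> (\<exists>v. W (pr p (pr v x)) \<and> W (pr q (pr v x)))"
  "W (pr (pr (cd 7) (pr p q)) x) \<longleftrightarrow> (\<exists>v w. v \<lhd> w \<and> W (pr p (pr v x)) \<and> W (pr q (pr w x)))"
  "W (pr (pr (cd 8) (pr p q)) x) \<longleftrightarrow> W (pr p x) \<and> W (pr q x)"
  "W (pr (pr (cd 9) (pr p q)) x) \<longleftrightarrow> W (pr p x) \<or> W (pr q x)"
  "W (pr (pr (cd 10) p) x) \<longleftrightarrow> (\<exists>v. W (pr p (pr v x)))"
  "W (pr (pr (cd 11) (pr p q)) x) \<longleftrightarrow> (\<exists>v. W (pr p (pr v x)) \<and> (\<forall>u. u \<lhd> v \<longrightarrow> W (pr q (pr u x))))"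
  subgoal by (rule iffI, drule W_unfold, simp add: stW_def, rule W_I0, simp add: stW_def)
  subgoal by (rule iffI, drule W_unfold, simp add: stW_def, erule W_I1, simp add: stW_def)
  subgoal by (rule iffI, drule W_unfold, simp add: stW_def, rule W_I0, simp add: stW_def)
  subgoal by (rule iffI, drule W_unfold, force simp: stW_def, elim exE conjE, erule W_I1, simp add: stW_def)
  subgoal by (rule iffI, drule W_unfold, force simp: stW_def, elim exE conjE, erule (1) W_I2, auto simp: stW_def)
  subgoal by (rule iffI, drule W_unfold, force simp: stW_def, elim exE conjE, erule (1) W_I2, auto simp: stW_def)
  subgoal by (rule iffI, drule W_unfold, force simp: stW_def, elim exE conjE, erule (1) W_I2, auto simp: stW_def)
  subgoal by (rule iffI, drule W_unfold, force simp: stW_def, elim exE conjE, erule (1) W_I2, auto simp: stW_def)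
  subgoal by (rule iffI, drule W_unfold, force simp: stW_def, elim exE conjE, erule (1) W_I2, auto simp: stW_def)
  subgoal by (rule iffI, drule W_unfold, force simp: stW_def, elim disjE, erule W_I1, simp add: stW_def, erule W_I1, simp add: stW_def)
  subgoal by (rule iffI, drule W_unfold, force simp: stW_def, elim exE conjE, erule W_I1, auto simp: stW_def)
  subgoal by (rule iffI, drule W_unfold, force simp: stW_def, elim exE conjE, erule W_ballI, blast)
  done

section \<open>Programs for terms and formulas\<close>

fun tup :: "nat \<Rightarrow> (nat \<Rightarrow> 'a) \<Rightarrow> 'a" where
  "tup 0 e = \<zero>"
| "tup (Suc m) e = pr (e 0) (tup m (\<lambda>i. e (Suc i)))"

lemma W_tm: "fv_tm t \<subseteq> {..<m} \<Longrightarrow> \<exists>c. \<forall>e v. W (pr c (pr v (tup m e))) \<longleftrightarrow> v = meval M e t"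
proof (induction t)
  case (Var i)
  then have "i < m" by simp
  then have "\<exists>c. \<forall>e v. W (pr c (pr v (tup m e))) \<longleftrightarrow> v = e i"
  proof (induction i arbitrary: m)
    case 0
    then obtain k where "m = Suc k" by (cases m) auto
    then show ?case by (auto simp: W_iff intro!: exI[of _ "pr (cd 0) (cd 0)"])
  next
    case (Suc i)
    then obtain k where k: "m = Suc k" "i < k" by (cases m) auto
    from Suc.IH[OF k(2)] obtain c where "\<forall>e v. W (pr c (pr v (tup k e))) \<longleftrightarrow> v = e i" by blast
    then show ?case using k by (auto simp: W_iff simp del: One_nat_def intro!: exI[of _ "pr (cd 1) c"])
  qed
  then show ?case by simp
next
  case Zero
  show ?case by (intro exI[of _ "pr (cd 2) (cd 0)"]) (simp only: W_iff meval.simps cd.simps(1)[symmetric], simp)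
next
  case (Succ t)
  then obtain c where "\<forall>e v. W (pr c (pr v (tup m e))) \<longleftrightarrow> v = meval M e t" by auto
  then show ?case by (auto simp: W_iff intro!: exI[of _ "pr (cd 3) c"])
next
  case (Plus s t)
  then obtain c d where "\<forall>e v. W (pr c (pr v (tup m e))) \<longleftrightarrow> v = meval M e s"
    "\<forall>e v. W (pr d (pr v (tup m e))) \<longleftrightarrow> v = meval M e t" by auto
  then show ?case by (auto simp: W_iff intro!: exI[of _ "pr (cd 4) (pr c d)"])
next
  case (Times s t)
  then obtain c d where "\<forall>e v. W (pr c (pr v (tup m e))) \<longleftrightarrow> v = meval M e s"
    "\<forall>e v. W (pr d (pr v (tup m e))) \<longleftrightarrow> v = meval M e t" by auto
  then show ?case by (auto simp: W_iff intro!: exI[of _ "pr (cd 5) (pr c d)"])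
qed

text \<open>Only the existence of a program is recorded. The first m variables are kept on the
  stack, so a quantifier pushes one more value.\<close>

definition WR :: "nat \<Rightarrow> ((nat \<Rightarrow> 'a) \<Rightarrow> bool) \<Rightarrow> bool" where
  "WR m R \<longleftrightarrow> (\<exists>c. \<forall>e. W (pr c (tup m e)) \<longleftrightarrow> R e)"

lemma WR_eq: "fv_tm s \<subseteq> {..<m} \<Longrightarrow> fv_tm t \<subseteq> {..<m} \<Longrightarrow> WR m (\<lambda>e. meval M e s = meval M e t)"
proof -
  assume "fv_tm s \<subseteq> {..<m}" "fv_tm t \<subseteq> {..<m}"
  then obtain c d where "\<forall>e v. W (pr c (pr v (tup m e))) \<longleftrightarrow> v = meval M e s"
    "\<forall>e v. W (pr d (pr v (tup m e))) \<longleftrightarrow> v = meval M e t" using W_tm by meson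
  then show ?thesis unfolding WR_def by (intro exI[of _ "pr (cd 6) (pr c d)"]) (auto simp: W_iff)
qed

lemma WR_less: "fv_tm s \<subseteq> {..<m} \<Longrightarrow> fv_tm t \<subseteq> {..<m} \<Longrightarrow> WR m (\<lambda>e. meval M e s \<lhd> meval M e t)"
proof -
  assume "fv_tm s \<subseteq> {..<m}" "fv_tm t \<subseteq> {..<m}"
  then obtain c d where "\<forall>e v. W (pr c (pr v (tup m e))) \<longleftrightarrow> v = meval M e s"
    "\<forall>e v. W (pr d (pr v (tup m e))) \<longleftrightarrow> v = meval M e t" using W_tm by meson
  then show ?thesis unfolding WR_def by (intro exI[of _ "pr (cd 7) (pr c d)"]) (auto simp: W_iff)
qed

lemma WR_conj: "WR m R \<Longrightarrow> WR m R' \<Longrightarrow> WR m (\<lambda>e. R e \<and> R' e)"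
  unfolding WR_def by (metis W_iff(9))

lemma WR_disj: "WR m R \<Longrightarrow> WR m R' \<Longrightarrow> WR m (\<lambda>e. R e \<or> R' e)"
  unfolding WR_def by (metis W_iff(10))

lemma tup_econs: "tup (Suc m) (a ## e) = pr a (tup m e)"
  by simp

lemma WR_ex: "WR (Suc m) R \<Longrightarrow> WR m (\<lambda>e. \<exists>a. R (a ## e))"
proof -
  assume "WR (Suc m) R"
  then obtain c where "\<And>e. W (pr c (tup (Suc m) e)) \<longleftrightarrow> R e" unfolding WR_def by blast
  from this[of "a ## e" for a e] show ?thesis
    unfolding WR_def tup_econs by (intro exI[of _ "pr (cd 10) c"]) (auto simp: W_iff)
qed

lemma WR_ball: "WR (Suc m) R \<Longrightarrow> fv_tm t \<subseteq> {..<m} \<Longrightarrow> WR m (\<lambda>e. \<forall>a. a \<lhd> meval M e t \<longrightarrow> R (a ## e))"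
proof -
  assume "WR (Suc m) R"
  then obtain c where c: "\<And>e. W (pr c (tup (Suc m) e)) \<longleftrightarrow> R e" unfolding WR_def by blast
  assume "fv_tm t \<subseteq> {..<m}"
  then obtain d where "\<forall>e v. W (pr d (pr v (tup m e))) \<longleftrightarrow> v = meval M e t" using W_tm by meson
  then show ?thesis using c[of "a ## e" for a e]
    unfolding WR_def tup_econs by (intro exI[of _ "pr (cd 11) (pr d c)"]) (auto simp: W_iff)
qed

lemma fv_ball: "fv (Forall \<phi>) \<subseteq> {..<m} \<Longrightarrow> fv \<phi> \<subseteq> {..<Suc m}"
proof
  fix i assume "fv (Forall \<phi>) \<subseteq> {..<m}" "i \<in> fv \<phi>"
  then show "i \<in> {..<Suc m}" by (cases i) auto
qed

text \<open>Programs are positive, so the complement of each \<Delta>0 relation is carried along;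
  negated atoms become atoms by trichotomy.\<close>

lemma WR_delta0: "delta0 \<phi> \<Longrightarrow> fv \<phi> \<subseteq> {..<m} \<Longrightarrow> WR m (\<lambda>e. msat M e \<phi>) \<and> WR m (\<lambda>e. \<not> msat M e \<phi>)"
proof (induction arbitrary: m rule: delta0.induct)
  case (1 s t)
  have "WR m (\<lambda>e. meval M e s \<lhd> meval M e t \<or> meval M e t \<lhd> meval M e s)"
    using 1 by (intro WR_disj WR_less) auto
  then have "WR m (\<lambda>e. \<not> meval M e s = meval M e t)" by (simp flip: arith.neq_iff)
  then show ?case using 1 by (auto intro: WR_eq)
next
  case (2 s t)
  have "WR m (\<lambda>e. meval M e t \<lhd> meval M e s \<or> meval M e t = meval M e s)"
    using 2 by (intro WR_disj WR_less WR_eq) auto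
  moreover have "(\<not> a \<lhd> b) = (b \<lhd> a \<or> b = a)" for a b using not_leq leq_def by blast
  ultimately have "WR m (\<lambda>e. \<not> meval M e s \<lhd> meval M e t)" by (simp only:)
  then show ?case using 2 by (auto intro: WR_less)
next
  case (4 \<phi> \<psi>)
  then have "WR m (\<lambda>e. msat M e \<phi>)" "WR m (\<lambda>e. \<not> msat M e \<phi>)"
    "WR m (\<lambda>e. msat M e \<psi>)" "WR m (\<lambda>e. \<not> msat M e \<psi>)" by auto
  then show ?case
    using WR_disj[of m "\<lambda>e. \<not> msat M e \<phi>" "\<lambda>e. msat M e \<psi>"] WR_conj[of m "\<lambda>e. msat M e \<phi>" "\<lambda>e. \<not> msat M e \<psi>"]
    by (simp only: msat.simps imp_conv_disj de_Morgan_disj not_not)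
next
  case (5 \<phi> t)
  have f: "fv \<phi> \<subseteq> {..<Suc m}" "fv_tm (lift_tm 0 t) \<subseteq> {..<Suc m}" "fv_tm t \<subseteq> {..<m}"
    using fv_ball[OF 5(3)] 5(3) by (auto simp: fv_lift_tm_0)
  have "WR m (\<lambda>e. \<exists>a. meval M (a ## e) (Var 0) \<lhd> meval M (a ## e) (lift_tm 0 t) \<and> \<not> msat M (a ## e) \<phi>)"
    using 5(2)[OF f(1)] f(2) by (intro WR_ex WR_conj WR_less) auto
  moreover have "WR m (\<lambda>e. \<forall>a. a \<lhd> meval M e t \<longrightarrow> msat M (a ## e) \<phi>)"
    using WR_ball[of m "\<lambda>e. msat M e \<phi>" t] 5(2)[OF f(1)] f(3) by blast
  ultimately show ?case by simp
next
  case (6 \<phi> t)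
  have f: "fv \<phi> \<subseteq> {..<Suc m}" "fv_tm (lift_tm 0 t) \<subseteq> {..<Suc m}" "fv_tm t \<subseteq> {..<m}"
    using fv_ball[of "Neg (Conj (Lt (Var 0) (lift_tm 0 t)) \<phi>)" m] 6(3) by (auto simp: fv_lift_tm_0)
  have "WR m (\<lambda>e. \<exists>a. meval M (a ## e) (Var 0) \<lhd> meval M (a ## e) (lift_tm 0 t) \<and> msat M (a ## e) \<phi>)"
    using 6(2)[OF f(1)] f(2) by (intro WR_ex WR_conj WR_less) auto
  moreover have "WR m (\<lambda>e. \<forall>a. a \<lhd> meval M e t \<longrightarrow> \<not> msat M (a ## e) \<phi>)"
    using WR_ball[of m "\<lambda>e. \<not> msat M e \<phi>" t] 6(2)[OF f(1)] f(3) by blast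
  ultimately show ?case by simp
qed auto

lemma WR_sigma: "sigma_fm \<phi> \<Longrightarrow> fv \<phi> \<subseteq> {..<m} \<Longrightarrow> WR m (\<lambda>e. msat M e \<phi>)"
proof (induction arbitrary: m rule: sigma_fm.induct)
  case (sigma_delta0 \<phi>)
  then show ?case using WR_delta0 by blast
next
  case (sigma_Conj \<phi> \<psi>)
  then have "WR m (\<lambda>e. msat M e \<phi>)" "WR m (\<lambda>e. msat M e \<psi>)" by auto
  then show ?case using WR_conj[of m "\<lambda>e. msat M e \<phi>" "\<lambda>e. msat M e \<psi>"] by simp
next
  case (sigma_Disj \<phi> \<psi>)
  then have "WR m (\<lambda>e. msat M e \<phi>)" "WR m (\<lambda>e. msat M e \<psi>)" by auto
  then show ?case using WR_disj[of m "\<lambda>e. msat M e \<phi>" "\<lambda>e. msat M e \<psi>"]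
    by (simp only: msat.simps imp_conv_disj not_not)
next
  case (sigma_Exists \<phi>)
  have "fv \<phi> \<subseteq> {..<Suc m}" using fv_ball[of "Neg \<phi>"] sigma_Exists.prems by auto
  then show ?case using WR_ex[OF sigma_Exists.IH] by simp
next
  case (sigma_Ball \<phi> t)
  have "fv \<phi> \<subseteq> {..<Suc m}" "fv_tm t \<subseteq> {..<m}"
    using fv_ball[OF sigma_Ball.prems] sigma_Ball.prems by (auto simp: fv_lift_tm_0)
  then show ?case using WR_ball[OF sigma_Ball.IH, of m t] by simp
qed

text \<open>An index packs the program together with the stack of its parameters, so that sets
  defined with parameters, even nonstandard ones, have indices too.\<close>

definition univ :: "'a \<Rightarrow> 'a \<Rightarrow> bool" where
  "univ g n \<longleftrightarrow> (\<exists>c p. g = pr c p \<and> W (pr c (pr n p)))"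

lemma univ_universal:
  assumes "SD M (\<lambda>e. Q (e 0))"
  shows "\<exists>g. \<forall>n. univ g n \<longleftrightarrow> Q n"
proof -
  obtain p \<phi> where \<phi>: "sigma_fm \<phi>" "\<And>a e. Q a = msat M (a ## mix e p) \<phi>"
    using assms by (rule defin_econs_E[of sigma_fm M "\<lambda>a _. Q a"]) auto
  obtain m where m: "fv \<phi> \<subseteq> {..<m}" by (rule fv_bounded)
  then have "fv \<phi> \<subseteq> {..<Suc m}" by auto
  from WR_sigma[OF \<phi>(1) this] obtain c where c: "\<And>e. W (pr c (tup (Suc m) e)) \<longleftrightarrow> msat M e \<phi>"
    unfolding WR_def by blast
  have "univ (pr c (tup m (mix undefined p))) n \<longleftrightarrow> Q n" for n
    using c[of "n ## mix undefined p"] \<phi>(2)[of n undefined] by (simp add: univ_def)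
  then show ?thesis by blast
qed

end

text \<open>A set with index \<open>h\<close> that separates the first of these two sets from the second, and whose complement
  has the index \<open>g\<close>, contains \<open>\<langle>g, h\<rangle>\<close> if and only if it does not.\<close>

definition Univ1 :: dfm where
  "Univ1 = (\<^bold>\<exists>g. \<^bold>\<exists>h. Tup [g, h] (free 0) \<^bold>\<and> (\<^bold>\<exists>c. \<^bold>\<exists>p. Tup [c, p] g \<^bold>\<and> among (Ind WStep) [c, free 0, p]))"

definition Univ0 :: dfm where
  "Univ0 = (\<^bold>\<exists>g. \<^bold>\<exists>h. Tup [g, h] (free 0) \<^bold>\<and> (\<^bold>\<exists>c. \<^bold>\<exists>p. Tup [c, p] h \<^bold>\<and> among (Ind WStep) [c, free 0, p]))"

lemma dsig_Univ: "dsig Univ1" "dsig Univ0"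
  unfolding Univ1_def Univ0_def by (intro dsig_intros dsig_Ind dsig_WStep | assumption)+

context isig
begin

lemma msat_Univ1: "msat M e (Univ1 0) \<longleftrightarrow> (\<exists>g h. e 0 = pr g h \<and> univ g (e 0))"
proof -
  have "dsat (0, e) Univ1 (\<exists>g. \<exists>h. e 0 = pr g h \<and> (\<exists>c. \<exists>p. g = pr c p \<and> W (pr c (pr (e 0) p))))"
    unfolding Univ1_def
    by (rule dsat_intros dsat_Tup2 dsat_among3[where P=W] mean_W | assumption | rule den_free | rule den_up, assumption)+
  then show ?thesis using dsat_msat unfolding univ_def by simp
qed

lemma msat_Univ0: "msat M e (Univ0 0) \<longleftrightarrow> (\<exists>g h. e 0 = pr g h \<and> univ h (e 0))"
proof -
  have "dsat (0, e) Univ0 (\<exists>g. \<exists>h. e 0 = pr g h \<and> (\<exists>c. \<exists>p. h = pr c p \<and> W (pr c (pr (e 0) p))))"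
    unfolding Univ0_def
    by (rule dsat_intros dsat_Tup2 dsat_among3[where P=W] mean_W | assumption | rule den_free | rule den_up, assumption)+
  then show ?thesis using dsat_msat unfolding univ_def by simp
qed

end

lemma witness_formula:
  assumes "dsig F"
  shows "\<exists>\<kappa>. delta0 \<kappa> \<and> (\<forall>(M :: 'a model) e. models M ISigma1 \<longrightarrow>
    (msat M e (F 0) \<longleftrightarrow> (\<exists>s. msat M (s ## e) \<kappa>)))"
  using sigma_normal_form[of "F 0", where 'a='a] assms by (auto simp: dsig_def)

section \<open>Relational structures\<close>

text \<open>The symbols 0, \<dots>, 5 of a relational structure stand for equality, zero, and the graphs of successor,
  addition and multiplication, and the order.\<close>

fun rval :: "(nat \<Rightarrow> 'a list \<Rightarrow> bool) \<Rightarrow> (nat \<Rightarrow> 'a) \<Rightarrow> tm \<Rightarrow> 'a \<Rightarrow> bool" where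
  "rval R e (Var i) v \<longleftrightarrow> R 0 [e i, v]"
| "rval R e Zero v \<longleftrightarrow> R 1 [v]"
| "rval R e (Succ t) v \<longleftrightarrow> (\<exists>u. rval R e t u \<and> R 2 [u, v])"
| "rval R e (Plus s t) v \<longleftrightarrow> (\<exists>u w. rval R e s u \<and> rval R e t w \<and> R 3 [u, w, v])"
| "rval R e (Times s t) v \<longleftrightarrow> (\<exists>u w. rval R e s u \<and> rval R e t w \<and> R 4 [u, w, v])"

fun rsat :: "(nat \<Rightarrow> 'a list \<Rightarrow> bool) \<Rightarrow> (nat \<Rightarrow> 'a) \<Rightarrow> fm \<Rightarrow> bool" where
  "rsat R e (Eq s t) \<longleftrightarrow> (\<exists>u. rval R e s u \<and> rval R e t u)"
| "rsat R e (Lt s t) \<longleftrightarrow> (\<exists>u w. rval R e s u \<and> rval R e t w \<and> R 5 [u, w])"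
| "rsat R e (Neg \<phi>) \<longleftrightarrow> \<not> rsat R e \<phi>"
| "rsat R e (Imp \<phi> \<psi>) \<longleftrightarrow> (rsat R e \<phi> \<longrightarrow> rsat R e \<psi>)"
| "rsat R e (Forall \<phi>) \<longleftrightarrow> (\<forall>a. rsat R (a ## e) \<phi>)"

lemma rval_rename: "rval R e (psubst_tm (\<lambda>i. Var (f i)) t) v = rval R (\<lambda>i. e (f i)) t v"
  by (induction t arbitrary: v) auto

lemma rsat_rename: "rsat R e (psubst (\<lambda>i. Var (f i)) \<phi>) = rsat R (\<lambda>i. e (f i)) \<phi>"
proof (induction \<phi> arbitrary: e f)
  case (Forall \<phi>)
  have 1: "up (\<lambda>i. Var (f i)) = (\<lambda>i. Var (case_nat 0 (\<lambda>i. Suc (f i)) i))"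
    by (auto simp: fun_eq_iff split: nat.split)
  have 2: "(\<lambda>i. (a ## e) (case_nat 0 (\<lambda>i. Suc (f i)) i)) = a ## (\<lambda>i. e (f i))" for a
    by (auto simp: fun_eq_iff split: nat.split)
  show ?case by (simp only: psubst.simps rsat.simps 1 Forall.IH 2)
qed (auto simp: rval_rename)

lemma rval_lift: "rval R (a ## e) (lift_tm 0 t) v = rval R e t v"
  by (induction t arbitrary: v) auto

text \<open>The \<open>i\<close>-th bit of the set coded by \<open>a\<close> and \<open>b\<close> is 1 if \<open>1 + (i + 1) * b\<close> divides \<open>a\<close>. The complement
  has an existential definition as well, so that a coded set is \<open>\<Delta>\<^sub>1\<close> whenever the structure is \<open>\<Sigma>\<^sub>1\<close>.\<close>

definition rbit :: "(nat \<Rightarrow> 'a list \<Rightarrow> bool) \<Rightarrow> 'a \<Rightarrow> 'a \<Rightarrow> 'a \<Rightarrow> bool" where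
  "rbit R a b i \<longleftrightarrow> (\<exists>j p m q. R 2 [i, j] \<and> R 4 [j, b, p] \<and> R 2 [p, m] \<and> R 4 [q, m, a])"

definition rnbit :: "(nat \<Rightarrow> 'a list \<Rightarrow> bool) \<Rightarrow> 'a \<Rightarrow> 'a \<Rightarrow> 'a \<Rightarrow> bool" where
  "rnbit R a b i \<longleftrightarrow> (\<exists>j p m q w r z. R 2 [i, j] \<and> R 4 [j, b, p] \<and> R 2 [p, m] \<and> R 4 [q, m, w] \<and>
     R 3 [w, r, a] \<and> R 5 [r, m] \<and> R 1 [z] \<and> R 5 [z, r])"

text \<open>Finitely many axioms without any induction scheme, so that one modal sentence expresses
  them; the inductions are carried out in \<open>M\<close>. \<open>rless_suc_leq\<close> makes the
  numerals an initial segment, and \<open>rbit_iff\<close> gives the cleared bits a positive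
  form.\<close>

locale rel_arith =
  fixes R :: "nat \<Rightarrow> 'a list \<Rightarrow> bool"
  assumes eq_refl: "R 0 [x, x]" and eq_sym: "R 0 [x, y] \<Longrightarrow> R 0 [y, x]"
  and eq_trans: "R 0 [x, y] \<Longrightarrow> R 0 [y, z] \<Longrightarrow> R 0 [x, z]"
  and zero_ex: "\<exists>x. R 1 [x]" and zero_iff: "R 1 [x] \<Longrightarrow> R 1 [y] \<longleftrightarrow> R 0 [x, y]"
  and suc_ex: "\<exists>y. R 2 [x, y]"
  and suc_iff: "R 0 [x, x'] \<Longrightarrow> R 2 [x, y] \<Longrightarrow> R 2 [x', y'] \<longleftrightarrow> R 0 [y, y']"
  and add_ex: "\<exists>z. R 3 [x, y, z]"
  and add_iff: "R 0 [x, x'] \<Longrightarrow> R 0 [y, y'] \<Longrightarrow> R 3 [x, y, z] \<Longrightarrow> R 3 [x', y', z'] \<longleftrightarrow> R 0 [z, z']"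
  and mul_ex: "\<exists>z. R 4 [x, y, z]"
  and mul_iff: "R 0 [x, x'] \<Longrightarrow> R 0 [y, y'] \<Longrightarrow> R 4 [x, y, z] \<Longrightarrow> R 4 [x', y', z'] \<longleftrightarrow> R 0 [z, z']"
  and less_cong: "R 0 [x, x'] \<Longrightarrow> R 0 [y, y'] \<Longrightarrow> R 5 [x, y] \<Longrightarrow> R 5 [x', y']"
  and radd_zero: "R 1 [y] \<Longrightarrow> R 3 [x, y, x]"
  and radd_suc: "R 3 [x, y, z] \<Longrightarrow> R 2 [y, y'] \<Longrightarrow> R 2 [z, z'] \<Longrightarrow> R 3 [x, y', z']"
  and rmul_zero: "R 1 [y] \<Longrightarrow> R 4 [x, y, y]"
  and rmul_suc: "R 4 [x, y, z] \<Longrightarrow> R 2 [y, y'] \<Longrightarrow> R 3 [z, x, w] \<Longrightarrow> R 4 [x, y', w]"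
  and rless_zero: "R 1 [y] \<Longrightarrow> \<not> R 5 [x, y]"
  and rless_suc: "R 2 [y, y'] \<Longrightarrow> R 5 [x, y'] \<longleftrightarrow> R 5 [x, y] \<or> R 0 [x, y]"
  and rless_cases: "R 5 [x, y] \<or> R 0 [x, y] \<or> R 5 [y, x]"
  and rless_neq: "R 5 [x, y] \<Longrightarrow> \<not> R 0 [x, y]"
  and rless_trans: "R 5 [x, y] \<Longrightarrow> R 5 [y, z] \<Longrightarrow> R 5 [x, z]"
  and rless_suc_leq: "R 5 [x, y] \<Longrightarrow> R 2 [x, x'] \<Longrightarrow> R 5 [x', y] \<or> R 0 [x', y]"
  and rbit_iff: "rbit R a b i \<longleftrightarrow> \<not> rnbit R a b i"

text \<open>Rosser's witness comparison: the coded set separates the numbers with a witness for \<open>\<kappa>1\<close> below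
  the bound \<open>u\<close> and none for \<open>\<kappa>0\<close> from those in the converse situation.\<close>

definition rel_coding :: "fm \<Rightarrow> fm \<Rightarrow> (nat \<Rightarrow> 'a list \<Rightarrow> bool) \<Rightarrow> bool" where
  "rel_coding \<kappa>1 \<kappa>0 R \<longleftrightarrow> (\<forall>u. \<exists>a b. \<forall>i. R 5 [i, u] \<longrightarrow> (rbit R a b i \<longleftrightarrow>
     (\<exists>s. R 5 [s, u] \<and> rsat R (s ## (\<lambda>_. i)) \<kappa>1 \<and>
       (\<forall>t. R 5 [t, s] \<or> R 0 [t, s] \<longrightarrow> \<not> rsat R (t ## (\<lambda>_. i)) \<kappa>0))))"

lemma SD_subst2:
  assumes "SD M (\<lambda>e. P (e 0) (e 1))" "TD M s" "TD M t"
  shows "SD M (\<lambda>e. P (s e) (t e))"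
  using defin_subst[OF assms(1), of "\<lambda>e. s e ## t e ## e"] assms(2,3) by (simp add: TD_econs TD_var)

text \<open>\<open>F k y\<close> says that \<open>y\<close> is the \<open>k\<close>-th numeral of the structure, where \<open>k\<close> may be nonstandard.\<close>

locale relstruct = isig M + rel_arith R for M :: "'a model" and R +
  fixes F :: "'a \<Rightarrow> 'a \<Rightarrow> bool"
  assumes SD_R: "\<And>P ts. (\<And>t. t \<in> set ts \<Longrightarrow> TD M t) \<Longrightarrow> SD M (\<lambda>e. R P (map (\<lambda>t. t e) ts))"
    and F_zero: "\<And>y. F \<zero> y \<longleftrightarrow> R 1 [y]"
    and F_Suc: "\<And>k z. F (S k) z \<longleftrightarrow> (\<exists>y. F k y \<and> R 2 [y, z])"
    and SD_F0: "SD M (\<lambda>e. F (e 0) (e 1))"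
begin

section \<open>The numerals as an initial segment of the structure\<close>

lemma SD_R1: "TD M s \<Longrightarrow> SD M (\<lambda>e. R P [s e])"
  using SD_R[of "[s]"] by auto

lemma SD_R2: "TD M s \<Longrightarrow> TD M t \<Longrightarrow> SD M (\<lambda>e. R P [s e, t e])"
  using SD_R[of "[s, t]"] by auto

lemma SD_R3: "TD M s \<Longrightarrow> TD M t \<Longrightarrow> TD M u \<Longrightarrow> SD M (\<lambda>e. R P [s e, t e, u e])"
  using SD_R[of "[s, t, u]"] by auto

lemmas SD_F = SD_subst2[OF SD_F0]
lemmas SD_rel = SD_R1 SD_R2 SD_R3 SD_F

text \<open>The relations are only known to be \<Sigma>1. Through the order, inequality becomes
  \<Sigma>1 as well, as the \<Pi>1 induction in \<open>F_unique\<close> requires.\<close>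

lemma neq_iff: "\<not> R 0 [x, y] \<longleftrightarrow> R 5 [x, y] \<or> R 5 [y, x]"
  using rless_cases rless_neq eq_sym by blast

lemma F_ex: "\<exists>y. F x y"
proof (induction x rule: SD_induction)
  case 1
  show ?case by (intro SDs SD_rel TD_intros)
qed (use F_zero F_Suc zero_ex suc_ex in blast)+

lemma F_unique: "F x y \<Longrightarrow> F x y' \<Longrightarrow> R 0 [y, y']"
proof -
  have "\<forall>y y'. F x y \<and> F x y' \<longrightarrow> R 0 [y, y']"
  proof (induction x rule: PD_induction)
    case 1
    have "SD M (\<lambda>e. \<exists>y y'. F (e 0) y \<and> F (e 0) y' \<and> (R 5 [y, y'] \<or> R 5 [y', y]))"
      by (intro SDs SD_rel TD_intros)
    then show ?case by (simp flip: neq_iff)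
  next
    case 2
    then show ?case using F_zero zero_iff by blast
  next
    case (3 x)
    then show ?case using F_Suc suc_iff by blast
  qed
  then show "F x y \<Longrightarrow> F x y' \<Longrightarrow> R 0 [y, y']" by blast
qed

lemma F_cong: "F x y \<Longrightarrow> R 0 [y, y'] \<Longrightarrow> F x y'"
proof (cases "x = \<zero>")
  case True
  then show "F x y \<Longrightarrow> R 0 [y, y'] \<Longrightarrow> F x y'" using F_zero zero_iff by blast
next
  case False
  then obtain k where "x = S k" using not_zero_Suc by blast
  then show "F x y \<Longrightarrow> R 0 [y, y'] \<Longrightarrow> F x y'" using F_Suc suc_iff eq_refl by metis
qed

lemma F_iff: "F x y \<Longrightarrow> F x y' \<longleftrightarrow> R 0 [y, y']"
  using F_unique F_cong by blast

text \<open>The induction formula speaks of some representatives of the two numerals rather than of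
  all, which keeps it \<Sigma>1; uniqueness up to interpreted equality makes up for this. Addition
  and multiplication are treated in the same way.\<close>

lemma F_less: "F x y \<Longrightarrow> F x' y' \<Longrightarrow> x \<lhd> x' \<Longrightarrow> R 5 [y, y']"
proof -
  have "x \<lhd> x' \<longrightarrow> (\<exists>y y'. F x y \<and> F x' y' \<and> R 5 [y, y'])"
  proof (induction x' rule: SD_induction)
    case 1
    show ?case by (intro SDs SD_rel DDs TD_intros)
  next
    case (3 x')
    show ?case
    proof
      assume "x \<lhd> S x'"
      then have "\<exists>y y'. F x y \<and> F x' y' \<and> (R 5 [y, y'] \<or> R 0 [y, y'])"
        using 3 F_ex eq_refl less_Suc by blast
      then show "\<exists>y y'. F x y \<and> F (S x') y' \<and> R 5 [y, y']"
        using F_Suc suc_ex rless_suc by meson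
    qed
  qed simp
  then show "F x y \<Longrightarrow> F x' y' \<Longrightarrow> x \<lhd> x' \<Longrightarrow> R 5 [y, y']"
    using F_unique less_cong by blast
qed

lemma F_less_iff: "F x y \<Longrightarrow> F x' y' \<Longrightarrow> R 5 [y, y'] \<longleftrightarrow> x \<lhd> x'"
  using F_less[of x y x' y'] F_less[of x' y' x y] F_unique[of x y y'] less_cases[of x x']
    rless_neq rless_trans eq_refl eq_sym by blast

lemma F_inj: "F x y \<Longrightarrow> F x' y \<Longrightarrow> x = x'"
  using F_less[of x y x' y] F_less[of x' y x y] less_cases[of x x'] rless_neq eq_refl by blast

lemma F_add: "F x y \<Longrightarrow> F x' y' \<Longrightarrow> R 3 [y, y', z] \<longleftrightarrow> F (x \<oplus> x') z"
proof -
  have "\<exists>y y' z. F x y \<and> F x' y' \<and> F (x \<oplus> x') z \<and> R 3 [y, y', z]"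
  proof (induction x' rule: SD_induction)
    case 1
    show ?case by (intro SDs SD_rel TD_intros)
  next
    case 2
    obtain y z where "F x y" "R 1 [z]" using F_ex zero_ex by blast
    then have "F x y" "F \<zero> z" "F (x \<oplus> \<zero>) y" "R 3 [y, z, y]" using F_zero radd_zero add_zero by auto
    then show ?case by blast
  next
    case (3 x')
    then obtain y y' z where 1: "F x y" "F x' y'" "F (x \<oplus> x') z" "R 3 [y, y', z]" by blast
    obtain y'' w where 2: "R 2 [y', y'']" "R 2 [z, w]" using suc_ex by blast
    have "F (S x') y''" "F (x \<oplus> S x') w" "R 3 [y, y'', w]"
      using 1 2 F_Suc add_Suc radd_suc by auto
    then show ?case using 1(1) by blast
  qed
  then obtain v v' w where 0: "F x v" "F x' v'" "F (x \<oplus> x') w" "R 3 [v, v', w]" by blast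
  assume "F x y" "F x' y'"
  then have "R 3 [y, y', z] \<longleftrightarrow> R 0 [w, z]" using 0 F_unique by (intro add_iff[of v _ v']) blast+
  then show ?thesis using F_iff[OF 0(3)] by simp
qed

lemma F_mul: "F x y \<Longrightarrow> F x' y' \<Longrightarrow> R 4 [y, y', z] \<longleftrightarrow> F (x \<odot> x') z"
proof -
  have "\<exists>y y' z. F x y \<and> F x' y' \<and> F (x \<odot> x') z \<and> R 4 [y, y', z]"
  proof (induction x' rule: SD_induction)
    case 1
    show ?case by (intro SDs SD_rel TD_intros)
  next
    case 2
    obtain y z where "F x y" "R 1 [z]" using F_ex zero_ex by blast
    then have "F x y" "F \<zero> z" "F (x \<odot> \<zero>) z" "R 4 [y, z, z]" using F_zero rmul_zero mul_zero by auto
    then show ?case by blast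
  next
    case (3 x')
    then obtain y y' z where 1: "F x y" "F x' y'" "F (x \<odot> x') z" "R 4 [y, y', z]" by blast
    obtain y'' w where 2: "R 2 [y', y'']" "R 3 [z, y, w]" using suc_ex add_ex by blast
    have "F (S x') y''" "F (x \<odot> S x') w" "R 4 [y, y'', w]"
      using 1 2 F_Suc F_add[OF 1(3) 1(1)] mul_Suc rmul_suc by auto
    then show ?case using 1(1) by blast
  qed
  then obtain v v' w where 0: "F x v" "F x' v'" "F (x \<odot> x') w" "R 4 [v, v', w]" by blast
  assume "F x y" "F x' y'"
  then have "R 4 [y, y', z] \<longleftrightarrow> R 0 [w, z]" using 0 F_unique by (intro mul_iff[of v _ v']) blast+
  then show ?thesis using F_iff[OF 0(3)] by simp
qed

text \<open>For fixed c, induction on x: either c has already appeared as a smaller numeral, or the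
  x-th numeral is still at most c. The latter is expressed positively, by equality or order.\<close>

lemma F_initial: "F x y \<Longrightarrow> R 5 [c, y] \<Longrightarrow> \<exists>x'. x' \<lhd> x \<and> F x' c"
proof -
  have "(\<exists>x'. x' \<lhd> x \<and> F x' c) \<or> (\<exists>y. F x y \<and> (R 0 [y, c] \<or> R 5 [y, c]))"
  proof (induction x rule: SD_induction)
    case 1
    show ?case by (intro SDs SD_rel SD_delta DDs TD_intros)
  next
    case 2
    obtain z where "R 1 [z]" using zero_ex by blast
    then show ?case using F_zero rless_cases rless_zero by blast
  next
    case (3 x)
    then consider "\<exists>x'. x' \<lhd> x \<and> F x' c" | "F x c" | y where "F x y" "R 5 [y, c]"
      using F_cong by blast
    then show ?case
    proof cases
      case 3
      then show ?thesis using suc_ex[of y] F_Suc rless_suc_leq by blast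
    qed (auto simp: less_Suc)
  qed
  moreover assume "F x y" "R 5 [c, y]"
  have "\<not> (R 0 [y', c] \<or> R 5 [y', c])" if "F x y'" for y'
  proof -
    have "R 5 [c, y']" using less_cong[OF eq_refl F_unique[OF \<open>F x y\<close> that] \<open>R 5 [c, y]\<close>] .
    then show ?thesis using rless_neq[of c y'] rless_neq[of c c] rless_trans[of c y' c] eq_refl eq_sym by blast
  qed
  ultimately show ?thesis by blast
qed

lemma rval_F: "(\<And>i. i \<in> fv_tm t \<Longrightarrow> F (e i) (e' i)) \<Longrightarrow> rval R e' t v \<longleftrightarrow> F (meval M e t) v"
proof (induction t arbitrary: v)
  case (Var i)
  then show ?case using F_iff[of "e i" "e' i" v] by simp
next
  case (Plus s t)
  obtain y y' where y: "F (meval M e s) y" "F (meval M e t) y'" using F_ex by blast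
  have "rval R e' (Plus s t) v \<longleftrightarrow> (\<exists>u w. F (meval M e s) u \<and> F (meval M e t) w \<and> R 3 [u, w, v])"
    using Plus by simp
  then show ?case using y F_add by auto
next
  case (Times s t)
  obtain y y' where y: "F (meval M e s) y" "F (meval M e t) y'" using F_ex by blast
  have "rval R e' (Times s t) v \<longleftrightarrow> (\<exists>u w. F (meval M e s) u \<and> F (meval M e t) w \<and> R 4 [u, w, v])"
    using Times by simp
  then show ?case using y F_mul by auto
qed (auto simp: F_zero F_Suc)

lemma rsat_F_Eq: "(\<And>i. i \<in> fv (Eq s t) \<Longrightarrow> F (e i) (e' i)) \<Longrightarrow> rsat R e' (Eq s t) \<longleftrightarrow> msat M e (Eq s t)"
  using rval_F[of s e e'] rval_F[of t e e'] F_inj F_ex by (simp, metis)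

lemma rsat_F_Lt: "(\<And>i. i \<in> fv (Lt s t) \<Longrightarrow> F (e i) (e' i)) \<Longrightarrow> rsat R e' (Lt s t) \<longleftrightarrow> msat M e (Lt s t)"
  using rval_F[of s e e'] rval_F[of t e e'] F_less_iff F_ex by (simp, metis)

text \<open>Bounded quantifiers do not leave the initial segment of numerals, so absoluteness holds
  before F is known to be onto.\<close>

lemma rsat_F_delta0:
  "delta0 \<phi> \<Longrightarrow> (\<And>i. F (e i) (e' i)) \<Longrightarrow> rsat R e' \<phi> \<longleftrightarrow> msat M e \<phi>"
proof (induction arbitrary: e e' rule: delta0.induct)
  case (1 s t)
  then show ?case by (intro rsat_F_Eq)
next
  case (2 s t)
  then show ?case by (intro rsat_F_Lt)
next
  case (5 \<phi> t)
  have ext: "F ((a ## e) i) ((c ## e') i)" if "F a c" for a c i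
    using that 5(3) by (cases i) auto
  have lt: "rsat R (c ## e') (Lt (Var 0) (lift_tm 0 t)) \<longleftrightarrow> a \<lhd> meval M e t" if "F a c" for a c
    using rsat_F_Lt[of "Var 0" "lift_tm 0 t" "a ## e" "c ## e'"] ext[OF that] by simp
  have st: "\<exists>a. F a c" if h: "rsat R (c ## e') (Lt (Var 0) (lift_tm 0 t))" for c
  proof -
    obtain u w where "R 0 [c, u]" "rval R e' t w" "R 5 [u, w]" using h by (auto simp: rval_lift)
    then have "F (meval M e t) w" "R 5 [c, w]"
      using rval_F[of t e e'] 5(3) less_cong eq_sym eq_refl by blast+
    then show ?thesis using F_initial by blast
  qed
  have ih: "rsat R (c ## e') \<phi> \<longleftrightarrow> msat M (a ## e) \<phi>" if "F a c" for a c
    by (rule 5(2)) (rule ext[OF that])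
  have "rsat R e' (Forall (Imp (Lt (Var 0) (lift_tm 0 t)) \<phi>)) \<longleftrightarrow>
      (\<forall>c. rsat R (c ## e') (Lt (Var 0) (lift_tm 0 t)) \<longrightarrow> rsat R (c ## e') \<phi>)"
    by (simp only: rsat.simps(4,5))
  also have "\<dots> \<longleftrightarrow> (\<forall>a. a \<lhd> meval M e t \<longrightarrow> msat M (a ## e) \<phi>)"
    using ih lt st F_ex by blast
  finally show ?case by simp
next
  case (6 \<phi> t)
  have ext: "F ((a ## e) i) ((c ## e') i)" if "F a c" for a c i
    using that 6(3) by (cases i) auto
  have lt: "rsat R (c ## e') (Lt (Var 0) (lift_tm 0 t)) \<longleftrightarrow> a \<lhd> meval M e t" if "F a c" for a c
    using rsat_F_Lt[of "Var 0" "lift_tm 0 t" "a ## e" "c ## e'"] ext[OF that] by simp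
  have st: "\<exists>a. F a c" if h: "rsat R (c ## e') (Lt (Var 0) (lift_tm 0 t))" for c
  proof -
    obtain u w where "R 0 [c, u]" "rval R e' t w" "R 5 [u, w]" using h by (auto simp: rval_lift)
    then have "F (meval M e t) w" "R 5 [c, w]"
      using rval_F[of t e e'] 6(3) less_cong eq_sym eq_refl by blast+
    then show ?thesis using F_initial by blast
  qed
  have ih: "rsat R (c ## e') \<phi> \<longleftrightarrow> msat M (a ## e) \<phi>" if "F a c" for a c
    by (rule 6(2)) (rule ext[OF that])
  have "rsat R e' (Exists (Conj (Lt (Var 0) (lift_tm 0 t)) \<phi>)) \<longleftrightarrow>
      (\<exists>c. rsat R (c ## e') (Lt (Var 0) (lift_tm 0 t)) \<and> rsat R (c ## e') \<phi>)"
    by (simp only: rsat.simps(3-5)) blast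
  also have "\<dots> \<longleftrightarrow> (\<exists>a. a \<lhd> meval M e t \<and> msat M (a ## e) \<phi>)"
    using ih lt st F_ex by blast
  finally show ?case by simp
next
  case (3 \<phi>)
  have "rsat R e' \<phi> \<longleftrightarrow> msat M e \<phi>" by (rule 3(2)) (rule 3(3))
  then show ?case by simp
next
  case (4 \<phi> \<psi>)
  have "rsat R e' \<phi> \<longleftrightarrow> msat M e \<phi>" by (rule "4.IH"(1)) (rule "4.prems")
  moreover have "rsat R e' \<psi> \<longleftrightarrow> msat M e \<psi>" by (rule "4.IH"(2)) (rule "4.prems")
  ultimately show ?case by simp
qed

lemma rsat_F_onto:
  assumes onto: "\<And>c. \<exists>a. F a c"
  shows "(\<And>i. i \<in> fv \<phi> \<Longrightarrow> F (e i) (e' i)) \<Longrightarrow> rsat R e' \<phi> \<longleftrightarrow> msat M e \<phi>"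
proof (induction \<phi> arbitrary: e e')
  case (Eq s t)
  then show ?case by (rule rsat_F_Eq)
next
  case (Lt s t)
  then show ?case by (rule rsat_F_Lt)
next
  case (Forall \<phi>)
  have ext: "F ((a ## e) i) ((c ## e') i)" if "F a c" "i \<in> fv \<phi>" for a c i
    using that Forall.prems by (cases i) auto
  have "rsat R (c ## e') \<phi> \<longleftrightarrow> msat M (a ## e) \<phi>" if "F a c" for a c
    by (rule Forall.IH) (rule ext[OF that])
  then show ?case using onto F_ex by (simp only: rsat.simps msat.simps) blast
next
  case (Neg \<phi>)
  have "rsat R e' \<phi> \<longleftrightarrow> msat M e \<phi>" by (rule Neg.IH) (simp add: Neg.prems)
  then show ?case by simp
next
  case (Imp \<phi> \<psi>)
  have "rsat R e' \<phi> \<longleftrightarrow> msat M e \<phi>" "rsat R e' \<psi> \<longleftrightarrow> msat M e \<psi>"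
    by (rule Imp.IH, simp add: Imp.prems)+
  then show ?case by simp
qed

lemma rbit_cong: "R 0 [i, j] \<Longrightarrow> rbit R a b i \<longleftrightarrow> rbit R a b j"
  unfolding rbit_def using suc_iff eq_refl eq_sym by meson

text \<open>Tennenbaum's theorem inside \<open>M\<close>: if \<open>c\<close> lies above all numerals, the separating set coded up to \<open>c\<close> is
  recursive in \<open>M\<close>, and its indices refute this.\<close>

lemma F_onto:
  assumes coding: "rel_coding \<kappa>1 \<kappa>0 R" and "delta0 \<kappa>1" "delta0 \<kappa>0"
    and U1: "\<And>e. msat M e (Univ1 0) \<longleftrightarrow> (\<exists>s. msat M (s ## e) \<kappa>1)"
    and U0: "\<And>e. msat M e (Univ0 0) \<longleftrightarrow> (\<exists>s. msat M (s ## e) \<kappa>0)"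
  shows "\<exists>a. F a c"
proof (rule ccontr)
  assume c: "\<not> (\<exists>a. F a c)"
  \<comment> \<open>A numeral that is not below c would make c a numeral, by initiality.\<close>
  have below: "R 5 [y, c]" if "F x y" for x y
    using c that F_initial F_cong rless_cases eq_sym by blast
  obtain a b where ab: "\<And>i. R 5 [i, c] \<Longrightarrow> rbit R a b i \<longleftrightarrow>
     (\<exists>s. R 5 [s, c] \<and> rsat R (s ## (\<lambda>_. i)) \<kappa>1 \<and>
       (\<forall>t. R 5 [t, s] \<or> R 0 [t, s] \<longrightarrow> \<not> rsat R (t ## (\<lambda>_. i)) \<kappa>0))"
    using coding unfolding rel_coding_def by blast
  \<comment> \<open>The trace of the coded set on the numerals, pulled back to
    \<open>M\<close>.\<close>
  define P where "P x \<longleftrightarrow> (\<exists>y. F x y \<and> rbit R a b y)" for x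
  have "SD M (\<lambda>e. P (e 0))"
    unfolding P_def rbit_def by (intro SDs SD_rel TD_intros)
  then obtain h where h: "\<And>n. univ h n \<longleftrightarrow> P n" using univ_universal by blast
  have "SD M (\<lambda>e. \<exists>y. F (e 0) y \<and> rnbit R a b y)"
    unfolding rnbit_def by (intro SDs SD_rel TD_intros)
  moreover have P: "P x \<longleftrightarrow> rbit R a b y" if "F x y" for x y
    using that F_unique rbit_cong unfolding P_def by blast
  then have "(\<exists>y. F x y \<and> rnbit R a b y) \<longleftrightarrow> \<not> P x" for x
    using F_ex rbit_iff by metis
  ultimately have "SD M (\<lambda>e. \<not> P (e 0))" by simp
  then obtain g where g: "\<And>n. univ g n \<longleftrightarrow> \<not> P n" using univ_universal[of "\<lambda>x. \<not> P x"] by blast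
  \<comment> \<open>The diagonal point: \<open>Univ1\<close> holds of it exactly if it lies outside
    P, \<open>Univ0\<close> exactly if it lies in P.\<close>
  define n where "n = pr g h"
  obtain y where y: "F n y" using F_ex by blast
  have 1: "(\<exists>s. msat M (s ## (\<lambda>_. n)) \<kappa>1) \<longleftrightarrow> \<not> P n"
    using U1[of "\<lambda>_. n"] msat_Univ1[of "\<lambda>_. n"] g by (simp add: n_def)
  have 0: "(\<exists>s. msat M (s ## (\<lambda>_. n)) \<kappa>0) \<longleftrightarrow> P n"
    using U0[of "\<lambda>_. n"] msat_Univ0[of "\<lambda>_. n"] h by (simp add: n_def)
  have abs: "rsat R (t ## (\<lambda>_. y)) \<kappa> \<longleftrightarrow> msat M (s ## (\<lambda>_. n)) \<kappa>" if "delta0 \<kappa>" "F s t" for s t \<kappa>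
    by (rule rsat_F_delta0[OF that(1)]) (use y that(2) in \<open>auto split: nat.split\<close>)
  show False
  proof (cases "P n")
    case True
    then obtain s where s: "R 5 [s, c]" "rsat R (s ## (\<lambda>_. y)) \<kappa>1"
      "\<And>t. R 5 [t, s] \<or> R 0 [t, s] \<Longrightarrow> \<not> rsat R (t ## (\<lambda>_. y)) \<kappa>0"
      using ab[OF below[OF y]] P[OF y] by blast
    \<comment> \<open>Some numeral is a witness for \<kappa>0, so s lies below it and is itself a
      numeral. Its preimage is then a witness for \<kappa>1 in \<open>M\<close>, which is impossible
      for n in P.\<close>
    obtain t0 t where t: "msat M (t0 ## (\<lambda>_. n)) \<kappa>0" "F t0 t" using 0 True F_ex by blast
    then have "R 5 [s, t]" using s(3) abs[OF assms(3)] rless_cases by blast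
    then obtain s0 where "F s0 s" using F_initial t(2) by blast
    then show False using s(2) abs[OF assms(2)] 1 True by blast
  next
    case False
    then obtain s0 s where s: "msat M (s0 ## (\<lambda>_. n)) \<kappa>1" "F s0 s" using 1 F_ex by blast
    \<comment> \<open>Everything up to the numeral s is a numeral, so a witness for \<kappa>0 there
      would come from one in \<open>M\<close>.\<close>
    have "\<not> rsat R (t ## (\<lambda>_. y)) \<kappa>0" if h: "R 5 [t, s] \<or> R 0 [t, s]" for t
    proof -
      obtain t0 where "F t0 t" using h s(2) F_initial F_cong eq_sym by blast
      then show ?thesis using abs[OF assms(3)] 0 False by blast
    qed
    then have "rbit R a b y"
      using ab[OF below[OF y]] below[OF s(2)] s abs[OF assms(2)] by blast
    then show False using P[OF y] False by blast
  qed
qed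

end

section \<open>Translating arithmetic into predicate logic\<close>

text \<open>\<open>rt n t j\<close> reads: t, whose variables are taken from outside n new
  quantifiers, has the value of variable j. Nested terms become existential statements because the
  modal language has no function symbols.\<close>

fun rt :: "nat \<Rightarrow> tm \<Rightarrow> nat \<Rightarrow> mfm" where
  "rt n (Var i) j = MPred 0 [i + n, j]"
| "rt n Zero j = MPred 1 [j]"
| "rt n (Succ t) j = MEx (MConj (rt (Suc n) t 0) (MPred 2 [0, Suc j]))"
| "rt n (Plus s t) j = MEx (MEx (MConj (rt (Suc (Suc n)) s 1) (MConj (rt (Suc (Suc n)) t 0)
     (MPred 3 [1, 0, Suc (Suc j)]))))"
| "rt n (Times s t) j = MEx (MEx (MConj (rt (Suc (Suc n)) s 1) (MConj (rt (Suc (Suc n)) t 0)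
     (MPred 4 [1, 0, Suc (Suc j)]))))"

fun rf :: "fm \<Rightarrow> mfm" where
  "rf (Eq s t) = MEx (MConj (rt 1 s 0) (rt 1 t 0))"
| "rf (Lt s t) = MEx (MEx (MConj (rt 2 s 1) (MConj (rt 2 t 0) (MPred 5 [1, 0]))))"
| "rf (Neg \<phi>) = MNeg (rf \<phi>)"
| "rf (Imp \<phi> \<psi>) = MImp (rf \<phi>) (rf \<psi>)"
| "rf (Forall \<phi>) = MAll (rf \<phi>)"

definition Rf :: "'a model \<Rightarrow> interp \<Rightarrow> nat \<Rightarrow> 'a list \<Rightarrow> bool" where
  "Rf M f P xs \<longleftrightarrow> msat M (\<lambda>i. if i < length xs then xs ! i else mZero M) (f P (length xs))"

lemma Rf_iff: "arith_interp f \<Longrightarrow> (\<And>i. i < length xs \<Longrightarrow> e i = xs ! i) \<Longrightarrow>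
    msat M e (f P (length xs)) \<longleftrightarrow> Rf M f P xs"
  unfolding Rf_def arith_interp_def by (intro msat_cong) auto

lemma msat_MPred: "arith_interp f \<Longrightarrow> msat M e (interpret_fm f \<tau> (MPred P ys)) \<longleftrightarrow> Rf M f P (map e ys)"
  using Rf_iff[of f "map e ys" "\<lambda>i. e (ys ! i)" M P] by (simp add: msat_psubst)

declare interpret_fm.simps(1) [simp del]

lemma msat_rt: "arith_interp f \<Longrightarrow>
    msat M e (interpret_fm f \<tau> (rt n t j)) \<longleftrightarrow> rval (Rf M f) (\<lambda>i. e (i + n)) t (e j)"
  by (induction t arbitrary: n e j) (simp_all add: msat_MPred)

lemma msat_rf: "arith_interp f \<Longrightarrow> msat M e (interpret_fm f \<tau> (rf \<phi>)) \<longleftrightarrow> rsat (Rf M f) e \<phi>"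
  by (induction \<phi> arbitrary: e) (simp_all add: msat_MPred msat_rt)

definition mconjs :: "mfm list \<Rightarrow> mfm" where
  "mconjs As = foldr MConj As (MNeg MBot)"

lemma (in isig) msat_mconjs:
  "msat M e (interpret_fm f \<tau> (mconjs As)) \<longleftrightarrow> (\<forall>A\<in>set As. msat M e (interpret_fm f \<tau> A))"
  unfolding mconjs_def by (induction As) (simp_all add: num_def)

abbreviation MIff :: "mfm \<Rightarrow> mfm \<Rightarrow> mfm" where "MIff A B \<equiv> MConj (MImp A B) (MImp B A)"

definition mbit :: "nat \<Rightarrow> nat \<Rightarrow> nat \<Rightarrow> mfm" where
  "mbit a b i = MEx (MEx (MEx (MEx (mconjs [MPred 2 [i + 4, 3], MPred 4 [3, b + 4, 2], MPred 2 [2, 1],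
     MPred 4 [0, 1, a + 4]]))))"

definition mnbit :: "nat \<Rightarrow> nat \<Rightarrow> nat \<Rightarrow> mfm" where
  "mnbit a b i = MEx (MEx (MEx (MEx (MEx (MEx (MEx (mconjs [MPred 2 [i + 7, 6], MPred 4 [6, b + 7, 5],
     MPred 2 [5, 4], MPred 4 [3, 4, 2], MPred 5 [1, 4], MPred 3 [2, 1, a + 7], MPred 1 [0],
     MPred 5 [0, 1]])))))))"

text \<open>The clauses follow the assumptions of \<open>rel_arith\<close> in their order, so that
  the two can be compared one by one.\<close>

definition marith :: mfm where
  "marith = mconjs
    [MAll (MPred 0 [0, 0]),
     MAll (MAll (MImp (MPred 0 [1, 0]) (MPred 0 [0, 1]))),
     MAll (MAll (MAll (MImp (MPred 0 [2, 1]) (MImp (MPred 0 [1, 0]) (MPred 0 [2, 0]))))),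
     MEx (MPred 1 [0]),
     MAll (MAll (MImp (MPred 1 [1]) (MIff (MPred 1 [0]) (MPred 0 [1, 0])))),
     MAll (MEx (MPred 2 [1, 0])),
     MAll (MAll (MAll (MAll (MImp (MPred 0 [3, 2]) (MImp (MPred 2 [3, 1]) (MIff (MPred 2 [2, 0]) (MPred 0 [1, 0]))))))),
     MAll (MAll (MEx (MPred 3 [2, 1, 0]))),
     MAll (MAll (MAll (MAll (MAll (MAll (MImp (MPred 0 [5, 4]) (MImp (MPred 0 [3, 2]) (MImp (MPred 3 [5, 3, 1])
       (MIff (MPred 3 [4, 2, 0]) (MPred 0 [1, 0])))))))))),
     MAll (MAll (MEx (MPred 4 [2, 1, 0]))),
     MAll (MAll (MAll (MAll (MAll (MAll (MImp (MPred 0 [5, 4]) (MImp (MPred 0 [3, 2]) (MImp (MPred 4 [5, 3, 1])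
       (MIff (MPred 4 [4, 2, 0]) (MPred 0 [1, 0])))))))))),
     MAll (MAll (MAll (MAll (MImp (MPred 0 [3, 2]) (MImp (MPred 0 [1, 0]) (MImp (MPred 5 [3, 1]) (MPred 5 [2, 0]))))))),
     MAll (MAll (MImp (MPred 1 [0]) (MPred 3 [1, 0, 1]))),
     MAll (MAll (MAll (MAll (MAll (MImp (MPred 3 [4, 3, 1]) (MImp (MPred 2 [3, 2]) (MImp (MPred 2 [1, 0])
       (MPred 3 [4, 2, 0])))))))),
     MAll (MAll (MImp (MPred 1 [0]) (MPred 4 [1, 0, 0]))),
     MAll (MAll (MAll (MAll (MAll (MImp (MPred 4 [4, 3, 1]) (MImp (MPred 2 [3, 2]) (MImp (MPred 3 [1, 4, 0])
       (MPred 4 [4, 2, 0])))))))),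
     MAll (MAll (MImp (MPred 1 [0]) (MNeg (MPred 5 [1, 0])))),
     MAll (MAll (MAll (MImp (MPred 2 [1, 0]) (MIff (MPred 5 [2, 0]) (MDisj (MPred 5 [2, 1]) (MPred 0 [2, 1])))))),
     MAll (MAll (MDisj (MPred 5 [1, 0]) (MDisj (MPred 0 [1, 0]) (MPred 5 [0, 1])))),
     MAll (MAll (MImp (MPred 5 [1, 0]) (MNeg (MPred 0 [1, 0])))),
     MAll (MAll (MAll (MImp (MPred 5 [2, 1]) (MImp (MPred 5 [1, 0]) (MPred 5 [2, 0]))))),
     MAll (MAll (MAll (MImp (MPred 5 [2, 0]) (MImp (MPred 2 [2, 1]) (MDisj (MPred 5 [1, 0]) (MPred 0 [1, 0])))))),
     MAll (MAll (MAll (MIff (mbit 2 1 0) (MNeg (mnbit 2 1 0)))))]"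

text \<open>Every variable of the two matrices except the witness is renamed to the tested element
  i, which matches the environment \<open>s ## (\<lambda>_. i)\<close> in
  \<open>rel_coding\<close>.\<close>

definition mcoding :: "fm \<Rightarrow> fm \<Rightarrow> mfm" where
  "mcoding \<kappa>1 \<kappa>0 = MAll (MEx (MEx (MAll (MImp (MPred 5 [0, 3]) (MIff (mbit 2 1 0)
     (MEx (MConj (rf (psubst (\<lambda>k. Var (if k = 0 then 0 else 1)) \<kappa>1)) (MConj (MPred 5 [0, 4])
       (MAll (MImp (MDisj (MPred 5 [0, 1]) (MPred 0 [0, 1]))
         (MNeg (rf (psubst (\<lambda>k. Var (if k = 0 then 0 else 2)) \<kappa>0)))))))))))))"

context isig
begin

lemma msat_mbit: "arith_interp f \<Longrightarrow>
    msat M e (interpret_fm f \<tau> (mbit a b i)) \<longleftrightarrow> rbit (Rf M f) (e a) (e b) (e i)"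
  by (simp add: mbit_def rbit_def msat_mconjs msat_MPred numeral_eq_Suc)

lemma msat_mnbit: "arith_interp f \<Longrightarrow>
    msat M e (interpret_fm f \<tau> (mnbit a b i)) \<longleftrightarrow> rnbit (Rf M f) (e a) (e b) (e i)"
  by (simp add: mnbit_def rnbit_def msat_mconjs msat_MPred numeral_eq_Suc)

lemma msat_marith:
  assumes f: "arith_interp f"
  shows "msat M e (interpret_fm f \<tau> marith) \<longleftrightarrow> rel_arith (Rf M f)"
  unfolding marith_def rel_arith_def msat_mconjs list.set ball_simps simp_thms conj_assoc
  by (intro arg_cong2[where f = "(\<and>)"];
      simp add: msat_MPred[OF f] msat_mbit[OF f] msat_mnbit[OF f] numeral_eq_Suc; blast?)

lemma msat_mcoding:
  assumes f: "arith_interp f"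
  shows "msat M e (interpret_fm f \<tau> (mcoding \<kappa>1 \<kappa>0)) \<longleftrightarrow> rel_coding \<kappa>1 \<kappa>0 (Rf M f)"
proof -
  have 1: "(\<lambda>k. (s ## i ## e) (if k = 0 then 0 else 1)) = s ## (\<lambda>_. i)" for s i and e :: "nat \<Rightarrow> 'a"
    by (auto simp: fun_eq_iff split: nat.split)
  have 2: "(\<lambda>k. (t ## s ## i ## e) (if k = 0 then 0 else 2)) = t ## (\<lambda>_. i)" for t s i and e :: "nat \<Rightarrow> 'a"
    by (auto simp: fun_eq_iff numeral_2_eq_2 split: nat.split)
  have 3: "(\<not> A \<and> \<not> B \<or> \<not> C) = ((A \<longrightarrow> \<not> C) \<and> (B \<longrightarrow> \<not> C))" for A B C by blast
  have ex: "msat M e (interpret_fm f \<tau> (MEx A)) \<longleftrightarrow> (\<exists>a. msat M (a ## e) (interpret_fm f \<tau> A))"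
    and conj: "msat M e (interpret_fm f \<tau> (MConj A B)) \<longleftrightarrow>
      msat M e (interpret_fm f \<tau> A) \<and> msat M e (interpret_fm f \<tau> B)"
    and disj: "msat M e (interpret_fm f \<tau> (MDisj A B)) \<longleftrightarrow>
      msat M e (interpret_fm f \<tau> A) \<or> msat M e (interpret_fm f \<tau> B)"
    and iff: "msat M e (interpret_fm f \<tau> (MIff A B)) \<longleftrightarrow>
      (msat M e (interpret_fm f \<tau> A) \<longleftrightarrow> msat M e (interpret_fm f \<tau> B))"
    and imp: "msat M e (interpret_fm f \<tau> (MImp A B)) \<longleftrightarrow>
      (msat M e (interpret_fm f \<tau> A) \<longrightarrow> msat M e (interpret_fm f \<tau> B))"
    and neg: "msat M e (interpret_fm f \<tau> (MNeg A)) \<longleftrightarrow> \<not> msat M e (interpret_fm f \<tau> A)"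
    and all: "msat M e (interpret_fm f \<tau> (MAll A)) \<longleftrightarrow> (\<forall>a. msat M (a ## e) (interpret_fm f \<tau> A))"
    for e A B by auto
  show ?thesis
    unfolding mcoding_def rel_coding_def
    by (simp only: all ex imp, simp only: iff, simp only: ex conj disj imp all neg msat_MPred[OF f]
        msat_mbit[OF f] msat_rf[OF f] rsat_rename 1 2) (simp add: numeral_eq_Suc 3)
qed

end

section \<open>The standard interpretation\<close>

text \<open>An interpretation has to assign formulas with exactly the right free variables to the unused symbols,
  too.\<close>

fun dummy_fm :: "nat \<Rightarrow> fm" where
  "dummy_fm 0 = Eq Zero Zero"
| "dummy_fm (Suc n) = Conj (Eq (Var n) (Var n)) (dummy_fm n)"

definition std_interp :: interp where
  "std_interp P n =
    (if P = 0 \<and> n = 2 then Eq (Var 0) (Var 1) else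
     if P = 1 \<and> n = 1 then Eq (Var 0) Zero else
     if P = 2 \<and> n = 2 then Eq (Succ (Var 0)) (Var 1) else
     if P = 3 \<and> n = 3 then Eq (Plus (Var 0) (Var 1)) (Var 2) else
     if P = 4 \<and> n = 3 then Eq (Times (Var 0) (Var 1)) (Var 2) else
     if P = 5 \<and> n = 2 then Lt (Var 0) (Var 1) else dummy_fm n)"

lemma sigma1_std_interp: "sigma1_interp std_interp"
proof -
  have 1: "fv (dummy_fm n) = {..<n}" for n
  proof (induction n)
    case (Suc n)
    then show ?case by (simp add: lessThan_Suc)
  qed simp
  have 2: "delta0 (dummy_fm n)" for n
    by (induction n) (simp_all add: delta0.intros(1-4))
  have "fv (std_interp P n) = {..<n}" for P n
    using 1 by (simp add: std_interp_def numeral_2_eq_2 numeral_3_eq_3 lessThan_Suc insert_commute)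
  moreover have "sigma1 (std_interp P n)" for P n
    by (rule sigma1.intros(1)) (simp add: std_interp_def 2 delta0.intros(1,2))
  ultimately show ?thesis by (simp add: sigma1_interp_def arith_interp_def)
qed

lemma arith_std_interp: "arith_interp std_interp"
  using sigma1_std_interp by (simp add: sigma1_interp_def)

lemma DD_fm:
  assumes "delta0 \<phi>" "\<And>i. TD M (\<lambda>e. \<sigma> e i)"
  shows "DD M (\<lambda>e. msat M (\<sigma> e) \<phi>)"
proof (rule defin_subst[OF _ _ assms(2)])
  show "DD M (\<lambda>e. msat M e \<phi>)"
    by (rule defin_I[of _ "psubst (\<lambda>i. Var (2 * i)) \<phi>" _ _ undefined])
      (auto simp: msat_psubst mix_def intro: delta0_psubst assms)
qed simp

lemma DD_ball:
  assumes "TD M t" "DD M (\<lambda>e. Q (e 0) (\<lambda>i. e (Suc i)))"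
  shows "DD M (\<lambda>e. \<forall>a. mLess M a (t e) \<longrightarrow> Q a e)"
proof -
  obtain p u \<phi> where 1: "\<And>e. t e = meval M (mix e p) u" "delta0 \<phi>"
      "\<And>e. Q (e 0) (\<lambda>i. e (Suc i)) = msat M (mix e p) \<phi>"
    using defin_TD_E2[OF assms psubst_closed(1)] by blast
  let ?\<sigma> = "\<lambda>i. Var (if i = 0 then 0 else if even i then i - 1 else Suc i)"
  have "Q a e = msat M (a ## mix e p) (psubst ?\<sigma> \<phi>)" for a e
    unfolding msat_psubst meval.simps mix_econs[symmetric] using 1(3)[of "a ## e"] by simp
  then show ?thesis
    by (intro defin_I[of _ "Forall (Imp (Lt (Var 0) (lift_tm 0 u)) (psubst ?\<sigma> \<phi>))" _ _ p])
      (auto simp: 1(1) intro: delta0.intros delta0_psubst 1(2))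
qed

context isig
begin

abbreviation "Rs \<equiv> Rf M std_interp"

lemma Rs_simps [simp]: "Rs 0 [x, y] \<longleftrightarrow> x = y" "Rs (Suc 0) [x] \<longleftrightarrow> x = \<zero>" "Rs 2 [x, y] \<longleftrightarrow> S x = y"
  "Rs 3 [x, y, z] \<longleftrightarrow> x \<oplus> y = z" "Rs 4 [x, y, z] \<longleftrightarrow> x \<odot> y = z" "Rs 5 [x, y] \<longleftrightarrow> x \<lhd> y"
  by (simp_all add: Rf_def std_interp_def)

lemma rbit_Rs: "rbit Rs a b i \<longleftrightarrow> (\<exists>q. q \<odot> S (S i \<odot> b) = a)"
  by (simp add: rbit_def)

lemma rnbit_Rs: "rnbit Rs a b i \<longleftrightarrow> (\<exists>q r. q \<odot> S (S i \<odot> b) \<oplus> r = a \<and> r \<lhd> S (S i \<odot> b) \<and> \<zero> \<lhd> r)"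
  by (simp add: rnbit_def)

lemma rbit_Rs_iff: "rbit Rs a b i \<longleftrightarrow> \<not> rnbit Rs a b i"
proof -
  let ?m = "S (S i \<odot> b)"
  obtain q r where qr: "a = q \<odot> ?m \<oplus> r" "r \<lhd> ?m" using division[OF zero_less_Suc] by blast
  have unique: "q' = q \<and> r' = r" if "q' \<odot> ?m \<oplus> r' = a" "r' \<lhd> ?m" for q' r'
    using remainder_unique[of q' ?m r' q r] that qr by simp
  have "rbit Rs a b i \<longleftrightarrow> r = \<zero>"
    unfolding rbit_Rs using unique[of _ \<zero>] qr(1) zero_less_Suc by (metis add_zero)
  moreover have "rnbit Rs a b i \<longleftrightarrow> \<zero> \<lhd> r"
    unfolding rnbit_Rs using unique qr by metis
  ultimately show ?thesis using zero_leq[of r] by (auto simp: leq_def)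
qed

lemma rel_arith_Rs: "rel_arith Rs"
  by unfold_locales
    (auto simp: rbit_Rs_iff add_zero add_Suc mul_zero mul_Suc less_Suc less_cases intro: less_trans
      dest: Suc_less_Suc)

text \<open>With the identity in the part of F, the general isomorphism lemma yields
  \<open>rsat_Rs\<close> for the standard interpretation.\<close>

lemma relstruct_Rs: "relstruct M Rs (=)"
proof -
  interpret rel_arith Rs by (rule rel_arith_Rs)
  show ?thesis
  proof
    show "SD M (\<lambda>e. Rs P (map (\<lambda>t. t e) ts))" if "\<And>t. t \<in> set ts \<Longrightarrow> TD M t" for P ts
    proof -
      have "TD M (\<lambda>e. if i < length (map (\<lambda>t. t e) ts) then map (\<lambda>t. t e) ts ! i else \<zero>)" for i
        by (cases "i < length ts") (auto intro: that TD_const)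
      then show ?thesis
        unfolding Rf_def length_map
        by (intro SD_fm) (use sigma1_std_interp in \<open>auto simp: sigma1_interp_def intro: sigma1_sigma_fm\<close>)
    qed
    show "SD M (\<lambda>e. e 0 = e 1)" by (intro SD_delta DDs TD_intros)
  qed auto
qed

lemma rsat_Rs: "rsat Rs e \<phi> \<longleftrightarrow> msat M e \<phi>"
  by (rule relstruct.rsat_F_onto[OF relstruct_Rs]) auto

text \<open>All witnesses are compared below u, so membership is \<Delta>0 in \<open>M\<close>; its
  truth values true and false are coded as the remainders 0 and 1.\<close>

lemma rel_coding_Rs:
  assumes "delta0 \<kappa>1" "delta0 \<kappa>0"
  shows "rel_coding \<kappa>1 \<kappa>0 Rs"
  unfolding rel_coding_def
proof
  fix u
  \<comment> \<open>Written with bounded universal quantifiers, the form that \<open>DD_ball\<close>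
    handles; the bound \<open>S s\<close> means at most s.\<close>
  define \<theta> where "\<theta> i \<longleftrightarrow> \<not> (\<forall>s. s \<lhd> u \<longrightarrow> \<not> (msat M (s ## (\<lambda>_. i)) \<kappa>1 \<and>
    (\<forall>t. t \<lhd> S s \<longrightarrow> \<not> msat M (t ## (\<lambda>_. i)) \<kappa>0)))" for i
  have \<theta>: "DD M (\<lambda>e. \<theta> (e 0))"
    unfolding \<theta>_def by (intro DD_not DD_ball DD_conj DD_fm TD_econs TD_intros assms)
  let ?V = "\<lambda>i v. \<theta> i \<and> v = \<zero> \<or> \<not> \<theta> i \<and> v = S \<zero>"
  have "\<exists>a b. \<forall>i. i \<lhd> u \<longrightarrow> (\<exists>v. beta a b i v \<and> ?V i v)"
  proof (rule beta_comprehension[where B = "S (S \<zero>)"])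
    show "SD M (\<lambda>e. ?V (e 0) (e 1))" by (intro SD_delta DDs \<theta> TD_intros)
    show "\<exists>v. v \<lhd> S (S \<zero>) \<and> ?V i v" for i using less_Suc by blast
  qed
  then obtain a b where ab: "\<And>i. i \<lhd> u \<Longrightarrow> \<exists>v. beta a b i v \<and> ?V i v" by blast
  have bit: "rbit Rs a b i \<longleftrightarrow> beta a b i \<zero>" for i
    unfolding rbit_Rs beta_def using zero_less_Suc by (auto simp: add_zero)
  have "rbit Rs a b i \<longleftrightarrow> \<theta> i" if "i \<lhd> u" for i
    using ab[OF that] beta_fun[of a b i \<zero>] unfolding bit by (metis Suc_not_zero(2))
  then show "\<exists>a b. \<forall>i. Rs 5 [i, u] \<longrightarrow> (rbit Rs a b i \<longleftrightarrow>
     (\<exists>s. Rs 5 [s, u] \<and> rsat Rs (s ## (\<lambda>_. i)) \<kappa>1 \<and>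
       (\<forall>t. Rs 5 [t, s] \<or> Rs 0 [t, s] \<longrightarrow> \<not> rsat Rs (t ## (\<lambda>_. i)) \<kappa>0)))"
    unfolding \<theta>_def rsat_Rs by (intro exI[of _ a] exI[of _ b]) (simp add: less_Suc)
qed

end

section \<open>The numerals of an interpreted structure\<close>

definition FStep :: "fm \<Rightarrow> fm \<Rightarrow> (dtm \<Rightarrow> dfm) \<Rightarrow> dtm \<Rightarrow> dfm" where
  "FStep \<zeta> \<sigma> E z = ((\<^bold>\<exists>y. Tup [dnum 0, y] z \<^bold>\<and> (\<lambda>d. psubst (\<lambda>_. y d) \<zeta>)) \<^bold>\<or>
     (\<^bold>\<exists>k. \<^bold>\<exists>y. \<^bold>\<exists>w. Tup [dS k, w] z \<^bold>\<and> among E [k, y] \<^bold>\<and> (\<lambda>d. psubst (\<lambda>i. if i = 0 then y d else w d) \<sigma>)))"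

text \<open>\<zeta> and \<sigma> are to be the interpretations of zero and successor. A formula is
  wanted here, and not just a relation on \<open>M\<close>, because the isomorphism will also be
  spoken of under the provability predicate.\<close>

definition FF :: "fm \<Rightarrow> fm \<Rightarrow> fm" where
  "FF \<zeta> \<sigma> = among (Ind (FStep \<zeta> \<sigma>)) [free 0, free 1] 0"

lemma dsig_FF: "sigma_fm \<zeta> \<Longrightarrow> sigma_fm \<sigma> \<Longrightarrow> dsig (among (Ind (FStep \<zeta> \<sigma>)) xs)"
  unfolding FStep_def[abs_def] by (intro dsig_among dsig_Ind dsig_intros dsig_psubst)

context isig
begin

definition stF where
  "stF \<zeta> \<sigma> E z \<longleftrightarrow> (\<exists>y. z = pr (cd 0) y \<and> msat M (\<lambda>_. y) \<zeta>) \<or>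
     (\<exists>k. \<exists>y. \<exists>w. z = pr (S k) w \<and> E (pr k y) \<and> msat M (\<lambda>i. if i = 0 then y else w) \<sigma>)"

definition Fr where "Fr \<zeta> \<sigma> x y = IND (stF \<zeta> \<sigma>) (pr x y)"

lemma mono_stF: "mono_step (stF \<zeta> \<sigma>)"
  unfolding mono_step_def stF_def
  by (intro allI, rule impI, (rule imp_refl disj_mono conj_mono ex_mono | erule spec)+)

lemma dsat_psubst2: "den c y a \<Longrightarrow> den c w b \<Longrightarrow>
    dsat c (\<lambda>d. psubst (\<lambda>i. if i = 0 then y d else w d) \<phi>) (msat M (\<lambda>i. if i = 0 then a else b) \<phi>)"
  unfolding den_def dsat_def msat_psubst by (auto intro!: arg_cong[of _ _ "\<lambda>e. msat M e \<phi>"])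

lemma dsat_FF: "dsat (0, e) (among (Ind (FStep \<zeta> \<sigma>)) [free 0, free 1]) (Fr \<zeta> \<sigma> (e 0) (e 1))"
  unfolding Fr_def
  apply (rule dsat_among2[where P = "IND (stF \<zeta> \<sigma>)"], rule mean_Ind)
  subgoal for c' E P z a
    unfolding stF_def FStep_def
    by (rule dsat_intros dsat_Tup2 dsat_among2[where P=P and E=E] dsat_tau dsat_psubst2 den_intros
        | assumption | rule den_up, assumption | rule mean_up, assumption)+
  by (rule den_free)+

lemma msat_FF: "msat M e (FF \<zeta> \<sigma>) \<longleftrightarrow> Fr \<zeta> \<sigma> (e 0) (e 1)"
  unfolding FF_def by (rule dsat_msat[OF dsat_FF])

lemma Fr_zero: "Fr \<zeta> \<sigma> \<zero> y \<longleftrightarrow> msat M (\<lambda>_. y) \<zeta>"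
proof
  assume "Fr \<zeta> \<sigma> \<zero> y"
  from IND_unfold[OF mono_stF this[unfolded Fr_def]] show "msat M (\<lambda>_. y) \<zeta>" by (auto simp: stF_def)
next
  assume "msat M (\<lambda>_. y) \<zeta>"
  then show "Fr \<zeta> \<sigma> \<zero> y" unfolding Fr_def
    by (intro IND_intro0[OF mono_stF]) (auto simp: stF_def cd.simps)
qed

lemma Fr_Suc: "Fr \<zeta> \<sigma> (S k) w \<longleftrightarrow> (\<exists>y. Fr \<zeta> \<sigma> k y \<and> msat M (\<lambda>i. if i = 0 then y else w) \<sigma>)"
proof
  assume "Fr \<zeta> \<sigma> (S k) w"
  from IND_unfold[OF mono_stF this[unfolded Fr_def]]
  show "\<exists>y. Fr \<zeta> \<sigma> k y \<and> msat M (\<lambda>i. if i = 0 then y else w) \<sigma>" by (auto simp: stF_def Fr_def cd.simps)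
next
  assume "\<exists>y. Fr \<zeta> \<sigma> k y \<and> msat M (\<lambda>i. if i = 0 then y else w) \<sigma>"
  then obtain y where y: "IND (stF \<zeta> \<sigma>) (pr k y)" "msat M (\<lambda>i. if i = 0 then y else w) \<sigma>"
    by (auto simp: Fr_def)
  show "Fr \<zeta> \<sigma> (S k) w" unfolding Fr_def
    by (rule IND_intro1[OF mono_stF y(1)]) (auto simp: stF_def y(2))
qed

lemma relstruct_Fr:
  assumes f: "sigma1_interp f" and R: "rel_arith (Rf M f)"
  shows "relstruct M (Rf M f) (Fr (f 1 1) (f 2 2))"
proof -
  have ai: "arith_interp f" and s1: "\<And>P n. sigma1 (f P n)" using f by (auto simp: sigma1_interp_def)
  interpret rel_arith "Rf M f" by (rule R)
  show ?thesis
  proof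
    show "SD M (\<lambda>e. Rf M f P (map (\<lambda>t. t e) ts))" if "\<And>t. t \<in> set ts \<Longrightarrow> TD M t" for P ts
    proof -
      have "TD M (\<lambda>e. if i < length (map (\<lambda>t. t e) ts) then map (\<lambda>t. t e) ts ! i else \<zero>)" for i
        by (cases "i < length ts") (auto intro: that TD_const)
      then show ?thesis
        unfolding Rf_def length_map by (intro SD_fm) (use s1 in \<open>auto intro: sigma1_sigma_fm\<close>)
    qed
    show "SD M (\<lambda>e. Fr (f 1 1) (f 2 2) (e 0) (e 1))"
      by (rule SD_dsig[OF dsig_FF dsat_FF]) (intro sigma1_sigma_fm s1)+
    show "Fr (f 1 1) (f 2 2) \<zero> y \<longleftrightarrow> Rf M f 1 [y]" for y
      using Rf_iff[OF ai, of "[y]" "\<lambda>_. y" M 1] by (simp add: Fr_zero)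
    show "Fr (f 1 1) (f 2 2) (S k) z \<longleftrightarrow> (\<exists>y. Fr (f 1 1) (f 2 2) k y \<and> Rf M f 2 [y, z])" for k z
    proof -
      have "msat M (\<lambda>i. if i = 0 then y else z) (f 2 2) \<longleftrightarrow> Rf M f 2 [y, z]" for y
      proof -
        have "(if i = 0 then y else z) = [y, z] ! i" if "i < length [y, z]" for i
          using that by (auto simp: less_Suc_eq)
        from Rf_iff[OF ai this, of M 2] show ?thesis by (simp add: numeral_2_eq_2)
      qed
      then show ?thesis by (simp add: Fr_Suc)
    qed
  qed
qed

end

section \<open>Theories extending \<open>I\<Sigma>\<^sub>1\<close>\<close>

lemma msat_Iff: "msat M e (Iff \<phi> \<psi>) \<longleftrightarrow> (msat M e \<phi> \<longleftrightarrow> msat M e \<psi>)"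
  by auto

locale arith_theory =
  fixes T :: "fm set" and \<tau> :: fm
  assumes ISigma1_subset: "Th ISigma1 \<subseteq> Th T"
    and sigma1_tau: "sigma1 \<tau>" and definition_tau: "is_definition \<tau> T"
begin

lemma ISigma1_provable: "\<phi> \<in> ISigma1 \<Longrightarrow> T \<turnstile> \<phi>"
proof -
  assume \<phi>: "\<phi> \<in> ISigma1"
  then have "sentence \<phi>" by (auto simp: ISigma1_def sentence_univ_closure)
  then show ?thesis using \<phi> ISigma1_subset proves.ax[of \<phi> ISigma1] by (auto simp: Th_def)
qed

lemma isig_model: "models M T \<Longrightarrow> isig M"
  using ISigma1_provable soundness unfolding isig_def models_def by blast

lemma proves_instance: "T \<turnstile> univ_closure \<phi> \<Longrightarrow> T \<turnstile> \<phi>"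
  unfolding univ_closure_def using proves_psubst_foralls[of T Var] proves_psubst
  by (metis psubst_Var)

lemma proves_iff: "T \<turnstile> \<phi> \<longleftrightarrow> (\<forall>(M :: nat model) e. models M T \<longrightarrow> msat M e \<phi>)"
proof
  assume "T \<turnstile> \<phi>"
  then show "\<forall>(M :: nat model) e. models M T \<longrightarrow> msat M e \<phi>" using soundness by blast
next
  have Q: "T \<turnstile> \<phi>" if "\<phi> \<in> set Q_axioms" for \<phi>
    by (rule proves_instance, rule ISigma1_provable) (use that in \<open>simp add: ISigma1_def\<close>)
  have ax: "T \<turnstile> Imp (Eq (Succ (Var 0)) (Succ (Var 1))) (Eq (Var 0) (Var 1))"
    "T \<turnstile> Neg (Eq (Succ (Var 0)) Zero)"
    by (rule Q, simp add: Q_axioms_def)+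
  assume "\<forall>(M :: nat model) e. models M T \<longrightarrow> msat M e \<phi>"
  then show "T \<turnstile> \<phi>" using completeness[OF ax, of \<phi>] by blast
qed

lemma PR_provable_dot: "models M T \<Longrightarrow> T \<turnstile> \<phi> \<Longrightarrow> isig.PR M \<tau> (isig.qf M 0 \<phi> e)"
proof -
  assume M: "models M T" and \<phi>: "T \<turnstile> \<phi>"
  interpret isig M by (rule isig_model[OF M])
  show "PR \<tau> (qf 0 \<phi> e)"
    by (rule PR_dot[OF \<phi>]) (rule definition_sat[OF sigma1_tau definition_tau])
qed

lemma PR_imp:
  assumes M: "models M T" and "T \<turnstile> Imp \<phi> \<psi>" and "isig.PR M \<tau> (isig.qf M 0 \<phi> e)"
  shows "isig.PR M \<tau> (isig.qf M 0 \<psi> e)"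
proof -
  interpret isig M by (rule isig_model[OF M])
  show "PR \<tau> (qf 0 \<psi> e)" using PR_Imp[OF PR_provable_dot[OF M assms(2)] assms(3)] .
qed

lemma PR_cong: "models M T \<Longrightarrow> T \<turnstile> Iff \<phi> \<psi> \<Longrightarrow>
    isig.PR M \<tau> (isig.qf M 0 \<phi> e) \<longleftrightarrow> isig.PR M \<tau> (isig.qf M 0 \<psi> e)"
proof -
  assume M: "models M T" and eq: "T \<turnstile> Iff \<phi> \<psi>"
  have "T \<turnstile> Imp \<phi> \<psi>" "T \<turnstile> Imp \<psi> \<phi>" using eq unfolding proves_iff by auto
  then show ?thesis using PR_imp[OF M] by blast
qed

end

lemma interpret_foralls: "interpret_fm f \<tau> ((MAll ^^ n) A) = (Forall ^^ n) (interpret_fm f \<tau> A)"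
  by (induction n) auto

lemma finite_mfv [simp]: "finite (mfv A)"
proof (induction A)
  case (MAll A)
  have "{i. Suc i \<in> mfv A} = Suc -` mfv A" by auto
  then show ?case using MAll by (simp add: finite_vimageI)
qed auto

lemma mfv_foralls: "mfv ((MAll ^^ n) A) = {i. i + n \<in> mfv A}"
  by (induction n) auto

definition mclosure :: "mfm \<Rightarrow> mfm" where
  "mclosure A = (MAll ^^ Suc (Max (insert 0 (mfv A)))) A"

lemma mfv_mclosure: "mfv (mclosure A) = {}"
proof -
  have "i \<le> Max (insert 0 (mfv A))" if "i \<in> mfv A" for i using that by (intro Max_ge) auto
  then show ?thesis unfolding mclosure_def mfv_foralls by fastforce
qed

lemma (in arith_theory) mclosure_in_QPL:
  "mclosure A \<in> QPL_Sigma1 \<tau> T \<longleftrightarrow>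
    (\<forall>f (M :: nat model) e. sigma1_interp f \<longrightarrow> models M T \<longrightarrow> msat M e (interpret_fm f \<tau> A))"
proof -
  have "T \<turnstile> interpret_fm f \<tau> (mclosure A) \<longleftrightarrow>
      (\<forall>(M :: nat model) e. models M T \<longrightarrow> msat M e (interpret_fm f \<tau> A))" for f
    unfolding proves_iff mclosure_def interpret_foralls using msat_foralls by blast
  then show ?thesis unfolding QPL_Sigma1_def by (auto simp: mfv_mclosure)
qed

section \<open>From provably equivalent provability predicates to inclusion\<close>

text \<open>Only the box needs an argument: the hypothesis changes the predicate in front of a fixed
  formula, and the induction hypothesis, being a theorem of \<open>T\<^sub>1\<close>, changes the
  formula behind the predicate of \<open>T\<^sub>1\<close>.\<close>

lemma QPL_mono:
  assumes "arith_theory T\<^sub>0 \<tau>\<^sub>0" "arith_theory T\<^sub>1 \<tau>\<^sub>1" "Th T\<^sub>0 \<subseteq> Th T\<^sub>1"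
    and equiv: "\<And>\<phi>. T\<^sub>1 \<turnstile> univ_closure (Iff (Pr_dot \<tau>\<^sub>0 \<phi>) (Pr_dot \<tau>\<^sub>1 \<phi>))"
  shows "QPL_Sigma1 \<tau>\<^sub>0 T\<^sub>0 \<subseteq> QPL_Sigma1 \<tau>\<^sub>1 T\<^sub>1"
proof
  interpret T0: arith_theory T\<^sub>0 \<tau>\<^sub>0 by fact
  interpret T1: arith_theory T\<^sub>1 \<tau>\<^sub>1 by fact
  fix A assume A: "A \<in> QPL_Sigma1 \<tau>\<^sub>0 T\<^sub>0"
  have eq: "T\<^sub>1 \<turnstile> Iff (interpret_fm f \<tau>\<^sub>0 B) (interpret_fm f \<tau>\<^sub>1 B)" for f B
  proof (induction B)
    case (MBox B)
    show ?case
      unfolding T1.proves_iff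
    proof (intro allI impI)
      fix M :: "nat model" and e
      assume M: "models M T\<^sub>1"
      interpret isig M by (rule T1.isig_model[OF M])
      have "msat M e (Iff (Pr_dot \<tau>\<^sub>0 \<phi>) (Pr_dot \<tau>\<^sub>1 \<phi>))" for \<phi>
        using T1.proves_instance[OF equiv] M unfolding T1.proves_iff by blast
      then have "PR \<tau>\<^sub>0 (qf 0 \<phi> e) \<longleftrightarrow> PR \<tau>\<^sub>1 (qf 0 \<phi> e)" for \<phi>
        unfolding msat_Iff msat_Pr_dot by blast
      moreover have "PR \<tau>\<^sub>1 (qf 0 (interpret_fm f \<tau>\<^sub>0 B) e) \<longleftrightarrow> PR \<tau>\<^sub>1 (qf 0 (interpret_fm f \<tau>\<^sub>1 B) e)"
        by (rule T1.PR_cong[OF M MBox])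
      ultimately show "msat M e (Iff (interpret_fm f \<tau>\<^sub>0 (MBox B)) (interpret_fm f \<tau>\<^sub>1 (MBox B)))"
        unfolding interpret_fm.simps(6) msat_Iff msat_Pr_dot by blast
    qed
  qed (unfold T1.proves_iff msat_Iff interpret_fm.simps msat.simps, blast+)
  have "T\<^sub>1 \<turnstile> interpret_fm f \<tau>\<^sub>1 A" if f: "sigma1_interp f" for f
  proof -
    have "T\<^sub>0 \<turnstile> univ_closure (interpret_fm f \<tau>\<^sub>0 A)"
      using A f by (intro proves_univ_closure) (simp add: QPL_Sigma1_def)
    then have "univ_closure (interpret_fm f \<tau>\<^sub>0 A) \<in> Th T\<^sub>1"
      using assms(3) sentence_univ_closure by (auto simp: Th_def)
    then have "T\<^sub>1 \<turnstile> interpret_fm f \<tau>\<^sub>0 A" using T1.proves_instance unfolding Th_def by blast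
    then show ?thesis using eq[of f A] unfolding T1.proves_iff msat_Iff by blast
  qed
  then show "A \<in> QPL_Sigma1 \<tau>\<^sub>1 T\<^sub>1" using A by (simp add: QPL_Sigma1_def)
qed

section \<open>From inclusion to provably equivalent provability predicates\<close>

text \<open>Witnesses are compared for \<open>\<Delta>\<^sub>0\<close> matrices because only \<open>\<Delta>\<^sub>0\<close> formulas are known to be absolute
  between the two structures before the isomorphism is established.\<close>

definition K1 :: fm where
  "K1 = (SOME \<kappa>. delta0 \<kappa> \<and> (\<forall>(M :: nat model) e. models M ISigma1 \<longrightarrow>
    (msat M e (Univ1 0) \<longleftrightarrow> (\<exists>s. msat M (s ## e) \<kappa>))))"

definition K0 :: fm where
  "K0 = (SOME \<kappa>. delta0 \<kappa> \<and> (\<forall>(M :: nat model) e. models M ISigma1 \<longrightarrow>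
    (msat M e (Univ0 0) \<longleftrightarrow> (\<exists>s. msat M (s ## e) \<kappa>))))"

lemma K1: "delta0 K1" "models (M :: nat model) ISigma1 \<Longrightarrow> msat M e (Univ1 0) \<longleftrightarrow> (\<exists>s. msat M (s ## e) K1)"
  using someI_ex[OF witness_formula[OF dsig_Univ(1), where 'a = nat], folded K1_def] by blast+

lemma K0: "delta0 K0" "models (M :: nat model) ISigma1 \<Longrightarrow> msat M e (Univ0 0) \<longleftrightarrow> (\<exists>s. msat M (s ## e) K0)"
  using someI_ex[OF witness_formula[OF dsig_Univ(2), where 'a = nat], folded K0_def] by blast+

definition mstruct :: mfm where
  "mstruct = MConj marith (mcoding K1 K0)"

lemma (in isig) msat_mstruct: "arith_interp f \<Longrightarrow>
    msat M e (interpret_fm f \<tau> mstruct) \<longleftrightarrow> rel_arith (Rf M f) \<and> rel_coding K1 K0 (Rf M f)"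
  by (simp add: mstruct_def msat_marith msat_mcoding)

lemma onto:
  fixes M :: "nat model"
  assumes "isig M" "sigma1_interp f" "msat M e (interpret_fm f \<tau> mstruct)"
  shows "\<exists>a. isig.Fr M (f 1 1) (f 2 2) a c"
proof -
  interpret isig M by fact
  have R: "rel_arith (Rf M f)" "rel_coding K1 K0 (Rf M f)"
    using assms(2,3) msat_mstruct by (auto simp: sigma1_interp_def)
  interpret relstruct M "Rf M f" "Fr (f 1 1) (f 2 2)"
    by (rule relstruct_Fr[OF assms(2) R(1)])
  show ?thesis
    by (rule F_onto[OF R(2) K1(1) K0(1) K1(2)[OF models_ISigma1] K0(2)[OF models_ISigma1]])
qed

text \<open>\<open>mstruct\<close> describes the structure and not the values of variables, so the
  environment \<open>e0\<close> in which it holds may differ from the two that are compared.\<close>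

lemma rsat_iso:
  fixes M :: "nat model"
  assumes "isig M" "sigma1_interp f" "msat M e0 (interpret_fm f \<tau> mstruct)"
    and "\<And>i. i \<in> fv \<phi> \<Longrightarrow> isig.Fr M (f 1 1) (f 2 2) (e i) (e' i)"
  shows "msat M e' (interpret_fm f \<tau>' (rf \<phi>)) \<longleftrightarrow> msat M e \<phi>"
proof -
  interpret isig M by fact
  have f: "arith_interp f" using assms(2) by (simp add: sigma1_interp_def)
  have R: "rel_arith (Rf M f)" using assms(3) msat_mstruct[OF f] by auto
  interpret relstruct M "Rf M f" "Fr (f 1 1) (f 2 2)"
    by (rule relstruct_Fr[OF assms(2) R])
  show ?thesis
    unfolding msat_rf[OF f] using onto[OF assms(1-3)] assms(4) by (rule rsat_F_onto)
qed

lemma std_mstruct: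
  fixes M :: "nat model"
  assumes "isig M"
  shows "msat M e (interpret_fm std_interp \<tau> mstruct)"
proof -
  interpret isig M by fact
  show ?thesis
    using msat_mstruct[OF arith_std_interp] rel_arith_Rs rel_coding_Rs[OF K1(1) K0(1)] by blast
qed

lemma std_rf:
  fixes M :: "nat model"
  assumes "isig M"
  shows "msat M e (interpret_fm std_interp \<tau> (rf \<phi>)) \<longleftrightarrow> msat M e \<phi>"
proof -
  interpret isig M by fact
  show ?thesis by (simp add: msat_rf[OF arith_std_interp] rsat_Rs)
qed

lemma QPL_imp_Th:
  assumes "arith_theory T\<^sub>0 \<tau>\<^sub>0" "arith_theory T\<^sub>1 \<tau>\<^sub>1"
    and sub: "QPL_Sigma1 \<tau>\<^sub>0 T\<^sub>0 \<subseteq> QPL_Sigma1 \<tau>\<^sub>1 T\<^sub>1"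
  shows "Th T\<^sub>0 \<subseteq> Th T\<^sub>1"
proof
  interpret T0: arith_theory T\<^sub>0 \<tau>\<^sub>0 by fact
  interpret T1: arith_theory T\<^sub>1 \<tau>\<^sub>1 by fact
  fix \<phi> assume "\<phi> \<in> Th T\<^sub>0"
  then have \<phi>: "sentence \<phi>" "T\<^sub>0 \<turnstile> \<phi>" by (auto simp: Th_def)
  have "mclosure (MImp mstruct (rf \<phi>)) \<in> QPL_Sigma1 \<tau>\<^sub>0 T\<^sub>0"
    unfolding T0.mclosure_in_QPL
  proof (intro allI impI)
    fix f and M :: "nat model" and e
    assume f: "sigma1_interp f" and M: "models M T\<^sub>0"
    have "msat M e (interpret_fm f \<tau>\<^sub>0 (rf \<phi>))" if "msat M e (interpret_fm f \<tau>\<^sub>0 mstruct)"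
      \<comment> \<open>In a sentence no variables have to correspond, so one environment serves on
        both sides.\<close>
      using rsat_iso[OF T0.isig_model[OF M] f that, of \<phi> e e \<tau>\<^sub>0] \<phi> M
      by (auto simp: sentence_def T0.proves_iff)
    then show "msat M e (interpret_fm f \<tau>\<^sub>0 (MImp mstruct (rf \<phi>)))" by simp
  qed
  then have "mclosure (MImp mstruct (rf \<phi>)) \<in> QPL_Sigma1 \<tau>\<^sub>1 T\<^sub>1" using sub by blast
  then have "msat M e (interpret_fm std_interp \<tau>\<^sub>1 (MImp mstruct (rf \<phi>)))"
    if "models M T\<^sub>1" for M :: "nat model" and e
    using that sigma1_std_interp unfolding T1.mclosure_in_QPL by blast
  then have "msat M e \<phi>" if "models M T\<^sub>1" for M :: "nat model" and e
    using that std_mstruct[OF T1.isig_model[OF that], of e \<tau>\<^sub>1] std_rf[OF T1.isig_model[OF that], of e \<tau>\<^sub>1 \<phi>]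
    by auto
  then have "T\<^sub>1 \<turnstile> \<phi>" unfolding T1.proves_iff by blast
  then show "\<phi> \<in> Th T\<^sub>1" using \<phi>(1) by (simp add: Th_def)
qed

lemma (in isig) qt_cong: "(\<And>i. i + n \<in> fv_tm t \<Longrightarrow> e i = e' i) \<Longrightarrow> qt n t e = qt n t e'"
proof (induction t)
  case (Var i)
  then show ?case using Var[of "i - n"] by auto
qed auto

lemma (in isig) qf_cong: "(\<And>i. i + n \<in> fv \<phi> \<Longrightarrow> e i = e' i) \<Longrightarrow> qf n \<phi> e = qf n \<phi> e'"
proof (induction \<phi> arbitrary: n)
  case (Eq s t)
  then show ?case using qt_cong[of n s e e'] qt_cong[of n t e e'] by auto
next
  case (Lt s t)
  then show ?case using qt_cong[of n s e e'] qt_cong[of n t e e'] by auto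
next
  case (Imp \<phi> \<psi>)
  then show ?case using Imp.IH(1)[of n] Imp.IH(2)[of n] by auto
next
  case (Neg \<phi>)
  then show ?case using Neg.IH[of n] by auto
next
  case (Forall \<phi>)
  then show ?case using Forall.IH[of "Suc n"] by auto
qed

text \<open>Instances of formalized \<open>\<Sigma>\<^sub>1\<close>-completeness. As hypotheses of the modal formula they have to be verified
  for the standard interpretation only.\<close>

definition mpersist :: mfm where
  "mpersist = MConj (MAll (MImp (MPred 1 [0]) (MBox (MPred 1 [0]))))
     (MAll (MAll (MImp (MPred 2 [1, 0]) (MBox (MPred 2 [1, 0])))))"

text \<open>Formalized \<Sigma>1-completeness for the single formula F: along its derivation in
  \<open>M\<close>, \<open>mpersist\<close> turns each step into a provable one. The induction is
  legitimate because \<open>Pr_dot\<close> is \<Sigma>1.\<close>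

lemma (in arith_theory) PR_FF:
  fixes M :: "nat model"
  assumes M: "models M T" and f: "sigma1_interp f"
    and persist: "msat M e (interpret_fm f \<tau> mpersist)"
    and F: "isig.Fr M (f 1 1) (f 2 2) x y"
  shows "isig.PR M \<tau> (isig.qf M 0 (FF (f 1 1) (f 2 2)) (x ## (\<lambda>_. y)))"
proof -
  interpret isig M by (rule isig_model[OF M])
  have ai: "arith_interp f" using f by (simp add: sigma1_interp_def)
  let ?F = "FF (f 1 1) (f 2 2)"
  let ?Q = "\<lambda>z. \<exists>x y. z = pr x y \<and> PR \<tau> (qf 0 ?F (x ## (\<lambda>_. y)))"
  define Z where "Z = interpret_fm f \<tau> (MPred 1 [0])"
  define \<Sigma> where "\<Sigma> = interpret_fm f \<tau> (MPred 2 [1, 0])"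
  have Zs: "msat N e Z \<longleftrightarrow> msat N (\<lambda>_. e 0) (f 1 1)" for N :: "nat model" and e
    unfolding Z_def interpret_fm.simps(1) msat_psubst
    by (rule msat_cong[THEN trans]) (use ai in \<open>auto simp: arith_interp_def\<close>)
  have Ss: "msat N e \<Sigma> \<longleftrightarrow> msat N (\<lambda>i. if i = 0 then e 1 else e 0) (f 2 2)" for N :: "nat model" and e
    unfolding \<Sigma>_def interpret_fm.simps(1) msat_psubst
    by (rule msat_cong[THEN trans]) (use ai in \<open>auto simp: arith_interp_def less_Suc_eq numeral_2_eq_2\<close>)
  have "msat M (a ## e) (Imp Z (Pr_dot \<tau> Z))" "msat M (b ## a ## e) (Imp \<Sigma> (Pr_dot \<tau> \<Sigma>))" for a b
    using persist unfolding mpersist_def interpret_fm.simps(2-6) Z_def[symmetric] \<Sigma>_def[symmetric] by simp_all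
  note persist = this[unfolded msat.simps msat_Pr_dot]
  have pZ: "PR \<tau> (qf 0 Z (a ## e))" if "msat M (\<lambda>_. a) (f 1 1)" for a
    using persist(1) that Zs[of M "a ## e"] by simp
  have pS: "PR \<tau> (qf 0 \<Sigma> (b ## a ## e))" if "msat M (\<lambda>i. if i = 0 then a else b) (f 2 2)" for a b
    using persist(2) that Ss[of M "b ## a ## e"] by (simp cong: if_cong)
  have "?Q (pr x y)"
  proof (rule IND_induct[OF mono_stF F[unfolded Fr_def], of ?Q])
    have "sigma_fm (Pr_dot \<tau> ?F)" by (rule sigma_Pr_dot[OF sigma1_tau])
    then have 1: "SD M (\<lambda>e. PR \<tau> (qf 0 ?F (e 1 ## (\<lambda>_. e 0))))"
      using SD_fm[of "Pr_dot \<tau> ?F" M "\<lambda>e. e 1 ## (\<lambda>_. e 0)"] by (simp add: TD_econs TD_var msat_Pr_dot)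
    have 2: "SD M (\<lambda>e. e 2 = pr (e 1) (e 0))"
      unfolding ispr_iff[symmetric] ispr_def by (intro SD_delta DDs TD_intros)
    show "SD M (\<lambda>e. ?Q (e 0))"
      by (intro SD_ex SD_conj) (use 1 2 in \<open>simp_all add: numeral_2_eq_2\<close>)
  next
    fix z assume "stF (f 1 1) (f 2 2) ?Q z"
    then consider a where "z = pr \<zero> a" "msat M (\<lambda>_. a) (f 1 1)"
      | k a b where "z = pr (S k) b" "PR \<tau> (qf 0 ?F (k ## (\<lambda>_. a)))" "msat M (\<lambda>i. if i = 0 then a else b) (f 2 2)"
      unfolding stF_def by (auto simp: cd.simps)
    then show "?Q z"
    proof cases
      case 1
      let ?\<sigma> = "Zero ## (\<lambda>_. Var 0)"
      have "T \<turnstile> Imp Z (psubst ?\<sigma> ?F)"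
        unfolding proves_iff
      proof (intro allI impI)
        fix N :: "nat model" and e assume "models N T"
        then interpret N: isig N by (rule isig_model)
        show "msat N e (Imp Z (psubst ?\<sigma> ?F))"
          by (simp add: msat_psubst Zs N.msat_FF N.Fr_zero)
      qed
      from PR_imp[OF M this pZ[OF 1(2)]] have "PR \<tau> (qf 0 (psubst ?\<sigma> ?F) (a ## e))" .
      moreover have "qf 0 (psubst ?\<sigma> ?F) (a ## e) = qf 0 ?F (\<zero> ## (\<lambda>_. a))"
        by (rule qf0_psubst) (simp add: numc_zero split: nat.split)
      ultimately show ?thesis using 1(1) by auto
    next
      case 2
      \<comment> \<open>In the context \<open>b ## a ## k\<close>, the premise says that a is the
        k-th numeral, the conclusion that b is the next one. \<open>Succ (Var 2)\<close> quotes to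
        the numeral of \<open>S k\<close>.\<close>
      let ?\<sigma> = "Var 2 ## (\<lambda>_. Var 1)" and ?\<rho> = "Succ (Var 2) ## (\<lambda>_. Var 0)"
      have T: "T \<turnstile> Imp \<Sigma> (Imp (psubst ?\<sigma> ?F) (psubst ?\<rho> ?F))"
        unfolding proves_iff
      proof (intro allI impI)
        fix N :: "nat model" and e assume "models N T"
        then interpret N: isig N by (rule isig_model)
        show "msat N e (Imp \<Sigma> (Imp (psubst ?\<sigma> ?F) (psubst ?\<rho> ?F)))"
          by (auto simp: msat_psubst Ss N.msat_FF N.Fr_Suc cong: if_cong)
      qed
      let ?e = "b ## a ## k ## e"
      have "fv \<Sigma> \<subseteq> {0, 1}"
        using ai unfolding \<Sigma>_def interpret_fm.simps(1) fv_psubst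
        by (auto simp: arith_interp_def less_Suc_eq numeral_2_eq_2)
      then have "qf 0 \<Sigma> (b ## a ## e) = qf 0 \<Sigma> ?e"
        by (intro qf_cong) auto
      then have "PR \<tau> (qf 0 \<Sigma> ?e)" using pS[OF 2(3)] by simp
      from PR_imp[OF M T this] have "PR \<tau> (qf 0 (Imp (psubst ?\<sigma> ?F) (psubst ?\<rho> ?F)) ?e)" .
      moreover have "qf 0 (psubst ?\<sigma> ?F) ?e = qf 0 ?F (k ## (\<lambda>_. a))"
        by (rule qf0_psubst) (simp add: numeral_2_eq_2 split: nat.split)
      moreover have "qf 0 (psubst ?\<rho> ?F) ?e = qf 0 ?F (S k ## (\<lambda>_. b))"
        by (rule qf0_psubst) (simp add: numeral_2_eq_2 numc_Suc split: nat.split)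
      ultimately have "PR \<tau> (qf 0 ?F (S k ## (\<lambda>_. b)))" using 2(2) PR_mp by simp
      then show ?thesis using 2(1) by blast
    qed
  qed
  then show ?thesis by simp
qed

lemma (in isig) PR_foldr:
  "PR \<tau> (qf 0 (foldr Imp \<phi>s \<psi>) e) \<Longrightarrow> (\<And>\<phi>. \<phi> \<in> set \<phi>s \<Longrightarrow> PR \<tau> (qf 0 \<phi> e)) \<Longrightarrow> PR \<tau> (qf 0 \<psi> e)"
  by (induction \<phi>s) (auto intro: PR_mp)

lemma msat_foldr: "msat M e (foldr Imp \<phi>s \<psi>) \<longleftrightarrow> ((\<forall>\<phi>\<in>set \<phi>s. msat M e \<phi>) \<longrightarrow> msat M e \<psi>)"
  by (induction \<phi>s) auto

text \<open>The environment \<open>e\<close> sits on the even variables and its image \<open>e'\<close> on the odd ones; the proof of the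
  isomorphism theorem is reproduced inside the provability predicate.\<close>

lemma (in arith_theory) PR_iso:
  fixes M :: "nat model"
  assumes M: "models M T" and f: "sigma1_interp f"
    and box: "isig.PR M \<tau> (isig.qf M 0 (interpret_fm f \<tau> mstruct) e')"
    and persist: "msat M e' (interpret_fm f \<tau> mpersist)"
    and F: "\<And>i. isig.Fr M (f 1 1) (f 2 2) (e i) (e' i)"
  shows "isig.PR M \<tau> (isig.qf M 0 \<phi> e) \<longleftrightarrow> isig.PR M \<tau> (isig.qf M 0 (interpret_fm f \<tau> (rf \<phi>)) e')"
proof -
  interpret isig M by (rule isig_model[OF M])
  obtain n where n: "fv \<phi> \<subseteq> {..<n}" by (rule fv_bounded)
  let ?F = "FF (f 1 1) (f 2 2)"
  let ?l = "psubst (\<lambda>i. Var (2 * i))" and ?r = "psubst (\<lambda>i. Var (2 * i + 1))"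
  let ?Fs = "map (\<lambda>i. psubst (Var (2 * i) ## (\<lambda>_. Var (2 * i + 1))) ?F) [0..<n]"
  let ?e = "mix e e'"
  \<comment> \<open>The isomorphism becomes one theorem of T, with a hypothesis on F for each of the
    finitely many variables that may occur in \<phi>. Its hypotheses are then detached inside the
    provability predicate.\<close>
  have "T \<turnstile> foldr Imp (?r (interpret_fm f \<tau> mstruct) # ?Fs) (Iff (?l \<phi>) (?r (interpret_fm f \<tau> (rf \<phi>))))"
    unfolding proves_iff
  proof (intro allI impI)
    fix N :: "nat model" and \<epsilon> assume "models N T"
    then interpret N: isig N by (rule isig_model)
    have "msat N (\<lambda>i. \<epsilon> (2 * i)) \<phi> \<longleftrightarrow> msat N (\<lambda>i. \<epsilon> (2 * i + 1)) (interpret_fm f \<tau> (rf \<phi>))"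
      if 1: "msat N (\<lambda>i. \<epsilon> (2 * i + 1)) (interpret_fm f \<tau> mstruct)"
        and 2: "\<forall>i<n. N.Fr (f 1 1) (f 2 2) (\<epsilon> (2 * i)) (\<epsilon> (2 * i + 1))"
      by (rule rsat_iso[OF N.isig_axioms f 1, symmetric]) (use n 2 in auto)
    then show "msat N \<epsilon> (foldr Imp (?r (interpret_fm f \<tau> mstruct) # ?Fs)
        (Iff (?l \<phi>) (?r (interpret_fm f \<tau> (rf \<phi>)))))"
      unfolding msat_foldr by (auto simp: msat_psubst N.msat_FF)
  qed
  from PR_provable_dot[OF M this, of ?e]
  have "PR \<tau> (qf 0 (Iff (?l \<phi>) (?r (interpret_fm f \<tau> (rf \<phi>)))) ?e)"
  proof (rule PR_foldr)
    have r: "qf 0 (?r \<psi>) ?e = qf 0 \<psi> e'" for \<psi>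
      by (rule qf0_psubst) (simp add: mix_def)
    fix \<psi> assume "\<psi> \<in> set (?r (interpret_fm f \<tau> mstruct) # ?Fs)"
    then consider "\<psi> = ?r (interpret_fm f \<tau> mstruct)"
      | i where "\<psi> = psubst (Var (2 * i) ## (\<lambda>_. Var (2 * i + 1))) ?F" by auto
    then show "PR \<tau> (qf 0 \<psi> ?e)"
    proof cases
      case 1
      then show ?thesis using box r by simp
    next
      case (2 i)
      have "qf 0 \<psi> ?e = qf 0 ?F (e i ## (\<lambda>_. e' i))"
        unfolding 2 by (rule qf0_psubst) (simp add: mix_def split: nat.split)
      then show ?thesis using PR_FF[OF M f persist F] by simp
    qed
  qed
  moreover have "T \<turnstile> Imp (Iff \<alpha> \<beta>) (Imp \<alpha> \<beta>)" "T \<turnstile> Imp (Iff \<alpha> \<beta>) (Imp \<beta> \<alpha>)" for \<alpha> \<beta>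
    unfolding proves_iff by auto
  ultimately have "PR \<tau> (qf 0 (?l \<phi>) ?e) \<longleftrightarrow> PR \<tau> (qf 0 (?r (interpret_fm f \<tau> (rf \<phi>))) ?e)"
    using PR_imp[OF M] PR_Imp by blast
  moreover have "qf 0 (?l \<phi>) ?e = qf 0 \<phi> e" "qf 0 (?r (interpret_fm f \<tau> (rf \<phi>))) ?e = qf 0 (interpret_fm f \<tau> (rf \<phi>)) e'"
    by (rule qf0_psubst, simp add: mix_def)+
  ultimately show ?thesis by simp
qed

text \<open>Under quotation \<open>S x\<close> becomes the successor of the numeral of x, so both
  kinds of true atomic facts quote to instances of \<open>Eq t t\<close>.\<close>

lemma (in arith_theory) std_persist:
  fixes M :: "nat model"
  assumes M: "models M T"
  shows "msat M e (interpret_fm std_interp \<tau> mpersist)"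
proof -
  interpret isig M by (rule isig_model[OF M])
  have refl: "PR \<tau> (qf 0 (Eq t t) e)" for t e
    by (rule PR_provable_dot[OF M]) (simp add: proves_iff)
  have "PR \<tau> (qf 0 (Eq (Var 0) Zero) (\<zero> ## e))" for e
    using refl[of Zero e] by (simp add: numc_zero)
  moreover have "PR \<tau> (qf 0 (Eq (Succ (Var 1)) (Var 0)) (S x ## x ## e))" for x e
    using refl[of "Succ (Var 0)" "\<lambda>_. x"] by (simp add: numc_Suc)
  ultimately show ?thesis
    by (auto simp: mpersist_def interpret_fm.simps(1) std_interp_def msat_Pr_dot)
qed

text \<open>\<open>rf (Pr_dot \<tau>\<^sub>0 \<phi>)\<close> contains no box, so it keeps speaking
  of \<open>\<tau>\<^sub>0\<close> in both theories, whereas the box is read as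
  \<open>\<tau>\<^sub>0\<close> in \<open>T\<^sub>0\<close> and as \<open>\<tau>\<^sub>1\<close> in
  \<open>T\<^sub>1\<close>. This is how one modal formula relates the two predicates.\<close>

lemma QPL_imp_Pr:
  assumes "arith_theory T\<^sub>0 \<tau>\<^sub>0" "arith_theory T\<^sub>1 \<tau>\<^sub>1"
    and sub: "QPL_Sigma1 \<tau>\<^sub>0 T\<^sub>0 \<subseteq> QPL_Sigma1 \<tau>\<^sub>1 T\<^sub>1"
  shows "T\<^sub>1 \<turnstile> univ_closure (Iff (Pr_dot \<tau>\<^sub>0 \<phi>) (Pr_dot \<tau>\<^sub>1 \<phi>))"
proof -
  interpret T0: arith_theory T\<^sub>0 \<tau>\<^sub>0 by fact
  interpret T1: arith_theory T\<^sub>1 \<tau>\<^sub>1 by fact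
  let ?B = "MImp mstruct (MImp (MBox mstruct) (MImp mpersist (MIff (rf (Pr_dot \<tau>\<^sub>0 \<phi>)) (MBox (rf \<phi>)))))"
  have "mclosure ?B \<in> QPL_Sigma1 \<tau>\<^sub>0 T\<^sub>0"
    unfolding T0.mclosure_in_QPL
  proof (intro allI impI)
    fix f and M :: "nat model" and e'
    assume f: "sigma1_interp f" and M: "models M T\<^sub>0"
    interpret isig M by (rule T0.isig_model[OF M])
    have "msat M e' (interpret_fm f \<tau>\<^sub>0 (rf (Pr_dot \<tau>\<^sub>0 \<phi>))) \<longleftrightarrow> PR \<tau>\<^sub>0 (qf 0 (interpret_fm f \<tau>\<^sub>0 (rf \<phi>)) e')"
      if s: "msat M e' (interpret_fm f \<tau>\<^sub>0 mstruct)" and b: "PR \<tau>\<^sub>0 (qf 0 (interpret_fm f \<tau>\<^sub>0 mstruct) e')"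
        and p: "msat M e' (interpret_fm f \<tau>\<^sub>0 mpersist)"
    proof -
      \<comment> \<open>As F is onto, the whole environment has a preimage under it.\<close>
      have "\<forall>i. \<exists>a. Fr (f 1 1) (f 2 2) a (e' i)" using onto[OF isig_axioms f s] by blast
      then obtain e where e: "\<And>i. Fr (f 1 1) (f 2 2) (e i) (e' i)" by metis
      show ?thesis
        unfolding rsat_iso[OF isig_axioms f s e] msat_Pr_dot by (rule T0.PR_iso[OF M f b p e])
    qed
    then show "msat M e' (interpret_fm f \<tau>\<^sub>0 ?B)"
      unfolding interpret_fm.simps msat_Iff msat.simps msat_Pr_dot by blast
  qed
  then have B: "msat M e (interpret_fm std_interp \<tau>\<^sub>1 ?B)" if "models M T\<^sub>1" for M :: "nat model" and e
    using sub that sigma1_std_interp T1.mclosure_in_QPL by blast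
  have "T\<^sub>1 \<turnstile> Iff (Pr_dot \<tau>\<^sub>0 \<phi>) (Pr_dot \<tau>\<^sub>1 \<phi>)"
    unfolding T1.proves_iff
  proof (intro allI impI)
    fix M :: "nat model" and e
    assume M: "models M T\<^sub>1"
    interpret isig M by (rule T1.isig_model[OF M])
    \<comment> \<open>The boxed hypothesis holds because the standard interpretation of
      \<open>mstruct\<close> is true in all models of \<open>T\<^sub>1\<close>, hence a
      theorem.\<close>
    have "T\<^sub>1 \<turnstile> interpret_fm std_interp \<tau>\<^sub>1 mstruct"
      unfolding T1.proves_iff using std_mstruct T1.isig_model by blast
    then have "PR \<tau>\<^sub>1 (qf 0 (interpret_fm std_interp \<tau>\<^sub>1 mstruct) e)" by (rule T1.PR_provable_dot[OF M])
    then have "msat M e (Pr_dot \<tau>\<^sub>0 \<phi>) \<longleftrightarrow> PR \<tau>\<^sub>1 (qf 0 (interpret_fm std_interp \<tau>\<^sub>1 (rf \<phi>)) e)"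
      using B[OF M, of e] std_mstruct[OF isig_axioms, of e \<tau>\<^sub>1] T1.std_persist[OF M, of e]
        std_rf[OF isig_axioms, of e \<tau>\<^sub>1 "Pr_dot \<tau>\<^sub>0 \<phi>"]
      unfolding interpret_fm.simps msat_Iff msat.simps msat_Pr_dot by blast
    moreover have "T\<^sub>1 \<turnstile> Iff (interpret_fm std_interp \<tau>\<^sub>1 (rf \<phi>)) \<phi>"
      unfolding T1.proves_iff msat_Iff using std_rf T1.isig_model by blast
    ultimately have "msat M e (Pr_dot \<tau>\<^sub>0 \<phi>) \<longleftrightarrow> PR \<tau>\<^sub>1 (qf 0 \<phi> e)" using T1.PR_cong[OF M] by blast
    then show "msat M e (Iff (Pr_dot \<tau>\<^sub>0 \<phi>) (Pr_dot \<tau>\<^sub>1 \<phi>))"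
      unfolding msat_Iff msat_Pr_dot by blast
  qed
  then show ?thesis by (rule proves_univ_closure)
qed

theorem theorem4p6:
  fixes T\<^sub>0 T\<^sub>1 :: "fm set" and \<tau>\<^sub>0 \<tau>\<^sub>1 :: fm
  assumes "re_theory T\<^sub>0" and "re_theory T\<^sub>1"
    and "Th ISigma1 \<subseteq> Th T\<^sub>0" and "Th ISigma1 \<subseteq> Th T\<^sub>1"
    and "sigma1 \<tau>\<^sub>0" and "is_definition \<tau>\<^sub>0 T\<^sub>0"
    and "sigma1 \<tau>\<^sub>1" and "is_definition \<tau>\<^sub>1 T\<^sub>1"
  shows "QPL_Sigma1 \<tau>\<^sub>0 T\<^sub>0 \<subseteq> QPL_Sigma1 \<tau>\<^sub>1 T\<^sub>1 \<longleftrightarrow>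
    Th T\<^sub>0 \<subseteq> Th T\<^sub>1 \<and>
    (\<forall>\<phi>. T\<^sub>1 \<turnstile> univ_closure (Iff (Pr_dot \<tau>\<^sub>0 \<phi>) (Pr_dot \<tau>\<^sub>1 \<phi>)))"
proof -
  have "arith_theory T\<^sub>0 \<tau>\<^sub>0" "arith_theory T\<^sub>1 \<tau>\<^sub>1" using assms by (simp_all add: arith_theory_def)
  then show ?thesis using QPL_mono QPL_imp_Th QPL_imp_Pr by blast
qed

end
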